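(* Assume that the objective function $F$ satisfies Assumption (F-strong) and that the diffusion coefficient $\sigma$ satisfies Assumption ($\sigma$-strong), as spelled out in the context. Let $\rho(T)=\int_0^T e^{2\mu s}\varsigma(s)^2\,ds$ for $T\in[0,\infty)$. There exist positive real numbers $H\in(0,h_{\max})$ and $C\in(0,\infty)$ such that, for any initial value $x_0\in\mathbb{R}^d$, all $N\in\mathbb{N}^\star$ and all $h\in(0,H)$, the iterates $X_n$ of the stochastic gradient scheme with step size $h$ and $X_0=x_0$ satisfy: (1) (weak error) for any mapping $\varphi:\mathbb{R}^d\to\mathbb{R}$ of class $\mathcal{C}^3$ with bounded second and third order derivatives, \[ \big|\mathbb{E}[\varphi(X_N)]-\varphi(x^\star)\big|\le C_2(\varphi,x_0)\left(e^{-\mu Nh}\left(1+h\rho(Nh)\right)^{\frac12}+h^2\right), \] where $C_2(\varphi,x_0)=C\bigl(\|\nabla\varphi(x^\star)\|+|||\varphi|||_2+|||\varphi|||_3\bigr)\bigl(1+\|x_0-x^\star\|^5\bigr)$; (2) (expected residual) \[ \mathbb{E}[F(X_N)]-F(x^\star)\le C\bigl(1+\|x_0-x^\star\|^5\bigr)\left(e^{-2\mu Nh}\left(1+h\rho(Nh)\right)+h^2\right); \] (3) (strong error) \[ \mathbb{E}[\|X_N-x^\star\|]\le \bigl(\mathbb{E}[\|X_N-x^\star\|^2]\bigr)^{\frac12}\le C\bigl(1+\|x_0-x^\star\|^{\frac52}\bigr)\left(e^{-\mu Nh}\left(1+h\rho(Nh)\right)^{\frac12}+h\right). \]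
   Context: Notation: $\mathbb{N}=\{0,1,\dots\}$, $\mathbb{N}^\star=\{1,2,\dots\}$, $d\in\mathbb{N}^\star$; $\|\cdot\|$ is the Euclidean norm on $\mathbb{R}^d$ and the Frobenius norm on the space $\mathcal{M}_d(\mathbb{R})$ of real $d\times d$ matrices. For $\varphi:\mathbb{R}^d\to\mathbb{R}$ of class $\mathcal{C}^m$, $|||\varphi|||_m=\sup_{x\in\mathbb{R}^d}\sup_{k_1,\dots,k_m\neq0}\frac{|D^m\varphi(x).(k_1,\dots,k_m)|}{\|k_1\|\cdots\|k_m\|}$. A positive real number $h_{\max}$ is fixed; step sizes satisfy $h\in(0,h_{\max})$, and $t_n=nh$. Scheme: for deterministic $x_0\in\mathbb{R}^d$ and $h\in(0,h_{\max})$, $X_0=x_0$ and $X_{n+1}=X_n-h\nabla F(X_n)+h\sigma(t_n,X_n)\gamma_{n+1}$ for $n\in\mathbb{N}$, where $(\gamma_n)_{n\ge1}$ are independent standard centered Gaussian random variables in $\mathbb{R}^d$. Assumption (F-strong): $F:\mathbb{R}^d\to\mathbb{R}$ is of class $\mathcal{C}^5$; $\nabla F$ is globally Lipschitz continuous; there are $\mu\in(0,\infty)$ and $h_0\in(0,h_{\max})$ such that $\langle\nabla F(x_2)-\nabla F(x_1),x_2-x_1\rangle\ge\mu\|x_2-x_1\|^2$ for all $x_1,x_2\in\mathbb{R}^d$ and, for all $h\in(0,h_0)$, the modified objective function $F^h=F+\frac h4\|\nabla F\|^2$ satisfies $\langle\nabla F^h(x_2)-\nabla F^h(x_1),x_2-x_1\rangle\ge\mu\|x_2-x_1\|^2$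 for all $x_1,x_2\in\mathbb{R}^d$; the third, fourth and fifth order derivatives of $F$ are bounded. Under this assumption $F$ has a unique minimizer, denoted $x^\star$. The $\mu$ in the claim is this constant. Assumption ($\sigma$-strong): $\sigma:[0,\infty)\times\mathbb{R}^d\to\mathcal{M}_d(\mathbb{R})$ is continuous, and there is a bounded (measurable) mapping $\varsigma:[0,\infty)\to[0,\infty)$ such that for all $t\ge0$: $\|\sigma(t,x_2)-\sigma(t,x_1)\|\le\varsigma(t)\|x_2-x_1\|$ for all $x_1,x_2\in\mathbb{R}^d$, and $\sup_{x\in\mathbb{R}^d}\frac{\|\sigma(t,x)\|}{1+\|x-x^\star\|}\le\varsigma(t)$. Moreover, for all $t\ge0$, $\sigma(t,\cdot)$ is of class $\mathcal{C}^3$, with second and third order derivatives bounded uniformly in $(t,x)\in[0,\infty)\times\mathbb{R}^d$; and there is $L_\sigma\in(0,\infty)$ such that $\|\sigma(t_2,x)-\sigma(t_1,x)\|\le L_\sigma|t_2-t_1|$ for all $t_1,t_2\ge0$ and $x\in\mathbb{R}^d$. *)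

theory Defs
  imports "HOL-Probability.Probability"
begin

section \<open>Derivatives of higher order\<close>

text \<open>
  On a finite-dimensional space, the map sending \<open>x\<close> to the Frechet derivative of \<open>f\<close> at \<open>x\<close>
  is of class \<open>C\<^sup>m\<close> if and only if all its evaluations at a fixed direction \<open>k\<close> are. Recursing
  through these evaluations keeps the type of the function unchanged.
\<close>

primrec C_class :: "nat \<Rightarrow> ('a::euclidean_space \<Rightarrow> 'b::real_normed_vector) \<Rightarrow> bool" where
  "C_class 0 f \<longleftrightarrow> continuous_on UNIV f"
| "C_class (Suc m) f \<longleftrightarrow> (\<forall>x. f differentiable (at x)) \<and>
     (\<forall>k. C_class m (\<lambda>x. frechet_derivative f (at x) k))"

text \<open>
  For \<open>f\<close> of class \<open>C\<^sup>m\<close>, \<open>iter_deriv f [k\<^sub>1, \<dots>, k\<^sub>m] x\<close> is \<open>D\<^sup>m f(x).(k\<^sub>1, \<dots>, k\<^sub>m)\<close>.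
\<close>

primrec iter_deriv :: "('a::euclidean_space \<Rightarrow> 'b::real_normed_vector) \<Rightarrow> 'a list \<Rightarrow> 'a \<Rightarrow> 'b" where
  "iter_deriv f [] = f"
| "iter_deriv f (k # ks) = (\<lambda>x. frechet_derivative (iter_deriv f ks) (at x) k)"

definition deriv_bounded_by ::
    "real \<Rightarrow> nat \<Rightarrow> ('a::euclidean_space \<Rightarrow> 'b::real_normed_vector) \<Rightarrow> bool" where
  "deriv_bounded_by B m f \<longleftrightarrow>
     (\<forall>x ks. length ks = m \<longrightarrow> norm (iter_deriv f ks x) \<le> B * prod_list (map norm ks))"

text \<open>
  The suprema are taken in \<open>real\<close>, so this is meaningful only when the derivative of order \<open>m\<close>
  is bounded.
\<close>

definition deriv_seminorm :: "nat \<Rightarrow> ('a::euclidean_space \<Rightarrow> real) \<Rightarrow> real" where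
  "deriv_seminorm m f =
     (SUP x. SUP ks\<in>{ks. length ks = m \<and> 0 \<notin> set ks}.
        \<bar>iter_deriv f ks x\<bar> / prod_list (map norm ks))"

definition grad :: "('a::euclidean_space \<Rightarrow> real) \<Rightarrow> 'a \<Rightarrow> 'a" where
  "grad f x = (THE D. GDERIV f x :> D)"


section \<open>Objective function\<close>

definition minimizer :: "('a::euclidean_space \<Rightarrow> real) \<Rightarrow> 'a" where
  "minimizer F = (THE x. \<forall>y. F x \<le> F y)"

definition strongly_monotone :: "real \<Rightarrow> ('a::euclidean_space \<Rightarrow> 'a) \<Rightarrow> bool" where
  "strongly_monotone \<mu> G \<longleftrightarrow> (\<forall>x1 x2. (G x2 - G x1) \<bullet> (x2 - x1) \<ge> \<mu> * (norm (x2 - x1))\<^sup>2)"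

definition modified_objective :: "real \<Rightarrow> ('a::euclidean_space \<Rightarrow> real) \<Rightarrow> 'a \<Rightarrow> real" where
  "modified_objective h F x = F x + h / 4 * (norm (grad F x))\<^sup>2"

definition F_strong :: "real \<Rightarrow> real \<Rightarrow> ('a::euclidean_space \<Rightarrow> real) \<Rightarrow> bool" where
  "F_strong hmax \<mu> F \<longleftrightarrow>
     C_class 5 F \<and>
     (\<exists>L. L-lipschitz_on UNIV (grad F)) \<and>
     0 < \<mu> \<and>
     (\<exists>h0. 0 < h0 \<and> h0 < hmax \<and>
        strongly_monotone \<mu> (grad F) \<and>
        (\<forall>h. 0 < h \<and> h < h0 \<longrightarrow> strongly_monotone \<mu> (grad (modified_objective h F)))) \<and>
     (\<forall>m\<in>{3, 4, 5}. \<exists>B. deriv_bounded_by B m F)"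


section \<open>Diffusion coefficient\<close>

text \<open>
  The norm of the type \<open>real^'n^'n\<close> is the Euclidean norm of the vector of norms of the rows,
  that is, the Frobenius norm. The functions \<open>\<sigma>\<close> and \<open>vsig\<close> are only constrained (and only used)
  at nonnegative times.
\<close>

definition sigma_strong ::
    "real^'n \<Rightarrow> (real \<Rightarrow> real) \<Rightarrow> (real \<Rightarrow> real^'n \<Rightarrow> real^'n^'n) \<Rightarrow> bool" where
  "sigma_strong xstar vsig \<sigma> \<longleftrightarrow>
     continuous_on ({0..} \<times> UNIV) (\<lambda>(t, x). \<sigma> t x) \<and>
     set_borel_measurable borel {0..} vsig \<and>
     bounded (vsig ` {0..}) \<and>
     (\<forall>t\<ge>0. 0 \<le> vsig t) \<and>
     (\<forall>t\<ge>0. \<forall>x1 x2. norm (\<sigma> t x2 - \<sigma> t x1) \<le> vsig t * norm (x2 - x1)) \<and>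
     (\<forall>t\<ge>0. \<forall>x. norm (\<sigma> t x) / (1 + norm (x - xstar)) \<le> vsig t) \<and>
     (\<forall>t\<ge>0. C_class 3 (\<sigma> t)) \<and>
     (\<forall>m\<in>{2, 3}. \<exists>B. \<forall>t\<ge>0. deriv_bounded_by B m (\<sigma> t)) \<and>
     (\<exists>L>0. \<forall>t1\<ge>0. \<forall>t2\<ge>0. \<forall>x. norm (\<sigma> t2 x - \<sigma> t1 x) \<le> L * \<bar>t2 - t1\<bar>)"

definition rho :: "real \<Rightarrow> (real \<Rightarrow> real) \<Rightarrow> real \<Rightarrow> real" where
  "rho \<mu> vsig T = (LBINT s:{0..T}. exp (2 * \<mu> * s) * (vsig s)\<^sup>2)"


section \<open>Stochastic gradient scheme\<close>

definition standard_gaussian :: "'w measure \<Rightarrow> ('w \<Rightarrow> real^'n) \<Rightarrow> bool" where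
  "standard_gaussian M Y \<longleftrightarrow>
     distributed M lborel Y (\<lambda>x. ennreal (\<Prod>i\<in>UNIV. std_normal_density (x $ i)))"

definition iid_standard_gaussian :: "'w measure \<Rightarrow> (nat \<Rightarrow> 'w \<Rightarrow> real^'n) \<Rightarrow> bool" where
  "iid_standard_gaussian M \<gamma> \<longleftrightarrow>
     prob_space.indep_vars M (\<lambda>_. borel) \<gamma> {1..} \<and> (\<forall>n\<ge>1. standard_gaussian M (\<gamma> n))"

primrec sg_scheme ::
    "(real^'n \<Rightarrow> real) \<Rightarrow> (real \<Rightarrow> real^'n \<Rightarrow> real^'n^'n) \<Rightarrow> (nat \<Rightarrow> 'w \<Rightarrow> real^'n) \<Rightarrow>
      real \<Rightarrow> real^'n \<Rightarrow> nat \<Rightarrow> 'w \<Rightarrow> real^'n" where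
  "sg_scheme F \<sigma> \<gamma> h x0 0 \<omega> = x0"
| "sg_scheme F \<sigma> \<gamma> h x0 (Suc n) \<omega> =
     sg_scheme F \<sigma> \<gamma> h x0 n \<omega>
       - h *\<^sub>R grad F (sg_scheme F \<sigma> \<gamma> h x0 n \<omega>)
       + h *\<^sub>R (\<sigma> (real n * h) (sg_scheme F \<sigma> \<gamma> h x0 n \<omega>) *v \<gamma> (Suc n) \<omega>)"

end

theory Submission
  imports Defs
begin

text \<open>
  Let \<open>e = \<parallel>x - x\<^sup>\<star>\<parallel>\<close>. The gradient step \<open>x - h \<nabla>F x\<close> is the value at time \<open>h\<close> of a curve that solves
  \<open>y' = - \<nabla>F\<^sup>h y\<close> up to \<open>O(h\<^sup>2)\<close>, so strong monotonicity of \<open>\<nabla>F\<^sup>h\<close> contracts \<open>e\<^sup>2\<close> by \<open>exp (- 2 \<mu> h)\<close> with an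
  additive error \<open>O(h\<^sup>3 (e\<^sup>2 + e\<^sup>3))\<close>. Fourth moments of the scheme are bounded uniformly in time, and the
  noise of step \<open>n\<close> adds \<open>O(h)\<close> times the integral of \<open>\<varsigma>\<^sup>2\<close> over \<open>[t\<^sub>n, t\<^sub>n\<^sub>+\<^sub>1]\<close> (up to \<open>O(h\<^sup>4)\<close>, as \<open>\<sigma>\<close> is
  Lipschitz in time), hence the second moment of \<open>X\<^sub>n - x\<^sup>\<star>\<close> is \<open>O(\<beta>\<^sub>n + h\<^sup>2)\<close> with
  \<open>\<beta>\<^sub>n = exp (- 2 \<mu> t\<^sub>n) (1 + h \<rho>(t\<^sub>n))\<close>. This gives the strong error and the residual, and it bounds the
  quadratic part of \<open>\<phi>(X\<^sub>n) - \<phi>(x\<^sup>\<star>)\<close>. The linear part only involves the mean of \<open>X\<^sub>n - x\<^sup>\<star>\<close>, which is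
  contracted by \<open>exp (- \<mu> h)\<close> in each step and forced only by \<open>h\<close> times the second moment, so that it
  is \<open>O(sqrt \<beta>\<^sub>n + h\<^sup>2)\<close>.
\<close>

section \<open>Gradients and Hessians\<close>

text \<open>Monotonicity of the gradient alone leaves an error O(h^2) e^2 per step, hence O(h) once
  it is accumulated over the roughly 1/h steps that the contraction remembers. Passing to the
  modified field is what lowers the loss to O(h^3) per step at the exact rate \<open>\<mu>\<close>.
  That field also vanishes at the minimizer, so its monotonicity is used only between a point and
  the minimizer. The term e^3, variation of the Hessian times e, is the obstacle for the second
  moment: its recursion does not close on itself. Fourth moments are therefore propagated beforehand
  by a cruder contraction, and their bound \<open>1 + norm (x0 - xs) ^ 4\<close> is the factor of
  every later estimate. For the mean, Jensen's inequality would give only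
  \<open>sqrt \<beta> + h\<close>. The order h^2 needs a recursion of its own, in which the centered
  noise cancels exactly and the linear part of the drift commutes with the expectation. Conditional
  expectations are avoided: an iterate is a function of the earlier Gaussians, so expectations of
  products with the next one factorize.\<close>

lemma has_derivative_grad:
  fixes f :: "'a::euclidean_space \<Rightarrow> real"
  assumes "f differentiable (at x)"
  shows "(f has_derivative (\<lambda>k. k \<bullet> grad f x)) (at x)"
proof -
  obtain f' where f': "(f has_derivative f') (at x)"
    using assms by (auto simp: differentiable_def)
  have lin: "linear f'"
    using f' by (rule has_derivative_linear)
  \<comment> \<open>Riesz representation with an explicit vector. \<open>grad\<close> is a definite
    description, so existence is proved here and uniqueness follows from that of the
    derivative.\<close>
  have "f' = (\<lambda>k. k \<bullet> (\<Sum>b\<in>Basis. f' b *\<^sub>R b))"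
  proof
    fix k
    have "f' k = f' (\<Sum>b\<in>Basis. (k \<bullet> b) *\<^sub>R b)"
      by (simp add: euclidean_representation)
    also have "\<dots> = k \<bullet> (\<Sum>b\<in>Basis. f' b *\<^sub>R b)"
      by (simp add: linear_sum[OF lin] linear_scale[OF lin] inner_sum_right mult.commute)
    finally show "f' k = k \<bullet> (\<Sum>b\<in>Basis. f' b *\<^sub>R b)" .
  qed
  with f' have ex: "GDERIV f x :> (\<Sum>b\<in>Basis. f' b *\<^sub>R b)"
    by (simp add: gderiv_def)
  have "GDERIV f x :> grad f x"
    unfolding grad_def
  proof (rule theI[of "\<lambda>D. GDERIV f x :> D", OF ex])
    fix D assume "GDERIV f x :> D"
    then have "(\<lambda>k. k \<bullet> D) = (\<lambda>k. k \<bullet> (\<Sum>b\<in>Basis. f' b *\<^sub>R b))"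
      using ex has_derivative_unique unfolding gderiv_def by blast
    then have "\<forall>k. k \<bullet> D = k \<bullet> (\<Sum>b\<in>Basis. f' b *\<^sub>R b)"
      by (auto dest: fun_cong)
    then show "D = (\<Sum>b\<in>Basis. f' b *\<^sub>R b)"
      by (simp only: vector_eq_ldot)
  qed
  then show ?thesis
    by (simp add: gderiv_def)
qed

lemma frechet_derivative_grad:
  fixes f :: "'a::euclidean_space \<Rightarrow> real"
  assumes "f differentiable (at x)"
  shows "frechet_derivative f (at x) k = k \<bullet> grad f x"
  by (simp add: frechet_derivative_at[OF has_derivative_grad[OF assms], symmetric])

lemma grad_eqI:
  fixes f :: "'a::euclidean_space \<Rightarrow> real"
  assumes "(f has_derivative f') (at x)" "\<And>k. f' k = k \<bullet> D"
  shows "grad f x = D"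
proof -
  have "f' = (\<lambda>k. k \<bullet> grad f x)"
    by (rule has_derivative_unique[OF assms(1) has_derivative_grad[OF differentiableI[OF assms(1)]]])
  then have "\<forall>k. k \<bullet> grad f x = k \<bullet> D"
    using assms(2) by simp
  then show ?thesis
    by (simp only: vector_eq_ldot)
qed

section \<open>Iterated directional derivatives\<close>

lemma C_class_SucD: "C_class (Suc m) f \<Longrightarrow> C_class m f"
proof (induction m arbitrary: f)
  case 0
  then have "f differentiable_on UNIV"
    by (simp add: differentiable_on_def)
  then show ?case
    by (simp add: differentiable_imp_continuous_on)
next
  case (Suc m)
  then show ?case
    unfolding C_class.simps(2)[of "Suc m"] C_class.simps(2)[of m f] by blast
qed

text \<open>\<open>C_class\<close> peels off the derivative taken first, \<open>iter_deriv\<close>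
  the one taken last. The two meet by induction from the end of the list, where the direction of the
  first differentiation stands.\<close>

lemma iter_deriv_differentiable:
  "C_class (Suc (length ks)) f \<Longrightarrow> iter_deriv f ks differentiable (at x)"
proof (induction ks arbitrary: f rule: rev_induct)
  case Nil
  then show ?case by simp
next
  case (snoc k ks)
  have *: "iter_deriv f (ks @ [k]) = iter_deriv (\<lambda>x. frechet_derivative f (at x) k) ks"
    by (induction ks) simp_all
  have "C_class (Suc (length ks)) (\<lambda>x. frechet_derivative f (at x) k)"
    using snoc.prems by simp
  then show ?case
    unfolding * by (rule snoc.IH)
qed

lemma deriv_bounded_by_iter_deriv_lipschitz:
  assumes C: "C_class (Suc (length ks)) f" and B: "deriv_bounded_by B (Suc (length ks)) f"
  shows "norm (iter_deriv f ks y - iter_deriv f ks x) \<le> B * prod_list (map norm ks) * norm (y - x)"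
proof (rule differentiable_bound[of UNIV _ "\<lambda>z. frechet_derivative (iter_deriv f ks) (at z)"])
  fix z
  show "(iter_deriv f ks has_derivative frechet_derivative (iter_deriv f ks) (at z)) (at z within UNIV)"
    using iter_deriv_differentiable[OF C] by (simp add: frechet_derivative_works)
  show "onorm (frechet_derivative (iter_deriv f ks) (at z)) \<le> B * prod_list (map norm ks)"
  proof (rule onorm_bound)
    \<comment> \<open>The sign of \<open>B\<close> is not given; a unit direction shows that the
      bound is nonnegative.\<close>
    obtain k :: 'a where "norm k = 1"
      using norm_Basis SOME_Basis by blast
    then have "norm (iter_deriv f (k # ks) z) \<le> B * prod_list (map norm ks)"
      using B[unfolded deriv_bounded_by_def, rule_format, of "k # ks" z] by simp
    then show "0 \<le> B * prod_list (map norm ks)"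
      by (rule order_trans[OF norm_ge_zero])
    show "norm (frechet_derivative (iter_deriv f ks) (at z) k) \<le> B * prod_list (map norm ks) * norm k" for k
      using B[unfolded deriv_bounded_by_def, rule_format, of "k # ks" z] by (simp add: mult_ac)
  qed
qed auto

lemma norm_le_if_inner_le:
  fixes v :: "'a::real_inner"
  assumes "\<And>k. v \<bullet> k \<le> c * norm k" "0 \<le> c"
  shows "norm v \<le> c"
  using assms(1)[of v] assms(2)
  by (cases "v = 0") (auto simp: dot_square_norm power2_eq_square)

lemma deriv_bounded_by_grad_lipschitz:
  fixes f :: "'a::euclidean_space \<Rightarrow> real"
  assumes C: "C_class 2 f" and B: "deriv_bounded_by B 2 f" and "0 \<le> B"
  shows "norm (grad f y - grad f x) \<le> B * norm (y - x)"
proof (rule norm_le_if_inner_le)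
  fix k
  have *: "iter_deriv f [k] = (\<lambda>x. k \<bullet> grad f x)"
    using C by (auto simp: numeral_2_eq_2 frechet_derivative_grad)
  have "\<bar>k \<bullet> grad f y - k \<bullet> grad f x\<bar> \<le> B * norm k * norm (y - x)"
    using deriv_bounded_by_iter_deriv_lipschitz[of "[k]" f B y x] C B unfolding *
    by (simp add: numeral_2_eq_2)
  then have "k \<bullet> (grad f y - grad f x) \<le> B * norm k * norm (y - x)"
    by (simp add: inner_diff_right)
  then show "(grad f y - grad f x) \<bullet> k \<le> B * norm (y - x) * norm k"
    by (simp only: inner_commute[of k] mult_ac)
next
  show "0 \<le> B * norm (y - x)"
    using \<open>0 \<le> B\<close> by simp
qed

text \<open>Mean value inequality for \<open>f\<close> minus its linearization at \<open>x\<close>,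
  on the ball around \<open>x\<close> through \<open>y\<close>. The remainder constant is thus
  \<open>B\<close>, not the \<open>B / 2\<close> of an integral remainder.\<close>

lemma taylor_remainder:
  fixes f :: "'a::real_normed_vector \<Rightarrow> 'b::real_normed_vector"
  assumes f': "\<And>z. (f has_derivative f' z) (at z)"
    and B: "\<And>z k. norm (f' z k - f' x k) \<le> B * norm (z - x) * norm k" and "0 \<le> B"
  shows "norm (f y - f x - f' x (y - x)) \<le> B * (norm (y - x))\<^sup>2"
proof -
  have "norm (f y - f x - f' x (y - x)) \<le> norm (y - x) * (B * norm (y - x))"
  proof (rule differentiable_bound_linearization[of x y "cball x (norm (y - x))" f f' x])
    fix t :: real assume "t \<in> {0..1}"
    then show "x + t *\<^sub>R (y - x) \<in> cball x (norm (y - x))"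
      by (auto simp: dist_norm mult_left_le_one_le)
  next
    fix z assume z: "z \<in> cball x (norm (y - x))"
    show "(f has_derivative f' z) (at z within cball x (norm (y - x)))"
      using f' by (rule has_derivative_at_withinI)
    show "onorm (f' z - f' x) \<le> B * norm (y - x)"
    proof (rule onorm_bound)
      fix k
      have "norm (f' z k - f' x k) \<le> B * norm (z - x) * norm k"
        by (rule B)
      also have "\<dots> \<le> B * norm (y - x) * norm k"
        using z \<open>0 \<le> B\<close> by (intro mult_right_mono mult_left_mono) (auto simp: dist_norm norm_minus_commute)
      finally show "norm ((f' z - f' x) k) \<le> B * norm (y - x) * norm k"
        by simp
    qed (use \<open>0 \<le> B\<close> in simp)
  qed simp
  then show ?thesis
    by (simp add: power2_eq_square mult_ac)
qed

lemma grad_lipschitz_taylor: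
  fixes f :: "'a::euclidean_space \<Rightarrow> real"
  assumes f: "\<And>z. f differentiable (at z)"
    and B: "\<And>y x. norm (grad f y - grad f x) \<le> B * norm (y - x)" and "0 \<le> B"
  shows "\<bar>f y - f x - grad f x \<bullet> (y - x)\<bar> \<le> B * (norm (y - x))\<^sup>2"
proof -
  have "norm (f y - f x - (y - x) \<bullet> grad f x) \<le> B * (norm (y - x))\<^sup>2"
  proof (rule taylor_remainder[of f "\<lambda>z k. k \<bullet> grad f z"])
    fix z k
    have "norm (k \<bullet> grad f z - k \<bullet> grad f x) \<le> norm k * norm (grad f z - grad f x)"
      using Cauchy_Schwarz_ineq2[of k "grad f z - grad f x"] by (simp add: inner_diff_right)
    also have "\<dots> \<le> norm k * (B * norm (z - x))"
      by (intro mult_left_mono B) simp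
    finally show "norm (k \<bullet> grad f z - k \<bullet> grad f x) \<le> B * norm (z - x) * norm k"
      by (simp add: mult_ac)
  qed (use f \<open>0 \<le> B\<close> has_derivative_grad in auto)
  then show ?thesis
    by (simp add: inner_commute)
qed

text \<open>
  The second difference of \<open>F\<close> along \<open>a\<close> and \<open>b\<close> is symmetric in \<open>a\<close> and \<open>b\<close>, and equals
  \<open>s\<^sup>2 H a \<bullet> b\<close> up to a term of order \<open>s\<^sup>3\<close>.
\<close>

lemma symmetric_hessian:
  fixes F :: "'a::real_inner \<Rightarrow> real"
  assumes F: "\<And>z. (F has_derivative (\<lambda>k. k \<bullet> G z)) (at z)" and lin: "linear H"
    and G: "\<And>y. norm (G y - G x - H (y - x)) \<le> B * (norm (y - x))\<^sup>2" and "0 \<le> B"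
  shows "H a \<bullet> b = H b \<bullet> a"
proof -
  define \<Delta> where "\<Delta> s a b = F (x + s *\<^sub>R a + s *\<^sub>R b) - F (x + s *\<^sub>R a) - F (x + s *\<^sub>R b) + F x"
    for s :: real and a b
  have approx: "\<bar>\<Delta> s a b - s\<^sup>2 * (H a \<bullet> b)\<bar> \<le> s ^ 3 * (2 * B * (norm a + norm b)\<^sup>2 * norm b)"
    if "0 < s" for s a b
  proof -
    define R where "R = 2 * B * (norm a + norm b)\<^sup>2"
    define f where "f t = F (x + s *\<^sub>R a + t *\<^sub>R b) - F (x + t *\<^sub>R b)" for t
    define g where "g t = b \<bullet> G (x + s *\<^sub>R a + t *\<^sub>R b) - b \<bullet> G (x + t *\<^sub>R b)" for t
    have "(f has_real_derivative g t) (at t)" for t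
    proof -
      have line: "((\<lambda>t. c + t *\<^sub>R b) has_derivative (\<lambda>u. u *\<^sub>R b)) (at t)" for c
        by (auto intro!: derivative_eq_intros)
      have "((\<lambda>t. F (c + t *\<^sub>R b)) has_derivative (\<lambda>u. (u *\<^sub>R b) \<bullet> G (c + t *\<^sub>R b))) (at t)" for c
        by (rule has_derivative_compose[OF line F])
      from has_derivative_diff[OF this this] show ?thesis
        unfolding f_def g_def has_field_derivative_def
        by (rule has_derivative_eq_rhs) (auto simp: algebra_simps)
    qed
    \<comment> \<open>The mean value theorem in direction \<open>b\<close> turns the second
      difference of \<open>F\<close> into \<open>s\<close> times a first difference of
      \<open>G\<close>, to which the first-order expansion of \<open>G\<close> at \<open>x\<close>
      applies.\<close>
    then obtain t where t: "0 < t" "t < s" "f s - f 0 = (s - 0) * g t"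
      using MVT2[OF \<open>0 < s\<close>, of f g] by auto
    let ?u = "s *\<^sub>R a + t *\<^sub>R b" and ?v = "t *\<^sub>R b"
    define p where "p = G (x + ?u) - G x - H ?u"
    define q where "q = G (x + ?v) - G x - H ?v"
    have tb: "norm (t *\<^sub>R b) \<le> s * norm b"
      using t by (simp add: mult_right_mono)
    have "norm ?u \<le> norm (s *\<^sub>R a) + norm (t *\<^sub>R b)"
      by (rule norm_triangle_ineq)
    also have "\<dots> \<le> s * norm a + s * norm b"
      using tb t by simp
    finally have u: "norm ?u \<le> s * (norm a + norm b)"
      by (simp add: algebra_simps)
    have v: "norm ?v \<le> s * (norm a + norm b)"
      using tb \<open>0 < s\<close> by (auto simp: distrib_left intro: add_increasing)
    have remainder: "norm (G (x + w) - G x - H w) \<le> B * (s * (norm a + norm b))\<^sup>2"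
      if "norm w \<le> s * (norm a + norm b)" for w
      using G[of "x + w"] mult_left_mono[OF power_mono[OF that norm_ge_zero, of 2] \<open>0 \<le> B\<close>]
      by simp
    have "norm p \<le> B * (s * (norm a + norm b))\<^sup>2"
      unfolding p_def using u by (rule remainder)
    moreover have "norm q \<le> B * (s * (norm a + norm b))\<^sup>2"
      unfolding q_def using v by (rule remainder)
    ultimately have pq: "norm (p - q) \<le> s\<^sup>2 * R"
      using norm_triangle_ineq4[of p q] by (simp add: R_def power_mult_distrib mult_ac)
    have "H ?u - H ?v = s *\<^sub>R H a"
      by (simp add: linear_add[OF lin] linear_scale[OF lin])
    then have "g t = s * (H a \<bullet> b) + (p - q) \<bullet> b"
      by (simp add: g_def p_def q_def inner_commute inner_diff_right inner_diff_left add.assoc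
          inner_add_right linear_add[OF lin] linear_scale[OF lin])
    moreover have "\<Delta> s a b = s * g t"
      using t(3) by (simp add: \<Delta>_def f_def)
    ultimately have "\<Delta> s a b - s\<^sup>2 * (H a \<bullet> b) = s * ((p - q) \<bullet> b)"
      by (simp only: distrib_left) (simp add: power2_eq_square)
    also have "\<bar>\<dots>\<bar> \<le> s * (norm (p - q) * norm b)"
      using \<open>0 < s\<close> Cauchy_Schwarz_ineq2[of "p - q" b] by (simp add: abs_mult)
    also have "\<dots> \<le> s * (s\<^sup>2 * R * norm b)"
      using pq \<open>0 < s\<close> by (intro mult_left_mono mult_right_mono) auto
    finally show ?thesis
      by (simp add: R_def power2_eq_square power3_eq_cube mult_ac)
  qed
  define K where "K = 2 * B * (norm a + norm b)\<^sup>2 * norm b + 2 * B * (norm b + norm a)\<^sup>2 * norm a"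
  have "0 \<le> K"
    using \<open>0 \<le> B\<close> by (simp add: K_def)
  \<comment> \<open>The two expansions of the same second difference are subtracted and divided by
    \<open>s\<^sup>2\<close>; \<open>s\<close> is arbitrarily small.\<close>
  have le: "\<bar>H a \<bullet> b - H b \<bullet> a\<bar> \<le> s * K" if "0 < s" for s
  proof -
    have "\<Delta> s a b = \<Delta> s b a"
      by (simp add: \<Delta>_def add.assoc add.commute add.left_commute)
    then have "\<bar>s\<^sup>2 * (H a \<bullet> b) - s\<^sup>2 * (H b \<bullet> a)\<bar> \<le> s ^ 3 * K"
      using approx[OF that, of a b] approx[OF that, of b a]
      unfolding K_def distrib_left by linarith
    then have "s\<^sup>2 * \<bar>H a \<bullet> b - H b \<bullet> a\<bar> \<le> s\<^sup>2 * (s * K)"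
      by (simp add: right_diff_distrib[symmetric] abs_mult power2_eq_square power3_eq_cube mult_ac)
    then show ?thesis
      using that by (simp add: mult_le_cancel_left)
  qed
  have "\<bar>H a \<bullet> b - H b \<bullet> a\<bar> \<le> e" if "0 < e" for e
  proof -
    have "\<bar>H a \<bullet> b - H b \<bullet> a\<bar> \<le> e / (K + 1) * K"
      using that \<open>0 \<le> K\<close> by (intro le) simp
    also have "\<dots> \<le> e"
      using that \<open>0 \<le> K\<close> by (simp add: field_simps)
    finally show ?thesis .
  qed
  then have "\<bar>H a \<bullet> b - H b \<bullet> a\<bar> \<le> 0"
    by - (rule field_le_epsilon, simp)
  then show ?thesis
    by simp
qed

text \<open>A supremum in \<open>real\<close> carries information only over a nonempty set with
  bounded values. The assumed bound \<open>B\<close> supplies boundedness for both nested suprema, a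
  list of unit vectors nonemptiness.\<close>

lemma deriv_seminorm_bounds:
  fixes f :: "'a::euclidean_space \<Rightarrow> real"
  assumes B: "deriv_bounded_by B m f"
  shows "deriv_bounded_by (deriv_seminorm m f) m f" and "0 \<le> deriv_seminorm m f"
proof -
  define D where "D = {ks :: 'a list. length ks = m \<and> 0 \<notin> set ks}"
  define q where "q x ks = \<bar>iter_deriv f ks x\<bar> / prod_list (map norm ks)" for x and ks :: "'a list"
  have pos: "0 < prod_list (map norm ks)" if "0 \<notin> set ks" for ks :: "'a list"
    using that by (induction ks) auto
  have qB: "q x ks \<le> B" if "ks \<in> D" for x ks
    using B that pos[of ks] by (auto simp: q_def D_def deriv_bounded_by_def divide_le_eq)
  obtain b :: 'a where "norm b = 1"
    using norm_Basis SOME_Basis by blast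
  then have ne: "replicate m b \<in> D"
    by (auto simp: D_def)
  have in1: "q x ks \<le> (SUP ks\<in>D. q x ks)" if "ks \<in> D" for x ks
    using that qB by (intro cSUP_upper bdd_aboveI2[of _ _ B]) auto
  have in2: "(SUP ks\<in>D. q x ks) \<le> deriv_seminorm m f" for x
    unfolding deriv_seminorm_def D_def[symmetric] q_def[symmetric]
  proof (rule cSUP_upper)
    show "bdd_above (range (\<lambda>x. SUP ks\<in>D. q x ks))"
      using ne qB by (intro bdd_aboveI2[of _ _ B] cSUP_least) auto
  qed simp
  have q0: "0 \<le> q x ks" if "ks \<in> D" for x ks
    using that pos[of ks] by (auto simp: q_def D_def)
  show "0 \<le> deriv_seminorm m f"
    using q0[OF ne] in1[OF ne] in2 by (meson order_trans)
  show "deriv_bounded_by (deriv_seminorm m f) m f"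
    unfolding deriv_bounded_by_def
  proof (intro allI impI)
    fix x and ks :: "'a list" assume ks: "length ks = m"
    show "norm (iter_deriv f ks x) \<le> deriv_seminorm m f * prod_list (map norm ks)"
    proof (cases "0 \<in> set ks")
      \<comment> \<open>Lists with a zero direction do not enter the supremum; there the assumed
        bound makes the derivative vanish.\<close>
      case True
      then have "prod_list (map norm ks) = 0"
        by (induction ks) auto
      then show ?thesis
        using B[unfolded deriv_bounded_by_def, rule_format, OF ks, of x] by simp
    next
      case False
      with ks have "ks \<in> D"
        by (simp add: D_def)
      then have "q x ks \<le> deriv_seminorm m f"
        using in1 in2 order_trans by blast
      then show ?thesis
        using pos[OF False] by (simp add: q_def divide_le_eq)
    qed
  qed
qed

section \<open>The gradient step and the modified objective\<close>

text \<open>The increment of \<open>G\<close> along \<open>s *\<^sub>R k\<close> is at most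
  \<open>L * s * norm k\<close> and differs from \<open>s *\<^sub>R D k\<close> by O(s^2); divide by
  \<open>s\<close> and let it be small.\<close>

lemma derivative_norm_le_lipschitz:
  fixes G :: "'a::real_normed_vector \<Rightarrow> 'b::real_normed_vector"
  assumes "linear D" and L: "\<And>y. norm (G y - G x) \<le> L * norm (y - x)"
    and T: "\<And>y. norm (G y - G x - D (y - x)) \<le> B * (norm (y - x))\<^sup>2" and "0 \<le> B"
  shows "norm (D k) \<le> L * norm k"
proof (rule field_le_epsilon)
  fix e :: real assume "0 < e"
  \<comment> \<open>Chosen so that the remainder after division by \<open>s\<close> is at most
    \<open>e\<close>; the summand 1 keeps the denominator positive.\<close>
  define s where "s = e / (B * (norm k)\<^sup>2 + 1)"
  have den: "0 < B * (norm k)\<^sup>2 + 1"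
    using \<open>0 \<le> B\<close> by (simp add: add_nonneg_pos)
  then have "0 < s"
    using \<open>0 < e\<close> by (simp add: s_def)
  let ?y = "x + s *\<^sub>R k"
  have "norm (D (s *\<^sub>R k)) \<le> norm (G ?y - G x) + norm (G ?y - G x - D (s *\<^sub>R k))"
    using norm_triangle_ineq4[of "G ?y - G x" "G ?y - G x - D (s *\<^sub>R k)"] by simp
  also have "\<dots> \<le> L * norm (s *\<^sub>R k) + B * (norm (s *\<^sub>R k))\<^sup>2"
    using L[of ?y] T[of ?y] by (intro add_mono) simp_all
  finally have "s * norm (D k) \<le> s * (L * norm k + s * (B * (norm k)\<^sup>2))"
    using \<open>0 < s\<close> by (simp add: linear_scale[OF \<open>linear D\<close>] power_mult_distrib distrib_left power2_eq_square mult_ac)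
  then have "norm (D k) \<le> L * norm k + s * (B * (norm k)\<^sup>2)"
    using \<open>0 < s\<close> by (simp only: mult_le_cancel_left_pos)
  also have "s * (B * (norm k)\<^sup>2) \<le> e"
    using \<open>0 < e\<close> den by (simp add: s_def field_simps)
  finally show "norm (D k) \<le> L * norm k + e" by simp
qed

text \<open>
  The vector field \<open>G + h/2 H G\<close> is the gradient of the modified objective when \<open>G\<close> is a
  gradient and \<open>H\<close> the (symmetric) Hessian.
\<close>

locale modified_gradient =
  fixes G :: "'a::euclidean_space \<Rightarrow> 'a" and H :: "'a \<Rightarrow> 'a \<Rightarrow> 'a"
    and L B \<mu> h0 :: real and xs :: 'a
  assumes deriv: "\<And>x. (G has_derivative H x) (at x)"
    and lip: "\<And>x y. norm (G y - G x) \<le> L * norm (y - x)"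
    and hess_lip: "\<And>x y k. norm (H y k - H x k) \<le> B * norm (y - x) * norm k"
    and zero: "G xs = 0"
    and mono: "\<And>h y. 0 < h \<Longrightarrow> h < h0 \<Longrightarrow>
      \<mu> * (norm (y - xs))\<^sup>2 \<le> (G y + (h / 2) *\<^sub>R H y (G y)) \<bullet> (y - xs)"
    and nonneg: "0 \<le> L" "0 \<le> B" and mu_pos: "0 < \<mu>"
begin

lemma linear_H: "linear (H x)"
  using deriv by (rule has_derivative_linear)

lemma taylor: "norm (G y - G x - H x (y - x)) \<le> B * (norm (y - x))\<^sup>2"
  by (rule taylor_remainder[OF deriv hess_lip nonneg(2)])

lemma H_bound: "norm (H x k) \<le> L * norm k"
  by (rule derivative_norm_le_lipschitz[OF linear_H lip taylor nonneg(2)])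

lemma G_bound: "norm (G x) \<le> L * norm (x - xs)"
  using lip[of x xs] by (simp add: zero)

text \<open>
  The curve \<open>y s = x - s V x + s\<^sup>2/2 H x (G x)\<close>, with \<open>V\<close> the modified vector field, solves
  \<open>y' = - V y\<close> up to \<open>O(h\<^sup>2)\<close>, and its value at \<open>s = h\<close> is exactly the gradient step from \<open>x\<close>.
\<close>

lemma modified_flow_residual:
  fixes x :: 'a and h s :: real
  assumes s: "0 \<le> s" "s \<le> h" "h \<le> 1"
  defines "y \<equiv> x - s *\<^sub>R (G x + (h / 2) *\<^sub>R H x (G x)) + (s\<^sup>2 / 2) *\<^sub>R H x (G x)"
    and "v \<equiv> - (G x + (h / 2) *\<^sub>R H x (G x)) + s *\<^sub>R H x (G x)"
    and "e \<equiv> norm (x - xs)" and "P \<equiv> L + L\<^sup>2"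
  shows "norm (y - xs) \<le> (1 + P) * e"
    and "norm (v + (G y + (h / 2) *\<^sub>R H y (G y)))
      \<le> (B * P\<^sup>2 + L ^ 3 + P * (B * L * (1 + P) + L\<^sup>2)) * h\<^sup>2 * (e + e\<^sup>2)"
proof -
  have e0: "0 \<le> e" and P0: "0 \<le> P" and h0: "0 \<le> h"
    using nonneg s by (auto simp: e_def P_def)
  have gx: "norm (G x) \<le> L * e"
    using G_bound by (simp add: e_def)
  have ax: "norm (H x (G x)) \<le> L\<^sup>2 * e"
    using H_bound[of x "G x"] mult_left_mono[OF gx nonneg(1)] by (simp add: power2_eq_square mult_ac)
  \<comment> \<open>The coefficient of \<open>H x (G x)\<close> in \<open>y - x\<close>; it is of
    second order because \<open>s\<close> is at most \<open>h\<close>.\<close>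
  define c where "c = - s * (h / 2) + s\<^sup>2 / 2"
  have "\<bar>c\<bar> \<le> s * h / 2"
    using s mult_left_mono[OF s(2,1)] mult_nonneg_nonneg[of s h] mult_nonneg_nonneg[of s s]
    by (simp add: c_def power2_eq_square)
  have yx: "y - x = - s *\<^sub>R G x + c *\<^sub>R H x (G x)"
    by (simp add: y_def c_def algebra_simps)
  have cH: "norm (c *\<^sub>R H x (G x)) \<le> s * h * (L\<^sup>2 * e)"
  proof -
    have "norm (c *\<^sub>R H x (G x)) \<le> (s * h / 2) * (L\<^sup>2 * e)"
      using mult_mono[OF \<open>\<bar>c\<bar> \<le> s * h / 2\<close> ax] s h0 by simp
    also have "\<dots> \<le> s * h * (L\<^sup>2 * e)"
      using s h0 e0 by (intro mult_right_mono) auto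
    finally show ?thesis .
  qed
  have dist: "norm (y - x) \<le> s * (P * e)"
  proof -
    have "norm (y - x) \<le> norm (- s *\<^sub>R G x) + norm (c *\<^sub>R H x (G x))"
      unfolding yx by (rule norm_triangle_ineq)
    also have "\<dots> \<le> s * (L * e) + s * h * (L\<^sup>2 * e)"
      using gx s by (intro add_mono cH) (simp add: mult_left_mono)
    also have "s * h * (L\<^sup>2 * e) \<le> s * 1 * (L\<^sup>2 * e)"
      using s e0 by (intro mult_right_mono mult_left_mono) auto
    finally show ?thesis
      by (simp add: P_def algebra_simps)
  qed
  have dist1: "norm (y - x) \<le> P * e"
    using dist mult_right_mono[of s 1 "P * e"] s P0 e0 by simp
  show ye: "norm (y - xs) \<le> (1 + P) * e"
    using norm_triangle_ineq[of "y - x" "x - xs"] dist1 by (simp add: e_def algebra_simps)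
  have disth: "norm (y - x) \<le> h * (P * e)"
    using dist mult_right_mono[OF s(2), of "P * e"] P0 e0 by simp
  define r1 where "r1 = G y - G x - H x (y - x)"
  define r2 where "r2 = H x (c *\<^sub>R H x (G x))"
  define r3 where "r3 = (h / 2) *\<^sub>R ((H y (G y) - H x (G y)) + H x (G y - G x))"
  \<comment> \<open>The terms of order 0 and 1 cancel. What remains is the Taylor remainder of
    \<open>G\<close>, the Hessian applied to the second-order part of the displacement, and
    \<open>h / 2\<close> times the change of \<open>H G\<close> between \<open>x\<close> and
    \<open>y\<close>, itself O(h).\<close>
  have split: "v + (G y + (h / 2) *\<^sub>R H y (G y)) = r1 + r2 + r3"
  proof -
    have "H x (y - x) = - s *\<^sub>R H x (G x) + r2"
      unfolding yx r2_def
      by (simp add: linear_add[OF linear_H] linear_diff[OF linear_H] linear_scale[OF linear_H] linear_neg[OF linear_H])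
    then show ?thesis
      by (simp add: v_def r1_def r3_def linear_diff[OF linear_H] algebra_simps)
  qed
  have r1: "norm r1 \<le> B * P\<^sup>2 * h\<^sup>2 * e\<^sup>2"
  proof -
    have "norm r1 \<le> B * (norm (y - x))\<^sup>2"
      unfolding r1_def by (rule taylor)
    also have "\<dots> \<le> B * (h * (P * e))\<^sup>2"
      using disth nonneg by (intro mult_left_mono power_mono) auto
    finally show ?thesis
      by (simp add: power_mult_distrib mult_ac)
  qed
  have r2: "norm r2 \<le> L ^ 3 * h\<^sup>2 * e"
  proof -
    have "norm r2 \<le> L * (s * h * (L\<^sup>2 * e))"
      unfolding r2_def using H_bound[of x] mult_left_mono[OF cH nonneg(1)] order_trans by blast
    also have "\<dots> \<le> L * (h * h * (L\<^sup>2 * e))"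
      using s h0 nonneg e0 by (intro mult_left_mono mult_right_mono) auto
    finally show ?thesis
      by (simp add: power2_eq_square power3_eq_cube mult_ac)
  qed
  have r3: "norm r3 \<le> h\<^sup>2 * (P * B * L * (1 + P) * e\<^sup>2 + P * L\<^sup>2 * e)"
  proof -
    have gy: "norm (G y) \<le> L * ((1 + P) * e)"
      using G_bound[of y] mult_left_mono[OF ye nonneg(1)] by simp
    have "norm (H y (G y) - H x (G y)) \<le> B * norm (y - x) * norm (G y)"
      by (rule hess_lip)
    also have "\<dots> \<le> B * (h * (P * e)) * (L * ((1 + P) * e))"
      using nonneg disth gy h0 P0 e0 by (intro mult_mono) auto
    finally have 1: "norm (H y (G y) - H x (G y)) \<le> B * (h * (P * e)) * (L * ((1 + P) * e))" .
    have "norm (H x (G y - G x)) \<le> L * (L * norm (y - x))"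
      using H_bound[of x "G y - G x"] mult_left_mono[OF lip[of y x] nonneg(1)] by simp
    also have "\<dots> \<le> L * (L * (h * (P * e)))"
      using disth nonneg by (intro mult_left_mono) auto
    finally have 2: "norm (H x (G y - G x)) \<le> L * (L * (h * (P * e)))" .
    have "norm r3 \<le> h * (norm (H y (G y) - H x (G y)) + norm (H x (G y - G x)))"
      using h0 norm_triangle_ineq[of "H y (G y) - H x (G y)" "H x (G y - G x)"]
        mult_mono[of "h / 2" h] by (simp add: r3_def)
    also have "\<dots> \<le> h * (B * (h * (P * e)) * (L * ((1 + P) * e)) + L * (L * (h * (P * e))))"
      using 1 2 h0 by (intro mult_left_mono add_mono) auto
    also have "\<dots> = h\<^sup>2 * (P * B * L * (1 + P) * e\<^sup>2 + P * L\<^sup>2 * e)"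
      by (simp add: power2_eq_square algebra_simps)
    finally show ?thesis .
  qed
  have "norm (r1 + r2 + r3) \<le> norm r1 + norm r2 + norm r3"
    by (meson norm_triangle_ineq norm_triangle_le add_right_mono order_trans)
  also have "\<dots> \<le> B * P\<^sup>2 * h\<^sup>2 * e\<^sup>2 + L ^ 3 * h\<^sup>2 * e
      + h\<^sup>2 * (P * B * L * (1 + P) * e\<^sup>2 + P * L\<^sup>2 * e)"
    by (intro add_mono r1 r2 r3)
  also have "\<dots> = h\<^sup>2 * (B * P\<^sup>2 * e\<^sup>2 + L ^ 3 * e + (P * (B * L * (1 + P))) * e\<^sup>2 + (P * L\<^sup>2) * e)"
    by (simp add: algebra_simps)
  also have "\<dots> \<le> h\<^sup>2 * (B * P\<^sup>2 * (e + e\<^sup>2) + L ^ 3 * (e + e\<^sup>2)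
      + (P * (B * L * (1 + P))) * (e + e\<^sup>2) + (P * L\<^sup>2) * (e + e\<^sup>2))"
    using nonneg P0 e0 by (intro mult_left_mono add_mono) auto
  also have "\<dots> = (B * P\<^sup>2 + L ^ 3 + P * (B * L * (1 + P) + L\<^sup>2)) * h\<^sup>2 * (e + e\<^sup>2)"
    by (simp add: algebra_simps)
  finally show "norm (v + (G y + (h / 2) *\<^sub>R H y (G y)))
      \<le> (B * P\<^sup>2 + L ^ 3 + P * (B * L * (1 + P) + L\<^sup>2)) * h\<^sup>2 * (e + e\<^sup>2)"
    unfolding split .
qed

text \<open>A Gronwall argument along the curve: the squared distance weighted by
  \<open>exp (2 * \<mu> * s)\<close> would not increase under the modified flow, so its growth over
  \<open>[0, h]\<close> is caused by the residual only.\<close>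

lemma gradient_step_contraction_sq:
  "\<exists>Q\<ge>0. \<forall>x h. 0 < h \<longrightarrow> h < h0 \<longrightarrow> h \<le> 1 \<longrightarrow>
    (norm (x - h *\<^sub>R G x - xs))\<^sup>2
      \<le> exp (- 2 * \<mu> * h) * (norm (x - xs))\<^sup>2 + Q * h ^ 3 * ((norm (x - xs))\<^sup>2 + norm (x - xs) ^ 3)"
proof -
  define P where "P = L + L\<^sup>2"
  define R where "R = B * P\<^sup>2 + L ^ 3 + P * (B * L * (1 + P) + L\<^sup>2)"
  have P0: "0 \<le> P" and R0: "0 \<le> R"
    using nonneg by (auto simp: P_def R_def)
  have "(norm (x - h *\<^sub>R G x - xs))\<^sup>2 \<le> exp (- 2 * \<mu> * h) * (norm (x - xs))\<^sup>2
      + (2 * (1 + P) * R) * h ^ 3 * ((norm (x - xs))\<^sup>2 + norm (x - xs) ^ 3)"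
    if h: "0 < h" "h < h0" "h \<le> 1" for x h
  proof -
    define e where "e = norm (x - xs)"
    \<comment> \<open>Twice the product of the residual bound and the distance bound;
      \<open>(e + e\<^sup>2) * e\<close> is the origin of \<open>e\<^sup>2 + e ^ 3\<close>.\<close>
    define w where "w = (2 * (1 + P) * R) * h\<^sup>2 * (e\<^sup>2 + e ^ 3)"
    define W where "W z = G z + (h / 2) *\<^sub>R H z (G z)" for z
    define y where "y s = x - s *\<^sub>R W x + (s\<^sup>2 / 2) *\<^sub>R H x (G x)" for s
    define v where "v s = - W x + s *\<^sub>R H x (G x)" for s
    define u where "u s = exp (2 * \<mu> * s) * ((y s - xs) \<bullet> (y s - xs))" for s
    define u' where "u' s = exp (2 * \<mu> * s) * (2 * \<mu> * ((y s - xs) \<bullet> (y s - xs)) + 2 * (v s \<bullet> (y s - xs)))" for s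
    have e0: "0 \<le> e"
      by (simp add: e_def)
    have w0: "0 \<le> w"
      using P0 R0 e0 by (simp add: w_def)
    have y': "(y has_vector_derivative v s) (at s)" for s
      unfolding y_def v_def has_vector_derivative_def
      by (auto intro!: derivative_eq_intros simp: algebra_simps)
    have "((\<lambda>s. (y s - xs) \<bullet> (y s - xs)) has_derivative (\<lambda>t. t * (2 * (v s \<bullet> (y s - xs))))) (at s)" for s
      using y'[of s] unfolding has_vector_derivative_def
      by (auto intro!: derivative_eq_intros simp: inner_commute algebra_simps)
    then have N': "((\<lambda>s. (y s - xs) \<bullet> (y s - xs)) has_real_derivative 2 * (v s \<bullet> (y s - xs))) (at s)" for s
      by (simp add: has_field_derivative_def mult_commute_abs)
    have u': "(u has_real_derivative u' s) (at s)" for s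
    proof -
      have "((\<lambda>s. exp (2 * \<mu> * s)) has_real_derivative 2 * \<mu> * exp (2 * \<mu> * s)) (at s)"
        by (auto intro!: derivative_eq_intros)
      from DERIV_mult[OF this N'] show ?thesis
        unfolding u_def u'_def by (rule DERIV_cong) (simp only: algebra_simps)
    qed
    have u'_le: "u' s \<le> exp (2 * \<mu> * h) * w" if s: "0 \<le> s" "s \<le> h" for s
    proof -
      have ye: "norm (y s - xs) \<le> (1 + P) * e"
        and r: "norm (v s + W (y s)) \<le> R * h\<^sup>2 * (e + e\<^sup>2)"
        using modified_flow_residual[OF s h(3), of x]
        by (simp_all add: y_def v_def W_def e_def P_def R_def)
      have "v s \<bullet> (y s - xs) = (v s + W (y s)) \<bullet> (y s - xs) - W (y s) \<bullet> (y s - xs)"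
        by (simp add: inner_add_left)
      also have "\<dots> \<le> norm (v s + W (y s)) * norm (y s - xs) - \<mu> * (norm (y s - xs))\<^sup>2"
        using norm_cauchy_schwarz[of "v s + W (y s)" "y s - xs"] mono[OF h(1,2), of "y s"]
        by (simp add: W_def)
      finally have "2 * \<mu> * ((y s - xs) \<bullet> (y s - xs)) + 2 * (v s \<bullet> (y s - xs))
          \<le> 2 * (norm (v s + W (y s)) * norm (y s - xs))"
        by (simp add: dot_square_norm)
      also have "\<dots> \<le> 2 * (R * h\<^sup>2 * (e + e\<^sup>2) * ((1 + P) * e))"
        using r ye R0 e0 by (intro mult_left_mono mult_mono) auto
      also have "\<dots> = w"
        by (simp add: w_def power2_eq_square power3_eq_cube algebra_simps)
      finally have "u' s \<le> exp (2 * \<mu> * s) * w"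
        unfolding u'_def by (intro mult_left_mono) auto
      also have "\<dots> \<le> exp (2 * \<mu> * h) * w"
        using s mu_pos w0 by (intro mult_right_mono) auto
      finally show ?thesis .
    qed
    obtain s where s: "0 < s" "s < h" "u h - u 0 = (h - 0) * u' s"
      using MVT2[OF h(1), of u u'] u' by auto
    have "h * u' s \<le> h * (exp (2 * \<mu> * h) * w)"
      using s h by (intro mult_left_mono u'_le) auto
    then have "u h \<le> u 0 + h * (exp (2 * \<mu> * h) * w)"
      using s(3) by simp
    then have "exp (- 2 * \<mu> * h) * u h \<le> exp (- 2 * \<mu> * h) * (u 0 + h * (exp (2 * \<mu> * h) * w))"
      by (intro mult_left_mono) auto
    moreover have "exp (- 2 * \<mu> * h) * u h = (norm (y h - xs))\<^sup>2"
      by (simp add: u_def dot_square_norm mult.assoc[symmetric] exp_add[symmetric])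
    moreover have "y h = x - h *\<^sub>R G x"
      by (simp add: y_def W_def power2_eq_square algebra_simps)
    moreover have "u 0 = e\<^sup>2"
      by (simp add: u_def y_def e_def dot_square_norm)
    moreover have "exp (- 2 * \<mu> * h) * (u 0 + h * (exp (2 * \<mu> * h) * w)) = exp (- 2 * \<mu> * h) * u 0 + h * w"
      by (simp add: exp_minus field_simps)
    ultimately have "(norm (x - h *\<^sub>R G x - xs))\<^sup>2 \<le> exp (- 2 * \<mu> * h) * e\<^sup>2 + h * w"
      by (simp only:)
    then show ?thesis
      by (simp add: w_def e_def power2_eq_square power3_eq_cube mult_ac)
  qed
  moreover have "0 \<le> 2 * (1 + P) * R"
    using P0 R0 by simp
  ultimately show ?thesis
    by blast
qed

text \<open>Taking the root of each term would degrade h^3 to h^(3/2). Since the additive error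
  carries a factor e^2, it is read instead as part of the cross term of a square
  \<open>(a + b)\<^sup>2\<close>, with \<open>a\<close> the contracted distance and \<open>b\<close>
  of order h^3.\<close>

lemma gradient_step_contraction:
  "\<exists>Q\<ge>0. \<forall>x h. 0 < h \<longrightarrow> h < h0 \<longrightarrow> h \<le> 1 \<longrightarrow>
    norm (x - h *\<^sub>R G x - xs)
      \<le> exp (- \<mu> * h) * norm (x - xs) + Q * h ^ 3 * (norm (x - xs) + (norm (x - xs))\<^sup>2)"
proof -
  obtain Q where Q: "0 \<le> Q" and step: "\<And>x h. 0 < h \<Longrightarrow> h < h0 \<Longrightarrow> h \<le> 1 \<Longrightarrow>
    (norm (x - h *\<^sub>R G x - xs))\<^sup>2
      \<le> exp (- 2 * \<mu> * h) * (norm (x - xs))\<^sup>2 + Q * h ^ 3 * ((norm (x - xs))\<^sup>2 + norm (x - xs) ^ 3)"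
    using gradient_step_contraction_sq by blast
  have "norm (x - h *\<^sub>R G x - xs)
      \<le> exp (- \<mu> * h) * norm (x - xs) + (Q * exp \<mu>) * h ^ 3 * (norm (x - xs) + (norm (x - xs))\<^sup>2)"
    if h: "0 < h" "h < h0" "h \<le> 1" for x h
  proof (rule power2_le_imp_le)
    define e where "e = norm (x - xs)"
    have e0: "0 \<le> e" by (simp add: e_def)
    define a where "a = exp (- \<mu> * h) * e"
    define b where "b = (Q * exp \<mu>) * h ^ 3 * (e + e\<^sup>2)"
    have a0: "0 \<le> a" and b0: "0 \<le> b"
      using e0 Q h by (auto simp: a_def b_def)
    \<comment> \<open>The factor \<open>exp \<mu>\<close> in \<open>b\<close> compensates the decay
      factor contained in \<open>a\<close>.\<close>
    have "1 \<le> exp (- \<mu> * h) * exp \<mu>"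
      using h mu_pos by (simp add: exp_add[symmetric])
    then have "Q * h ^ 3 * (e\<^sup>2 + e ^ 3) * 1 \<le> Q * h ^ 3 * (e\<^sup>2 + e ^ 3) * (exp (- \<mu> * h) * exp \<mu>)"
      using Q h e0 by (intro mult_left_mono) auto
    also have "\<dots> = a * b"
      by (simp add: a_def b_def power2_eq_square power3_eq_cube algebra_simps)
    finally have "Q * h ^ 3 * (e\<^sup>2 + e ^ 3) \<le> a * b" by simp
    moreover have "exp (- 2 * \<mu> * h) * e\<^sup>2 = a\<^sup>2"
      by (simp add: a_def power_mult_distrib exp_double[symmetric] mult_ac)
    ultimately have "(norm (x - h *\<^sub>R G x - xs))\<^sup>2 \<le> a\<^sup>2 + a * b"
      using step[OF h, of x] by (simp add: e_def)
    also have "\<dots> \<le> (a + b)\<^sup>2"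
      using a0 b0 by (simp add: power2_sum)
    finally show "(norm (x - h *\<^sub>R G x - xs))\<^sup>2
        \<le> (exp (- \<mu> * h) * norm (x - xs) + (Q * exp \<mu>) * h ^ 3 * (norm (x - xs) + (norm (x - xs))\<^sup>2))\<^sup>2"
      by (simp add: a_def b_def e_def)
    show "0 \<le> exp (- \<mu> * h) * norm (x - xs) + (Q * exp \<mu>) * h ^ 3 * (norm (x - xs) + (norm (x - xs))\<^sup>2)"
      using a0 b0 by (simp add: a_def b_def e_def)
  qed
  moreover have "0 \<le> Q * exp \<mu>"
    using Q by simp
  ultimately show ?thesis
    by blast
qed

end

text \<open>Half of the gain \<open>2 * \<mu> * h\<close> pays for the quadratic term
  \<open>h\<^sup>2 * L\<^sup>2\<close>. The rate is thereby halved, but there is no additive error,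
  which is what uniform moment bounds and the fixed point argument for the existence of a zero
  require.\<close>

lemma gradient_step_crude:
  fixes G :: "'a::real_inner \<Rightarrow> 'a"
  assumes mono: "\<mu> * (norm (x - xs))\<^sup>2 \<le> G x \<bullet> (x - xs)" and lip: "norm (G x) \<le> L * norm (x - xs)"
    and h: "0 \<le> h" "h * L\<^sup>2 \<le> \<mu>"
  shows "(norm (x - h *\<^sub>R G x - xs))\<^sup>2 \<le> (1 - \<mu> * h) * (norm (x - xs))\<^sup>2"
proof -
  have "x - h *\<^sub>R G x - xs = (x - xs) - h *\<^sub>R G x" by simp
  then have "(norm (x - h *\<^sub>R G x - xs))\<^sup>2
      = (norm (x - xs))\<^sup>2 - 2 * h * (G x \<bullet> (x - xs)) + h\<^sup>2 * (norm (G x))\<^sup>2"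
    by (simp only: power2_norm_eq_inner)
      (simp add: inner_diff_left inner_diff_right inner_commute power2_eq_square algebra_simps)
  also have "\<dots> \<le> (norm (x - xs))\<^sup>2 - 2 * h * (\<mu> * (norm (x - xs))\<^sup>2) + h\<^sup>2 * (L * norm (x - xs))\<^sup>2"
    using h mono power_mono[OF lip, of 2] by (intro add_mono diff_mono mult_left_mono) auto
  also have "h\<^sup>2 * (L * norm (x - xs))\<^sup>2 = h * ((h * L\<^sup>2) * (norm (x - xs))\<^sup>2)"
    by (simp add: power2_eq_square mult_ac)
  also have "\<dots> \<le> h * (\<mu> * (norm (x - xs))\<^sup>2)"
    using h by (intro mult_left_mono mult_right_mono) auto
  finally show ?thesis
    by (simp add: algebra_simps)
qed

section \<open>Scalar recursions\<close>

text \<open>A forcing of size \<open>h\<close> is worth a fixed multiple of the loss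
  \<open>1 - exp (- c * h)\<close> of one step. This replaces summing geometric series and produces
  the factors \<open>exp c / c\<close> below.\<close>

lemma one_minus_exp_ge:
  fixes c h :: real
  assumes "0 \<le> c" "0 \<le> h" "h \<le> 1"
  shows "c * exp (- c) * h \<le> 1 - exp (- c * h)"
proof -
  have "c * h * exp (- c) \<le> c * h * exp (- c * h)"
    using assms by (intro mult_left_mono) (auto simp: mult_left_le)
  also have "\<dots> \<le> 1 - exp (- c * h)"
  proof -
    have "(1 + c * h) * exp (- c * h) \<le> exp (c * h) * exp (- c * h)"
      by (intro mult_right_mono exp_ge_add_one_self) simp
    then show ?thesis
      by (simp add: exp_add[symmetric] algebra_simps)
  qed
  finally show ?thesis by (simp add: mult_ac)
qed

lemma discounted_recursion_bounded:
  fixes \<beta> :: "nat \<Rightarrow> real"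
  assumes h: "0 \<le> h" "h \<le> 1" and "0 < c" "0 \<le> K" and \<beta>0: "\<beta> 0 \<le> 1"
    and step: "\<And>n. \<beta> (Suc n) \<le> exp (- c * h) * \<beta> n + K * h"
  shows "\<beta> n \<le> 1 + K * exp c / c"
proof (induction n)
  case 0
  then show ?case
    using \<beta>0 \<open>0 < c\<close> \<open>0 \<le> K\<close> by (simp add: add_increasing2)
next
  case (Suc n)
  define D where "D = 1 + K * exp c / c"
  have "K * h = (K * exp c / c) * (c * exp (- c) * h)"
    using \<open>0 < c\<close> by (simp add: exp_minus)
  also have "\<dots> \<le> D * (1 - exp (- c * h))"
    unfolding D_def using one_minus_exp_ge[of c h] h \<open>0 < c\<close> \<open>0 \<le> K\<close>
    by (intro mult_mono) auto
  finally have "K * h \<le> D * (1 - exp (- c * h))" .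
  moreover have "exp (- c * h) * \<beta> n \<le> exp (- c * h) * D"
    using Suc unfolding D_def by (intro mult_left_mono) auto
  ultimately have "\<beta> (Suc n) \<le> exp (- c * h) * D + D * (1 - exp (- c * h))"
    using step[of n] by linarith
  then show ?case
    unfolding D_def[symmetric] by (simp add: algebra_simps)
qed

lemma second_moment_recursion:
  fixes b \<beta> I :: "nat \<Rightarrow> real"
  assumes h: "0 \<le> h" "h \<le> 1" and "0 < c" "0 \<le> K" "\<And>n. 0 \<le> I n"
    and \<beta>: "1 \<le> \<beta> 0" "\<And>n. exp (- c * h) * (\<beta> n + h * I n) \<le> \<beta> (Suc n)"
    and b: "b 0 \<le> R" "\<And>n. b (Suc n) \<le> exp (- c * h) * b n + R * K * (h ^ 3 + h * I n)"
    and "0 \<le> R"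
  shows "b n \<le> R * (1 + K * exp c * (1 + 1 / c)) * (\<beta> n + h\<^sup>2)"
proof (induction n)
  case 0
  have "R * 1 \<le> R * ((1 + K * exp c * (1 + 1 / c)) * (\<beta> 0 + h\<^sup>2))"
  proof (intro mult_left_mono)
    have "1 * 1 \<le> (1 + K * exp c * (1 + 1 / c)) * (\<beta> 0 + h\<^sup>2)"
      using \<beta>(1) \<open>0 < c\<close> \<open>0 \<le> K\<close> by (intro mult_mono add_increasing2) auto
    then show "1 \<le> (1 + K * exp c * (1 + 1 / c)) * (\<beta> 0 + h\<^sup>2)" by simp
  qed fact
  then show ?case
    using b(1) by (simp add: mult.assoc)
next
  case (Suc n)
  \<comment> \<open>The three requirements on \<open>D\<close>: at least 1 for the start; at least
    \<open>K * exp c\<close>, since \<beta> discounts the contribution of \<open>I n\<close> by one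
    step while the forcing does not; at least \<open>K * exp c / c\<close>, so that the decay of the
    term \<open>h\<^sup>2\<close> pays for \<open>K * h ^ 3\<close>.\<close>
  define D where "D = 1 + K * exp c * (1 + 1 / c)"
  define q where "q = exp (- c * h)"
  have D0: "0 \<le> D" and q0: "0 \<le> q"
    using \<open>0 < c\<close> \<open>0 \<le> K\<close> by (simp_all add: D_def q_def)
  have KD: "K * exp c \<le> D" "K * exp c / c \<le> D"
    using \<open>0 < c\<close> \<open>0 \<le> K\<close> by (simp_all add: D_def distrib_left add_increasing2 add_increasing)
  have 1: "K * (h * I n) \<le> D * (q * (h * I n))"
  proof -
    have "K \<le> K * exp c * q"
    proof -
      have "exp 0 \<le> exp (c + - c * h)"
        using h \<open>0 < c\<close> by (subst exp_le_cancel_iff) (simp add: mult_left_le)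
      then have "K * 1 \<le> K * exp (c + - c * h)"
        using \<open>0 \<le> K\<close> by (intro mult_left_mono) simp_all
      then show ?thesis
        unfolding q_def by (simp only: exp_add mult.assoc mult_1_right)
    qed
    also have "\<dots> \<le> D * q"
      using KD q0 by (intro mult_right_mono)
    finally have "K * (h * I n) \<le> D * q * (h * I n)"
      using h assms(5) by (intro mult_right_mono) auto
    then show ?thesis by (simp add: mult_ac)
  qed
  have 2: "K * h ^ 3 \<le> D * ((1 - q) * h\<^sup>2)"
  proof -
    have "K * h = (K * exp c / c) * (c * exp (- c) * h)"
      using \<open>0 < c\<close> by (simp add: exp_minus)
    also have "\<dots> \<le> D * (1 - q)"
      using KD one_minus_exp_ge[of c h] h \<open>0 < c\<close> D0 unfolding q_def
      by (intro mult_mono) auto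
    finally have "(K * h) * h\<^sup>2 \<le> (D * (1 - q)) * h\<^sup>2"
      by (intro mult_right_mono) auto
    then show ?thesis
      by (simp add: power2_eq_square power3_eq_cube mult_ac)
  qed
  have "b (Suc n) \<le> q * (R * D * (\<beta> n + h\<^sup>2)) + R * K * (h ^ 3 + h * I n)"
    using b(2)[of n] mult_left_mono[OF Suc q0] unfolding D_def[symmetric] q_def[symmetric] by simp
  also have "\<dots> = R * (D * (q * \<beta> n) + (K * (h * I n)) + (D * (q * h\<^sup>2) + K * h ^ 3))"
    by (simp add: algebra_simps)
  also have "\<dots> \<le> R * (D * (q * \<beta> n) + D * (q * (h * I n)) + (D * (q * h\<^sup>2) + D * ((1 - q) * h\<^sup>2)))"
    by (intro mult_left_mono add_mono order_refl 1 2 \<open>0 \<le> R\<close>)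
  also have "\<dots> = R * (D * (q * (\<beta> n + h * I n)) + D * h\<^sup>2)"
    by (simp add: algebra_simps)
  also have "\<dots> \<le> R * (D * \<beta> (Suc n) + D * h\<^sup>2)"
    using \<beta>(2)[of n] D0 \<open>0 \<le> R\<close> unfolding q_def by (intro mult_left_mono add_mono) auto
  finally show ?case
    unfolding D_def[symmetric] by (simp add: algebra_simps)
qed

text \<open>
  A direct summation would cost a logarithmic factor. The induction hypothesis carries the
  negative term \<open>- B \<beta>\<close>, which decays faster than \<open>sqrt \<beta>\<close> and thereby absorbs the forcing \<open>K h \<beta>\<close>.
\<close>

lemma mean_recursion:
  fixes z \<beta> :: "nat \<Rightarrow> real"
  assumes h: "0 \<le> h" "h \<le> 1" and "0 < \<mu>" "0 \<le> K"
    and \<beta>: "\<beta> 0 = 1" "\<And>n. exp (- 2 * \<mu> * h) * \<beta> n \<le> \<beta> (Suc n)" "\<And>n. 0 \<le> \<beta> n" "\<And>n. \<beta> n \<le> S"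
    and z: "z 0 \<le> R" "\<And>n. z (Suc n) \<le> exp (- \<mu> * h) * z n + R * K * (h ^ 3 + h * \<beta> n)"
    and "0 \<le> R"
  defines "B \<equiv> K * exp (2 * \<mu>) / \<mu>"
  shows "z n \<le> R * (1 + B + 2 * B * sqrt S) * (sqrt (\<beta> n) + h\<^sup>2)"
proof -
  define A where "A = 1 + B + 2 * B * sqrt S"
  define q where "q = exp (- \<mu> * h)"
  have q: "0 < q" "q \<le> 1"
    using h \<open>0 < \<mu>\<close> by (simp_all add: q_def)
  have B0: "0 \<le> B"
    using \<open>0 < \<mu>\<close> \<open>0 \<le> K\<close> by (simp add: B_def)
  have S0: "0 \<le> S"
    using \<beta>(3,4) order_trans by blast
  have qq: "q * q = exp (- 2 * \<mu> * h)"
    by (simp add: q_def exp_add[symmetric])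
  \<comment> \<open>Only a lower bound for \<open>\<beta> (Suc n)\<close> in terms of
    \<open>\<beta> n\<close> is at hand, so the invariant must be increasing in \<beta>. On
    \<open>[0, S]\<close> this holds because \<open>A\<close> contains
    \<open>2 * B * sqrt S\<close>.\<close>
  have g_mono: "A * sqrt x - B * x \<le> A * sqrt y - B * y" if "0 \<le> x" "x \<le> y" "y \<le> S" for x y
  proof -
    have "sqrt x \<le> sqrt S" "sqrt y \<le> sqrt S"
      using that by auto
    then have "B * (sqrt x + sqrt y) \<le> B * (2 * sqrt S)"
      by (intro mult_left_mono B0) linarith
    also have "\<dots> \<le> A"
      using B0 by (simp add: A_def)
    finally have "B * (sqrt x + sqrt y) * (sqrt y - sqrt x) \<le> A * (sqrt y - sqrt x)"
      using that by (intro mult_right_mono) auto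
    moreover have "(sqrt x + sqrt y) * (sqrt y - sqrt x) = y - x"
      using that by (simp add: algebra_simps)
    ultimately show ?thesis
      using that by (simp add: algebra_simps)
  qed
  \<comment> \<open>In one step the linear recursion contracts by \<open>q\<close>, but \<beta> may
    decay by \<open>q * q\<close>. The gap \<open>q - q * q\<close> is of order \<open>h\<close>,
    and \<open>B\<close> is large enough for it to absorb the forcing.\<close>
  have Kh: "K * h \<le> B * (q * (1 - q))"
  proof -
    have e: "\<mu> * exp (- \<mu>) * h \<le> 1 - q"
      unfolding q_def using one_minus_exp_ge[of \<mu> h] h \<open>0 < \<mu>\<close> by simp
    have "exp (- \<mu>) \<le> q"
      using h \<open>0 < \<mu>\<close> by (simp add: q_def mult_left_le)
    then have "exp (- \<mu>) * (\<mu> * exp (- \<mu>) * h) \<le> q * (1 - q)"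
      using e q h \<open>0 < \<mu>\<close> by (intro mult_mono) auto
    then have "B * (exp (- \<mu>) * (\<mu> * exp (- \<mu>) * h)) \<le> B * (q * (1 - q))"
      using B0 by (rule mult_left_mono)
    moreover have "B * (exp (- \<mu>) * (\<mu> * exp (- \<mu>) * h)) = K * h * (exp (2 * \<mu>) * exp (- \<mu>) * exp (- \<mu>))"
      using \<open>0 < \<mu>\<close> by (simp add: B_def)
    moreover have "exp (2 * \<mu>) * exp (- \<mu>) * exp (- \<mu>) = 1"
      by (simp add: exp_add[symmetric])
    ultimately show ?thesis by simp
  qed
  have "z n \<le> R * (A * sqrt (\<beta> n) - B * \<beta> n + B * h\<^sup>2)"
  proof (induction n)
    case 0
    have "R * 1 \<le> R * (A * sqrt (\<beta> 0) - B * \<beta> 0 + B * h\<^sup>2)"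
      using \<beta>(1) B0 S0 \<open>0 \<le> R\<close> by (intro mult_left_mono) (auto simp: A_def)
    then show ?case
      using z(1) by simp
  next
    case (Suc n)
    have "K * h * \<beta> n \<le> B * (q * (1 - q)) * \<beta> n"
      using Kh \<beta>(3) by (rule mult_right_mono)
    then have 1: "- q * (B * \<beta> n) + K * (h * \<beta> n) \<le> - B * (q * q * \<beta> n)"
      by (simp add: algebra_simps)
    have "K * h \<le> B * (1 - q)"
      using Kh mult_left_mono[OF mult_right_mono[OF q(2), of "1 - q"] B0] q by simp
    then have "K * h * h\<^sup>2 \<le> B * (1 - q) * h\<^sup>2"
      by (intro mult_right_mono) auto
    then have 2: "q * (B * h\<^sup>2) + K * h ^ 3 \<le> B * h\<^sup>2"
      by (simp add: power2_eq_square power3_eq_cube algebra_simps)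
    have 3: "A * (q * sqrt (\<beta> n)) - B * (q * q * \<beta> n) \<le> A * sqrt (\<beta> (Suc n)) - B * \<beta> (Suc n)"
    proof -
      have "sqrt (q * q * \<beta> n) = q * sqrt (\<beta> n)"
        using q by (simp add: real_sqrt_mult)
      then show ?thesis
        using g_mono[of "q * q * \<beta> n" "\<beta> (Suc n)"] \<beta>(2,3,4) q by (simp add: qq)
    qed
    have "z (Suc n) \<le> q * (R * (A * sqrt (\<beta> n) - B * \<beta> n + B * h\<^sup>2)) + R * K * (h ^ 3 + h * \<beta> n)"
      using z(2)[of n] mult_left_mono[OF Suc less_imp_le[OF q(1)]] unfolding q_def[symmetric]
      by linarith
    also have "\<dots> = R * (A * (q * sqrt (\<beta> n)) + (- q * (B * \<beta> n) + K * (h * \<beta> n)) + (q * (B * h\<^sup>2) + K * h ^ 3))"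
      by (simp add: algebra_simps)
    also have "\<dots> \<le> R * (A * (q * sqrt (\<beta> n)) + - B * (q * q * \<beta> n) + B * h\<^sup>2)"
      by (intro mult_left_mono add_mono order_refl 1 2 \<open>0 \<le> R\<close>)
    also have "\<dots> \<le> R * (A * sqrt (\<beta> (Suc n)) - B * \<beta> (Suc n) + B * h\<^sup>2)"
      using 3 by (intro mult_left_mono \<open>0 \<le> R\<close>) linarith
    finally show ?case .
  qed
  also have "\<dots> \<le> R * (A * sqrt (\<beta> n) + A * h\<^sup>2)"
    using B0 S0 \<beta>(3)[of n] \<open>0 \<le> R\<close> by (intro mult_left_mono add_mono mult_right_mono) (auto simp: A_def)
  finally show ?thesis
    by (simp add: A_def algebra_simps)
qed

section \<open>Standard Gaussian vectors\<close>

lemma norm_matrix_vector_mult_le: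
  fixes A :: "real^'n^'m" and x :: "real^'n"
  shows "norm (A *v x) \<le> norm A * norm x"
proof (rule power2_le_imp_le)
  have "(norm (A *v x))\<^sup>2 = (\<Sum>i\<in>UNIV. (A $ i \<bullet> x)\<^sup>2)"
    by (simp only: power2_norm_eq_inner inner_vec_def[of "A *v x"] matrix_vector_mul_component)
      (simp add: power2_eq_square)
  also have "\<dots> \<le> (\<Sum>i\<in>UNIV. (norm (A $ i))\<^sup>2 * (norm x)\<^sup>2)"
    by (intro sum_mono) (simp add: Cauchy_Schwarz_ineq power2_norm_eq_inner)
  also have "\<dots> = (norm A * norm x)\<^sup>2"
    by (simp only: power_mult_distrib power2_norm_eq_inner[of A] inner_vec_def[of A]
        sum_distrib_right power2_norm_eq_inner)
  finally show "(norm (A *v x))\<^sup>2 \<le> (norm A * norm x)\<^sup>2" .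
qed simp

lemma prod_std_normal_density:
  fixes x :: "real^'n"
  shows "(\<Prod>i\<in>UNIV. std_normal_density (x $ i)) = (1 / sqrt (2 * pi)) ^ CARD('n) * exp (- (norm x)\<^sup>2 / 2)"
proof -
  have "(norm x)\<^sup>2 = (\<Sum>i\<in>UNIV. (x $ i)\<^sup>2)"
    by (simp only: power2_norm_eq_inner inner_vec_def) (simp add: power2_eq_square)
  then show ?thesis
    by (simp add: std_normal_density_def prod.distrib exp_sum[symmetric] sum_divide_distrib sum_negf
        prod_dividef power_divide)
qed

text \<open>Half of the Gaussian exponent is held back, so that this function dominates the Gaussian
  density times a polynomial. Coordinatewise it is a multiple of the normal density of variance
  2.\<close>

lemma integrable_exp_norm_sq:
  "integrable lborel (\<lambda>x :: 'a::euclidean_space. exp (- (norm x)\<^sup>2 / 4))"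
proof (rule integrableI_nonneg)
  have *: "integrable lborel (\<lambda>y::real. exp (- y\<^sup>2 / 4))"
  proof -
    have "(\<lambda>y::real. exp (- y\<^sup>2 / 4)) = (\<lambda>y. sqrt (4 * pi) * normal_density 0 (sqrt 2) y)"
      by (auto simp: normal_density_def)
    then show ?thesis
      using integrable_normal_density[of "sqrt 2" 0] by simp
  qed
  have "(\<integral>\<^sup>+x. ennreal (exp (- (norm x)\<^sup>2 / 4)) \<partial>(lborel :: 'a measure))
      = (\<integral>\<^sup>+x. (\<Prod>b\<in>Basis. ennreal (exp (- (x \<bullet> b)\<^sup>2 / 4))) \<partial>(lborel :: 'a measure))"
  proof (intro nn_integral_cong)
    fix x :: 'a
    have "(norm x)\<^sup>2 = (\<Sum>b\<in>Basis. (x \<bullet> b)\<^sup>2)"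
      by (simp only: power2_norm_eq_inner euclidean_inner[of x x]) (simp add: power2_eq_square)
    then show "ennreal (exp (- (norm x)\<^sup>2 / 4)) = (\<Prod>b\<in>Basis. ennreal (exp (- (x \<bullet> b)\<^sup>2 / 4)))"
      by (simp add: prod_ennreal exp_sum[symmetric] sum_divide_distrib sum_negf)
  qed
  also have "\<dots> = (\<Prod>b\<in>(Basis :: 'a set). \<integral>\<^sup>+y. ennreal (exp (- y\<^sup>2 / 4)) \<partial>lborel)"
    by (rule nn_integral_lborel_prod) auto
  also have "\<dots> < \<infinity>"
    using * by (simp add: nn_integral_eq_integral ennreal_power power_less_top_ennreal)
  finally show "(\<integral>\<^sup>+x. ennreal (exp (- (norm x)\<^sup>2 / 4)) \<partial>(lborel :: 'a measure)) < \<infinity>" .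
qed auto

text \<open>Lebesgue measure is invariant under reflection, so the integral equals its negative. For
  a non-integrable \<open>g\<close> the same equations hold with the default value 0.\<close>

lemma integral_lborel_odd:
  fixes g :: "'a::euclidean_space \<Rightarrow> real"
  assumes [measurable]: "g \<in> borel_measurable borel" and odd: "\<And>x. g (- x) = - g x"
  shows "integral\<^sup>L lborel g = 0"
proof -
  have "(lborel :: 'a measure) = distr lborel borel (\<lambda>x. - x)"
    using lborel_affine[of "-1" "0 :: 'a"] by (simp add: density_1)
  then have "integral\<^sup>L lborel g = integral\<^sup>L (distr lborel borel (\<lambda>x. - x)) g"
    by simp
  also have "\<dots> = (\<integral>x. g (- x) \<partial>lborel)"
    by (rule integral_distr) simp_all
  also have "\<dots> = - integral\<^sup>L lborel g"
    by (simp add: odd)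
  finally show ?thesis by simp
qed

lemma standard_gaussian_moments:
  fixes Y :: "'w \<Rightarrow> real^'n"
  assumes "standard_gaussian M Y"
  shows "integrable M (\<lambda>\<omega>. norm (Y \<omega>) ^ 4)" and "(\<integral>\<omega>. Y \<omega> $ i \<partial>M) = 0"
proof -
  define f where "f x = (\<Prod>i\<in>UNIV. std_normal_density (x $ i))" for x :: "real^'n"
  define c where "c = (1 / sqrt (2 * pi)) ^ CARD('n)"
  have f: "f x = c * exp (- (norm x)\<^sup>2 / 2)" for x
    by (simp add: f_def c_def prod_std_normal_density)
  have c0: "0 \<le> c" by (simp add: c_def)
  have f0: "0 \<le> f x" for x
    by (simp add: f c0)
  have [measurable]: "f \<in> borel_measurable borel"
    unfolding f[abs_def] by measurable
  have dist: "distributed M lborel Y (\<lambda>x. ennreal (f x))"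
    using assms by (simp add: standard_gaussian_def f_def)
  have "integrable lborel (\<lambda>x. f x * norm x ^ 4)"
  proof (rule Bochner_Integration.integrable_bound)
    show "integrable lborel (\<lambda>x :: real^'n. 32 * c * exp (- (norm x)\<^sup>2 / 4))"
      by (intro integrable_mult_right integrable_exp_norm_sq)
    show "AE x in lborel. norm (f x * norm x ^ 4) \<le> norm (32 * c * exp (- (norm x)\<^sup>2 / 4))"
    proof (intro AE_I2)
      fix x :: "real^'n"
      \<comment> \<open>With this \<open>t\<close>, \<open>norm x ^ 4 = 16 * t\<^sup>2\<close>, and
        \<open>t\<^sup>2 \<le> 2 * exp t\<close> gives the constant 32 and leaves the exponent
        \<open>- t\<close>.\<close>
      define t where "t = (norm x)\<^sup>2 / 4"
      have "0 \<le> t" by (simp add: t_def)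
      then have "t\<^sup>2 \<le> 2 * exp t"
        using exp_lower_Taylor_quadratic[of t] by simp
      then have "c * exp (- 2 * t) * (16 * t\<^sup>2) \<le> c * exp (- 2 * t) * (16 * (2 * exp t))"
        using c0 by (intro mult_left_mono) auto
      also have "\<dots> = 32 * c * (exp (- 2 * t) * exp t)"
        by simp
      also have "\<dots> = 32 * c * exp (- t)"
        by (simp only: exp_add[symmetric]) simp
      finally show "norm (f x * norm x ^ 4) \<le> norm (32 * c * exp (- (norm x)\<^sup>2 / 4))"
        using c0 by (simp add: f t_def power2_eq_square power4_eq_xxxx abs_mult mult_ac)
    qed
  qed measurable
  then show "integrable M (\<lambda>\<omega>. norm (Y \<omega>) ^ 4)"
    using distributed_integrable[OF dist, of "\<lambda>x. norm x ^ 4"] f0 by simp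
  have [measurable]: "(\<lambda>x. x $ i) \<in> borel_measurable (borel :: (real^'n) measure)"
    by (intro borel_measurable_continuous_onI continuous_intros)
  have "(\<integral>\<omega>. Y \<omega> $ i \<partial>M) = (\<integral>x. f x * x $ i \<partial>lborel)"
    using distributed_integral[OF dist, of "\<lambda>x. x $ i"] f0 by simp
  also have "\<dots> = 0"
    by (rule integral_lborel_odd) (simp_all add: f)
  finally show "(\<integral>\<omega>. Y \<omega> $ i \<partial>M) = 0" .
qed


section \<open>One step driven by independent noise\<close>


lemma borel_measurable_vec_nth_compose:
  "f \<in> borel_measurable M \<Longrightarrow> (\<lambda>x. f x $ i) \<in> borel_measurable M" for f :: "'a \<Rightarrow> ('b::real_normed_vector)^'n"
proof -
  assume f: "f \<in> borel_measurable M"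
  have "(\<lambda>v :: 'b^'n. v $ i) \<in> borel_measurable borel"
    by (intro borel_measurable_continuous_onI continuous_intros)
  from measurable_compose[OF f this] show ?thesis .
qed

lemma borel_measurable_matrix_vector_mult:
  fixes A :: "'a \<Rightarrow> real^'n^'m" and v :: "'a \<Rightarrow> real^'n"
  assumes "A \<in> borel_measurable M" "v \<in> borel_measurable M"
  shows "(\<lambda>x. A x *v v x) \<in> borel_measurable M"
proof (rule borel_measurable_continuous_Pair[OF assms])
  have "bounded_bilinear ((*v) :: real^'n^'m \<Rightarrow> real^'n \<Rightarrow> real^'m)"
    by (rule bounded_bilinear.intro)
      (auto simp: matrix_vector_mult_add_rdistrib matrix_vector_right_distrib scaleR_matrix_vector_assoc
        matrix_vector_mult_scaleR intro!: exI[of _ 1] norm_matrix_vector_mult_le)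
  from bounded_bilinear.continuous_on[OF this continuous_on_fst[OF continuous_on_id]
      continuous_on_snd[OF continuous_on_id]]
  show "continuous_on UNIV (\<lambda>x :: (real^'n^'m) \<times> (real^'n). fst x *v snd x)" .
qed

context prob_space
begin

lemma integrable_power_le:
  fixes f :: "'a \<Rightarrow> real"
  assumes "integrable M (\<lambda>\<omega>. f \<omega> ^ 4)" and [measurable]: "f \<in> borel_measurable M"
    and "\<And>\<omega>. 0 \<le> f \<omega>" and "k \<le> 4"
  shows "integrable M (\<lambda>\<omega>. f \<omega> ^ k)"
proof (rule Bochner_Integration.integrable_bound)
  show "integrable M (\<lambda>\<omega>. 1 + f \<omega> ^ 4)"
    using assms(1) by simp
  have "f \<omega> ^ k \<le> 1 + f \<omega> ^ 4" for \<omega>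
  proof (cases "f \<omega> \<le> 1")
    case True
    then show ?thesis
      using assms(3)[of \<omega>] power_le_one[of "f \<omega>" k] by (simp add: add_increasing2)
  next
    case False
    then have "1 \<le> f \<omega>" by simp
    from power_increasing[OF \<open>k \<le> 4\<close> this] show ?thesis by simp
  qed
  then show "AE \<omega> in M. norm (f \<omega> ^ k) \<le> norm (1 + f \<omega> ^ 4)"
    using assms(3) by (intro AE_I2) simp
qed measurable

lemma indep_var_product:
  fixes X Y :: "'a \<Rightarrow> 'b::topological_space" and f g :: "'b \<Rightarrow> real"
  assumes "indep_var borel X borel Y"
    and "f \<in> borel_measurable borel" "g \<in> borel_measurable borel"
    and "integrable M (\<lambda>\<omega>. f (X \<omega>))" "integrable M (\<lambda>\<omega>. g (Y \<omega>))"
  shows "integrable M (\<lambda>\<omega>. f (X \<omega>) * g (Y \<omega>))"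
    and "expectation (\<lambda>\<omega>. f (X \<omega>) * g (Y \<omega>)) = expectation (\<lambda>\<omega>. f (X \<omega>)) * expectation (\<lambda>\<omega>. g (Y \<omega>))"
proof -
  have i: "indep_var borel (\<lambda>\<omega>. f (X \<omega>)) borel (\<lambda>\<omega>. g (Y \<omega>))"
    using indep_var_compose[OF assms(1-3)] by (simp add: comp_def)
  show "integrable M (\<lambda>\<omega>. f (X \<omega>) * g (Y \<omega>))"
    using i assms(4,5) by (rule indep_var_integrable)
  show "expectation (\<lambda>\<omega>. f (X \<omega>) * g (Y \<omega>)) = expectation (\<lambda>\<omega>. f (X \<omega>)) * expectation (\<lambda>\<omega>. g (Y \<omega>))"
    using i assms(4,5) by (rule indep_var_lebesgue_integral)
qed

text \<open>In the coordinates of \<open>Y\<close> the inner product is a finite sum of products of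
  a function of \<open>X\<close> and a coordinate \<open>Y \<omega> $ j\<close>. Independence
  factorizes each expectation, and the second factor is 0.\<close>

lemma indep_centered_noise:
  fixes X Y :: "'a \<Rightarrow> real^'n"
    and p :: "real^'n \<Rightarrow> real^'m" and S :: "real^'n \<Rightarrow> real^'n^'m"
  assumes indep: "indep_var borel X borel Y"
    and p: "p \<in> borel_measurable borel" and S: "S \<in> borel_measurable borel"
    and int: "integrable M (\<lambda>\<omega>. norm (p (X \<omega>)) * norm (S (X \<omega>)))"
    and Y: "integrable M (\<lambda>\<omega>. norm (Y \<omega>))" "\<And>i. expectation (\<lambda>\<omega>. Y \<omega> $ i) = 0"
  shows "integrable M (\<lambda>\<omega>. p (X \<omega>) \<bullet> (S (X \<omega>) *v Y \<omega>))"
    and "expectation (\<lambda>\<omega>. p (X \<omega>) \<bullet> (S (X \<omega>) *v Y \<omega>)) = 0"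
proof -
  note [measurable] = indep_var_rv1[OF indep] indep_var_rv2[OF indep] p S borel_measurable_vec_nth_compose
  define r where "r j x = (\<Sum>i\<in>UNIV. p x $ i * S x $ i $ j)" for j x
  have eq: "p (X \<omega>) \<bullet> (S (X \<omega>) *v Y \<omega>) = (\<Sum>j\<in>UNIV. r j (X \<omega>) * Y \<omega> $ j)" for \<omega>
    unfolding dot_lmul_matrix[symmetric] by (simp add: inner_vec_def vector_matrix_mult_def r_def mult.commute)
  have [measurable]: "r j \<in> borel_measurable borel" for j
    unfolding r_def by measurable
  have r_le: "\<bar>r j x\<bar> \<le> (\<Sum>i\<in>(UNIV :: 'm set). norm (p x) * norm (S x))" for j x
  proof -
    have "\<bar>r j x\<bar> \<le> (\<Sum>i\<in>UNIV. \<bar>p x $ i\<bar> * \<bar>S x $ i $ j\<bar>)"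
      unfolding r_def by (rule order_trans[OF sum_abs]) (simp add: abs_mult)
    also have "\<dots> \<le> (\<Sum>i\<in>(UNIV :: 'm set). norm (p x) * norm (S x))"
    proof (intro sum_mono mult_mono)
      fix i
      have "\<bar>S x $ i $ j\<bar> \<le> norm (S x $ i)"
        by (rule component_le_norm_cart)
      also have "\<dots> \<le> norm (S x)"
        by (rule Finite_Cartesian_Product.norm_nth_le)
      finally show "\<bar>S x $ i $ j\<bar> \<le> norm (S x)" .
    qed (auto intro: component_le_norm_cart)
    finally show ?thesis .
  qed
  have r_int: "integrable M (\<lambda>\<omega>. r j (X \<omega>))" for j
  proof (rule Bochner_Integration.integrable_bound)
    show "integrable M (\<lambda>\<omega>. \<Sum>i\<in>(UNIV :: 'm set). norm (p (X \<omega>)) * norm (S (X \<omega>)))"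
      using int by simp
    show "AE \<omega> in M. norm (r j (X \<omega>)) \<le> norm (\<Sum>i\<in>(UNIV :: 'm set). norm (p (X \<omega>)) * norm (S (X \<omega>)))"
      using r_le by (intro AE_I2) (metis abs_ge_self order_trans real_norm_def)
  qed measurable
  have Y_int: "integrable M (\<lambda>\<omega>. Y \<omega> $ j)" for j
    by (rule Bochner_Integration.integrable_bound[OF Y(1)]) (auto simp: component_le_norm_cart)
  have j: "integrable M (\<lambda>\<omega>. r j (X \<omega>) * Y \<omega> $ j)" "expectation (\<lambda>\<omega>. r j (X \<omega>) * Y \<omega> $ j) = 0" for j
    using indep_var_product[OF indep, of "r j" "\<lambda>y. y $ j"] r_int Y_int Y(2) by auto
  then show "integrable M (\<lambda>\<omega>. p (X \<omega>) \<bullet> (S (X \<omega>) *v Y \<omega>))"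
    "expectation (\<lambda>\<omega>. p (X \<omega>) \<bullet> (S (X \<omega>) *v Y \<omega>)) = 0"
    by (simp_all add: eq)
qed

end

text \<open>With \<open>b\<close> the noise, \<open>4 * (norm a)\<^sup>2 * (a \<bullet> b)\<close>
  must be kept exactly because its mean vanishes. The other cross terms have no sign and are at
  least quadratic in \<open>b\<close>; Cauchy-Schwarz and Young suffice for them.\<close>

lemma norm_add_power4_le:
  fixes a b :: "'a::real_inner"
  shows "norm (a + b) ^ 4 \<le> norm a ^ 4 + 4 * ((norm a)\<^sup>2 * (a \<bullet> b)) + 8 * ((norm a)\<^sup>2 * (norm b)\<^sup>2) + 3 * norm b ^ 4"
proof -
  define A where "A = norm a"
  define D where "D = norm b"
  define i where "i = a \<bullet> b"
  have i: "\<bar>i\<bar> \<le> A * D"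
    unfolding i_def A_def D_def by (rule Cauchy_Schwarz_ineq2)
  have AD: "0 \<le> A" "0 \<le> D"
    by (simp_all add: A_def D_def)
  have i2: "i\<^sup>2 \<le> A\<^sup>2 * D\<^sup>2"
    using power_mono[OF i, of 2] by (simp add: power_mult_distrib)
  have iD: "i * D\<^sup>2 \<le> (A\<^sup>2 * D\<^sup>2 + D\<^sup>2 * D\<^sup>2) / 2"
  proof -
    have "i \<le> (A\<^sup>2 + D\<^sup>2) / 2"
      using i sum_squares_bound[of A D] by simp
    then have "i * D\<^sup>2 \<le> (A\<^sup>2 + D\<^sup>2) / 2 * D\<^sup>2"
      by (rule mult_right_mono) simp
    then show ?thesis
      by (simp add: field_simps)
  qed
  have "norm (a + b) ^ 4 = ((norm (a + b))\<^sup>2)\<^sup>2"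
    by simp
  also have "(norm (a + b))\<^sup>2 = A\<^sup>2 + 2 * i + D\<^sup>2"
    by (simp add: A_def D_def i_def power2_norm_eq_inner inner_add_left inner_add_right inner_commute)
  also have "(A\<^sup>2 + 2 * i + D\<^sup>2)\<^sup>2
      = A\<^sup>2 * A\<^sup>2 + 4 * (A\<^sup>2 * i) + 4 * i\<^sup>2 + D\<^sup>2 * D\<^sup>2 + 2 * (A\<^sup>2 * D\<^sup>2) + 4 * (i * D\<^sup>2)"
    by (simp add: power2_eq_square algebra_simps)
  also have "\<dots> \<le> A\<^sup>2 * A\<^sup>2 + 4 * (A\<^sup>2 * i) + 8 * (A\<^sup>2 * D\<^sup>2) + 3 * (D\<^sup>2 * D\<^sup>2)"
    using i2 iD by simp
  finally show ?thesis
    by (simp add: A_def D_def i_def power2_eq_square power4_eq_xxxx mult_ac)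
qed

text \<open>Every term linear in the noise has mean zero, so the noise acts on even moments only at
  order h^2 and on the mean not at all. The weight \<open>w\<close> stays explicit, since it will
  depend on the step.\<close>

lemma (in prob_space) noisy_step:
  fixes X Y :: "'a \<Rightarrow> real^'n" and \<Phi> :: "real^'n \<Rightarrow> real^'n" and S :: "real^'n \<Rightarrow> real^'n^'n"
    and xs :: "real^'n" and h w :: real
  assumes indep: "indep_var borel X borel Y"
    and \<Phi>: "\<Phi> \<in> borel_measurable borel" and S: "S \<in> borel_measurable borel"
    and X4: "integrable M (\<lambda>\<omega>. norm (X \<omega> - xs) ^ 4)"
    and Y4: "integrable M (\<lambda>\<omega>. norm (Y \<omega>) ^ 4)" and Y0: "\<And>i. expectation (\<lambda>\<omega>. Y \<omega> $ i) = 0"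
    and \<Phi>_le: "\<And>x. (norm (\<Phi> x - xs))\<^sup>2 \<le> (norm (x - xs))\<^sup>2"
    and S_le: "\<And>x. (norm (S x))\<^sup>2 \<le> w * (1 + (norm (x - xs))\<^sup>2)"
  defines "X' \<equiv> \<lambda>\<omega>. \<Phi> (X \<omega>) + h *\<^sub>R (S (X \<omega>) *v Y \<omega>)"
    and "m2 \<equiv> expectation (\<lambda>\<omega>. (norm (Y \<omega>))\<^sup>2)" and "m4 \<equiv> expectation (\<lambda>\<omega>. norm (Y \<omega>) ^ 4)"
    and "c4 \<equiv> expectation (\<lambda>\<omega>. norm (X \<omega> - xs) ^ 4)"
  shows "integrable M (\<lambda>\<omega>. norm (X' \<omega> - xs) ^ 4)"
    and "expectation (\<lambda>\<omega>. (norm (X' \<omega> - xs))\<^sup>2)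
      \<le> expectation (\<lambda>\<omega>. (norm (\<Phi> (X \<omega>) - xs))\<^sup>2)
        + h\<^sup>2 * w * m2 * (1 + expectation (\<lambda>\<omega>. (norm (X \<omega> - xs))\<^sup>2))"
    and "expectation (\<lambda>\<omega>. norm (X' \<omega> - xs) ^ 4)
      \<le> expectation (\<lambda>\<omega>. norm (\<Phi> (X \<omega>) - xs) ^ 4) + h\<^sup>2 * (16 * w * m2 + 6 * h\<^sup>2 * w\<^sup>2 * m4) * (1 + c4)"
    and "expectation (\<lambda>\<omega>. X' \<omega> - xs) = expectation (\<lambda>\<omega>. \<Phi> (X \<omega>) - xs)"
proof -
  note [measurable] = indep_var_rv1[OF indep] indep_var_rv2[OF indep] \<Phi> S
  define a where "a x = \<Phi> x - xs" for x
  define e where "e x = norm (x - xs)" for x :: "real^'n"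
  define b where "b \<omega> = h *\<^sub>R (S (X \<omega>) *v Y \<omega>)" for \<omega>
  have [measurable]: "a \<in> borel_measurable borel" "e \<in> borel_measurable borel"
    unfolding a_def[abs_def] e_def[abs_def] by measurable
  have SY_meas[measurable]: "(\<lambda>\<omega>. S (X \<omega>) *v Y \<omega>) \<in> borel_measurable M"
    by (intro borel_measurable_matrix_vector_mult) measurable
  have b_meas[measurable]: "b \<in> borel_measurable M"
    unfolding b_def[abs_def] by measurable
  have X': "X' \<omega> - xs = a (X \<omega>) + b \<omega>" for \<omega>
    by (simp add: X'_def a_def b_def)
  have e0: "0 \<le> e x" for x by (simp add: e_def)
  have w0: "0 \<le> w"
    using order_trans[OF zero_le_power2 S_le[of xs]] by simp
  have a_e: "norm (a x) \<le> e x" for x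
    using \<Phi>_le[of x] e0[of x] unfolding a_def e_def by (rule power2_le_imp_le)
  have e4: "integrable M (\<lambda>\<omega>. e (X \<omega>) ^ 4)"
    using X4 by (simp add: e_def)
  have e_int: "integrable M (\<lambda>\<omega>. e (X \<omega>) ^ k)" if "k \<le> 4" for k
    by (rule integrable_power_le[OF e4 _ _ that]) (auto simp: e0)
  have Y_int: "integrable M (\<lambda>\<omega>. norm (Y \<omega>) ^ k)" if "k \<le> 4" for k
    by (rule integrable_power_le[OF Y4 _ _ that]) auto
  have a_int: "integrable M (\<lambda>\<omega>. norm (a (X \<omega>)) ^ k)" if "k \<le> 4" for k
  proof (rule Bochner_Integration.integrable_bound[OF e_int[OF that]])
    show "AE \<omega> in M. norm (norm (a (X \<omega>)) ^ k) \<le> norm (e (X \<omega>) ^ k)"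
      using a_e e0 by (intro AE_I2) (simp add: power_mono)
  qed measurable
  have m2: "0 \<le> m2" and m4: "0 \<le> m4"
    by (simp_all add: m2_def m4_def)
  have b2: "(norm (b \<omega>))\<^sup>2 \<le> h\<^sup>2 * w * ((1 + e (X \<omega>) ^ 2) * norm (Y \<omega>) ^ 2)" for \<omega>
  proof -
    have "(norm (S (X \<omega>) *v Y \<omega>))\<^sup>2 \<le> (norm (S (X \<omega>)) * norm (Y \<omega>))\<^sup>2"
      by (intro power_mono norm_matrix_vector_mult_le) simp
    also have "\<dots> \<le> w * (1 + e (X \<omega>) ^ 2) * norm (Y \<omega>) ^ 2"
      unfolding power_mult_distrib using S_le[of "X \<omega>"] by (intro mult_right_mono) (auto simp: e_def)
    finally show ?thesis
      unfolding b_def by (simp add: power_mult_distrib mult_left_mono mult.assoc)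
  qed
  have int2: "integrable M (\<lambda>\<omega>. (1 + e (X \<omega>) ^ 2) * norm (Y \<omega>) ^ 2)"
    and E2: "expectation (\<lambda>\<omega>. (1 + e (X \<omega>) ^ 2) * norm (Y \<omega>) ^ 2)
      = (1 + expectation (\<lambda>\<omega>. e (X \<omega>) ^ 2)) * m2"
    using indep_var_product[OF indep, of "\<lambda>x. 1 + e x ^ 2" "\<lambda>y. norm y ^ 2"] e_int[of 2] Y_int[of 2]
    by (simp_all add: m2_def prob_space)
  have int4: "integrable M (\<lambda>\<omega>. (1 + e (X \<omega>) ^ 4) * norm (Y \<omega>) ^ k)"
    and E4: "expectation (\<lambda>\<omega>. (1 + e (X \<omega>) ^ 4) * norm (Y \<omega>) ^ k)
      = (1 + c4) * expectation (\<lambda>\<omega>. norm (Y \<omega>) ^ k)" if "k \<le> 4" for k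
    using indep_var_product[OF indep, of "\<lambda>x. 1 + e x ^ 4" "\<lambda>y. norm y ^ k"] e4 Y_int[OF that]
    by (simp_all add: c4_def e_def prob_space)
  have sq_le: "(1 + e x ^ 2)\<^sup>2 \<le> 2 * (1 + e x ^ 4)" for x
  proof -
    have "(1 + t)\<^sup>2 \<le> 2 * (1 + t\<^sup>2)" for t :: real
      using zero_le_power2[of "1 - t"] by (simp add: power2_eq_square algebra_simps)
    from this[of "e x ^ 2"] show ?thesis by simp
  qed
  have b4: "norm (b \<omega>) ^ 4 \<le> 2 * (h ^ 4 * w\<^sup>2) * ((1 + e (X \<omega>) ^ 4) * norm (Y \<omega>) ^ 4)" for \<omega>
  proof -
    have "norm (b \<omega>) ^ 4 = ((norm (b \<omega>))\<^sup>2)\<^sup>2" by simp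
    also have "\<dots> \<le> (h\<^sup>2 * w * ((1 + e (X \<omega>) ^ 2) * norm (Y \<omega>) ^ 2))\<^sup>2"
      by (intro power_mono b2) simp
    also have "\<dots> = h ^ 4 * w\<^sup>2 * norm (Y \<omega>) ^ 4 * (1 + e (X \<omega>) ^ 2)\<^sup>2"
      by (simp add: power_mult_distrib)
    also have "\<dots> \<le> h ^ 4 * w\<^sup>2 * norm (Y \<omega>) ^ 4 * (2 * (1 + e (X \<omega>) ^ 4))"
      by (intro mult_left_mono sq_le) simp
    finally show ?thesis by (simp only: mult_ac)
  qed
  have ab: "(norm (a (X \<omega>)))\<^sup>2 * (norm (b \<omega>))\<^sup>2 \<le> 2 * (h\<^sup>2 * w) * ((1 + e (X \<omega>) ^ 4) * norm (Y \<omega>) ^ 2)" for \<omega>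
  proof -
    have "(norm (a (X \<omega>)))\<^sup>2 \<le> 1 + e (X \<omega>) ^ 2"
      using power_mono[OF a_e, of "X \<omega>" 2] by simp
    then have "(norm (a (X \<omega>)))\<^sup>2 * (norm (b \<omega>))\<^sup>2
        \<le> (1 + e (X \<omega>) ^ 2) * (h\<^sup>2 * w * ((1 + e (X \<omega>) ^ 2) * norm (Y \<omega>) ^ 2))"
      using b2 by (intro mult_mono) auto
    also have "\<dots> = h\<^sup>2 * w * norm (Y \<omega>) ^ 2 * (1 + e (X \<omega>) ^ 2)\<^sup>2"
      by (simp add: power2_eq_square mult_ac)
    also have "\<dots> \<le> h\<^sup>2 * w * norm (Y \<omega>) ^ 2 * (2 * (1 + e (X \<omega>) ^ 4))"
      using w0 by (intro mult_left_mono sq_le) simp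
    finally show ?thesis by (simp only: mult_ac)
  qed
  have b4_int: "integrable M (\<lambda>\<omega>. norm (b \<omega>) ^ 4)"
    by (rule Bochner_Integration.integrable_bound[OF integrable_mult_right[OF int4[OF order_refl]]])
      (use b4 in \<open>auto intro!: AE_I2 order_trans[OF _ abs_ge_self]\<close>)
  have b2_int: "integrable M (\<lambda>\<omega>. (norm (b \<omega>))\<^sup>2)"
    by (rule integrable_power_le[OF b4_int]) auto
  have ab_int: "integrable M (\<lambda>\<omega>. (norm (a (X \<omega>)))\<^sup>2 * (norm (b \<omega>))\<^sup>2)"
    by (rule Bochner_Integration.integrable_bound[OF integrable_mult_right[OF int4[of 2]]])
      (use ab in \<open>auto intro!: AE_I2 order_trans[OF _ abs_ge_self]\<close>)
  have S_e: "norm (S x) \<le> w + (1 + e x ^ 2)" for x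
  proof -
    have "(norm (S x))\<^sup>2 \<le> (w + (1 + e x ^ 2))\<^sup>2"
    proof -
      have "(norm (S x))\<^sup>2 \<le> w * (1 + e x ^ 2)"
        using S_le by (simp add: e_def)
      also have "\<dots> \<le> (w + (1 + e x ^ 2))\<^sup>2"
        using w0 by (simp add: power2_sum mult_nonneg_nonneg)
      finally show ?thesis .
    qed
    then show ?thesis
      by (rule power2_le_imp_le) (use w0 in simp)
  qed
  \<comment> \<open>The cancellation for a general multiplier \<open>p\<close>, needed for
    constants, for \<open>a\<close>, and for \<open>a\<close> scaled by its squared norm. The growth
    condition keeps everything within fourth moments of \<open>X\<close>.\<close>
  have cross: "integrable M (\<lambda>\<omega>. p (X \<omega>) \<bullet> b \<omega>)" "expectation (\<lambda>\<omega>. p (X \<omega>) \<bullet> b \<omega>) = 0"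
    if p[measurable]: "p \<in> borel_measurable borel" and p_le: "\<And>x. norm (p x) * norm (S x) \<le> K * (1 + e x ^ 4)"
    for p :: "real^'n \<Rightarrow> real^'n" and K
  proof -
    have "integrable M (\<lambda>\<omega>. norm (p (X \<omega>)) * norm (S (X \<omega>)))"
    proof (rule Bochner_Integration.integrable_bound)
      show "integrable M (\<lambda>\<omega>. K * (1 + e (X \<omega>) ^ 4))"
        using e4 by simp
      show "AE \<omega> in M. norm (norm (p (X \<omega>)) * norm (S (X \<omega>))) \<le> norm (K * (1 + e (X \<omega>) ^ 4))"
        using p_le by (intro AE_I2) (auto intro!: order_trans[OF _ abs_ge_self])
    qed measurable
    moreover have "integrable M (\<lambda>\<omega>. norm (Y \<omega>))"
      using Y_int[of 1] by simp
    ultimately have c: "integrable M (\<lambda>\<omega>. p (X \<omega>) \<bullet> (S (X \<omega>) *v Y \<omega>))"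
      "expectation (\<lambda>\<omega>. p (X \<omega>) \<bullet> (S (X \<omega>) *v Y \<omega>)) = 0"
      using indep_centered_noise[OF indep p S] Y0 by auto
    then show "integrable M (\<lambda>\<omega>. p (X \<omega>) \<bullet> b \<omega>)" "expectation (\<lambda>\<omega>. p (X \<omega>) \<bullet> b \<omega>) = 0"
      unfolding b_def inner_scaleR_right by simp_all
  qed
  have e_pow: "e x ^ k \<le> 1 + e x ^ 4" if "k \<le> 4" for x k
  proof (cases "e x \<le> 1")
    case True
    then show ?thesis
      using e0[of x] power_le_one[of "e x" k] by (simp add: add_increasing2)
  next
    case False
    then have "1 \<le> e x" by simp
    from power_increasing[OF that this] show ?thesis by simp
  qed
  have "norm (S x) \<le> (w + 2) * (1 + e x ^ 4)" for x
  proof -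
    have "0 \<le> e x ^ 4"
      by simp
    moreover have "(w + 2) * (1 + e x ^ 4) = w + 2 + w * e x ^ 4 + 2 * e x ^ 4"
      by (simp add: algebra_simps)
    ultimately show ?thesis
      using S_e[of x] e_pow[of 2 x] mult_nonneg_nonneg[OF w0, of "e x ^ 4"] by linarith
  qed
  then have const: "expectation (\<lambda>\<omega>. k \<bullet> b \<omega>) = 0" "integrable M (\<lambda>\<omega>. k \<bullet> b \<omega>)" for k :: "real^'n"
    using cross[of "\<lambda>_. k" "norm k * (w + 2)"] by (auto simp: mult.assoc mult_left_mono)
  have a1: "norm (a x) * norm (S x) \<le> (w + 2) * (1 + e x ^ 4)" for x
  proof -
    have "norm (a x) * norm (S x) \<le> e x * (w + (1 + e x ^ 2))"
      using a_e S_e e0 by (intro mult_mono) auto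
    also have "\<dots> = w * e x ^ 1 + e x ^ 1 + e x ^ 3"
      by (simp add: power2_eq_square power3_eq_cube algebra_simps)
    also have "\<dots> \<le> w * (1 + e x ^ 4) + (1 + e x ^ 4) + (1 + e x ^ 4)"
      using w0 by (intro add_mono mult_left_mono e_pow) auto
    finally show ?thesis by (simp add: algebra_simps)
  qed
  note cross1 = cross[of a, OF _ a1]
  have cross3: "integrable M (\<lambda>\<omega>. (norm (a (X \<omega>)))\<^sup>2 * (a (X \<omega>) \<bullet> b \<omega>))"
    "expectation (\<lambda>\<omega>. (norm (a (X \<omega>)))\<^sup>2 * (a (X \<omega>) \<bullet> b \<omega>)) = 0"
  proof -
    \<comment> \<open>The quadratic bound \<open>S_e\<close> would produce \<open>e x ^ 5\<close>
      here, beyond the available moments; linear growth of \<open>S\<close> is needed.\<close>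
    have S4: "norm (S x) \<le> sqrt w * (1 + e x)" for x
    proof (rule power2_le_imp_le)
      have "(norm (S x))\<^sup>2 \<le> w * (1 + e x ^ 2)"
        using S_le by (simp add: e_def)
      also have "\<dots> \<le> w * (1 + e x)\<^sup>2"
        using w0 e0 by (intro mult_left_mono) (simp_all add: power2_sum)
      finally show "(norm (S x))\<^sup>2 \<le> (sqrt w * (1 + e x))\<^sup>2"
        using w0 by (simp add: power_mult_distrib)
      show "0 \<le> sqrt w * (1 + e x)"
        using w0 e0 by (simp add: add_nonneg_nonneg)
    qed
    have "norm ((norm (a x))\<^sup>2 *\<^sub>R a x) * norm (S x) \<le> (2 * sqrt w) * (1 + e x ^ 4)" for x
    proof -
      have "norm ((norm (a x))\<^sup>2 *\<^sub>R a x) = norm (a x) ^ 3"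
        by (simp add: power2_eq_square power3_eq_cube)
      also have "\<dots> \<le> e x ^ 3"
        by (intro power_mono a_e) simp
      finally have "norm ((norm (a x))\<^sup>2 *\<^sub>R a x) * norm (S x) \<le> e x ^ 3 * (sqrt w * (1 + e x))"
        using S4 e0 w0 by (intro mult_mono) auto
      also have "\<dots> = sqrt w * (e x ^ 3 + e x ^ 4)"
        by (simp add: power4_eq_xxxx power3_eq_cube algebra_simps)
      also have "\<dots> \<le> sqrt w * ((1 + e x ^ 4) + (1 + e x ^ 4))"
        using w0 by (intro mult_left_mono add_mono e_pow) auto
      finally show ?thesis by (simp add: algebra_simps)
    qed
    from cross[OF _ this] show "integrable M (\<lambda>\<omega>. (norm (a (X \<omega>)))\<^sup>2 * (a (X \<omega>) \<bullet> b \<omega>))"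
      "expectation (\<lambda>\<omega>. (norm (a (X \<omega>)))\<^sup>2 * (a (X \<omega>) \<bullet> b \<omega>)) = 0"
      by simp_all
  qed
  let ?U = "\<lambda>\<omega>. norm (a (X \<omega>)) ^ 4 + 4 * ((norm (a (X \<omega>)))\<^sup>2 * (a (X \<omega>) \<bullet> b \<omega>))
      + 8 * ((norm (a (X \<omega>)))\<^sup>2 * (norm (b \<omega>))\<^sup>2) + 3 * norm (b \<omega>) ^ 4"
  have U_int: "integrable M ?U"
    using a_int[of 4] cross3 ab_int b4_int by simp
  show X'4: "integrable M (\<lambda>\<omega>. norm (X' \<omega> - xs) ^ 4)"
    unfolding X'
    by (rule Bochner_Integration.integrable_bound[OF U_int])
      (auto intro!: AE_I2 order_trans[OF _ abs_ge_self] norm_add_power4_le)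
  have "expectation (\<lambda>\<omega>. norm (X' \<omega> - xs) ^ 4) \<le> expectation ?U"
    using X'4 unfolding X' by (intro integral_mono U_int norm_add_power4_le)
  also have "\<dots> = expectation (\<lambda>\<omega>. norm (a (X \<omega>)) ^ 4)
      + 8 * expectation (\<lambda>\<omega>. (norm (a (X \<omega>)))\<^sup>2 * (norm (b \<omega>))\<^sup>2)
      + 3 * expectation (\<lambda>\<omega>. norm (b \<omega>) ^ 4)"
    using a_int[of 4] cross3 ab_int b4_int by simp
  also have "\<dots> \<le> expectation (\<lambda>\<omega>. norm (a (X \<omega>)) ^ 4) + 8 * (2 * (h\<^sup>2 * w) * ((1 + c4) * m2))
      + 3 * (2 * (h ^ 4 * w\<^sup>2) * ((1 + c4) * m4))"
  proof (intro add_mono mult_left_mono order_refl)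
    have "expectation (\<lambda>\<omega>. (norm (a (X \<omega>)))\<^sup>2 * (norm (b \<omega>))\<^sup>2)
        \<le> expectation (\<lambda>\<omega>. 2 * (h\<^sup>2 * w) * ((1 + e (X \<omega>) ^ 4) * norm (Y \<omega>) ^ 2))"
      by (intro integral_mono ab_int integrable_mult_right int4 ab) simp
    also have "\<dots> = 2 * (h\<^sup>2 * w) * ((1 + c4) * m2)"
      by (simp add: E4 m2_def)
    finally show "expectation (\<lambda>\<omega>. (norm (a (X \<omega>)))\<^sup>2 * (norm (b \<omega>))\<^sup>2) \<le> 2 * (h\<^sup>2 * w) * ((1 + c4) * m2)" .
    have "expectation (\<lambda>\<omega>. norm (b \<omega>) ^ 4)
        \<le> expectation (\<lambda>\<omega>. 2 * (h ^ 4 * w\<^sup>2) * ((1 + e (X \<omega>) ^ 4) * norm (Y \<omega>) ^ 4))"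
      by (intro integral_mono b4_int integrable_mult_right int4 b4) simp
    also have "\<dots> = 2 * (h ^ 4 * w\<^sup>2) * ((1 + c4) * m4)"
      by (simp add: E4 m4_def)
    finally show "expectation (\<lambda>\<omega>. norm (b \<omega>) ^ 4) \<le> 2 * (h ^ 4 * w\<^sup>2) * ((1 + c4) * m4)" .
  qed simp_all
  also have "\<dots> = expectation (\<lambda>\<omega>. norm (\<Phi> (X \<omega>) - xs) ^ 4)
      + h\<^sup>2 * (16 * w * m2 + 6 * h\<^sup>2 * w\<^sup>2 * m4) * (1 + c4)"
    by (simp add: a_def power2_eq_square power4_eq_xxxx algebra_simps)
  finally show "expectation (\<lambda>\<omega>. norm (X' \<omega> - xs) ^ 4)
      \<le> expectation (\<lambda>\<omega>. norm (\<Phi> (X \<omega>) - xs) ^ 4) + h\<^sup>2 * (16 * w * m2 + 6 * h\<^sup>2 * w\<^sup>2 * m4) * (1 + c4)" .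
  have "(norm (X' \<omega> - xs))\<^sup>2 = (norm (a (X \<omega>)))\<^sup>2 + 2 * (a (X \<omega>) \<bullet> b \<omega>) + (norm (b \<omega>))\<^sup>2" for \<omega>
    unfolding X' by (simp add: power2_norm_eq_inner inner_add_left inner_add_right inner_commute)
  then have "expectation (\<lambda>\<omega>. (norm (X' \<omega> - xs))\<^sup>2)
      = expectation (\<lambda>\<omega>. (norm (a (X \<omega>)))\<^sup>2) + expectation (\<lambda>\<omega>. (norm (b \<omega>))\<^sup>2)"
    using a_int[of 2] cross1 b2_int by simp
  also have "expectation (\<lambda>\<omega>. (norm (b \<omega>))\<^sup>2)
      \<le> expectation (\<lambda>\<omega>. h\<^sup>2 * w * ((1 + e (X \<omega>) ^ 2) * norm (Y \<omega>) ^ 2))"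
    by (intro integral_mono b2_int integrable_mult_right int2 b2)
  also have "\<dots> = h\<^sup>2 * w * m2 * (1 + expectation (\<lambda>\<omega>. (norm (X \<omega> - xs))\<^sup>2))"
    using E2 by (simp add: e_def mult_ac)
  finally show "expectation (\<lambda>\<omega>. (norm (X' \<omega> - xs))\<^sup>2)
      \<le> expectation (\<lambda>\<omega>. (norm (\<Phi> (X \<omega>) - xs))\<^sup>2)
        + h\<^sup>2 * w * m2 * (1 + expectation (\<lambda>\<omega>. (norm (X \<omega> - xs))\<^sup>2))"
    by (simp add: a_def)
  have b_int: "integrable M b"
    using integrable_power_le[OF b4_int, of 1] by (simp add: integrable_norm_iff)
  have aX_int: "integrable M (\<lambda>\<omega>. a (X \<omega>))"
    using a_int[of 1] by (simp add: integrable_norm_iff)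
  \<comment> \<open>The cancellation for constant multipliers, with the mean of \<open>b\<close>
    itself as the multiplier.\<close>
  have "expectation b \<bullet> expectation b = 0"
    using const(1)[of "expectation b"] integral_inner_right[of "expectation b" M b] b_int by auto
  then show "expectation (\<lambda>\<omega>. X' \<omega> - xs) = expectation (\<lambda>\<omega>. \<Phi> (X \<omega>) - xs)"
    unfolding X' using aX_int b_int by (simp add: a_def)
qed

section \<open>Measurability of the iterates and independence from the next noise\<close>

text \<open>
  The scheme is polymorphic in the sample space. Run on the sequence space itself, with the
  coordinate projections as noise, it exhibits \<open>X\<^sub>n\<close> as a measurable function of \<open>\<gamma>\<^sub>1, \<dots>, \<gamma>\<^sub>n\<close>.
\<close>

lemma sg_scheme_restrict:
  "n \<le> m \<Longrightarrow> sg_scheme F \<sigma> (\<lambda>k f. f k) h x0 n (restrict (\<lambda>i. \<gamma> i \<omega>) {1..m}) = sg_scheme F \<sigma> \<gamma> h x0 n \<omega>"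
  by (induction n) simp_all

text \<open>The index set \<open>{1..m}\<close> is fixed while \<open>n\<close> grows, so the whole
  induction lives on one product space.\<close>

lemma sg_scheme_measurable:
  assumes F: "continuous_on UNIV (grad F)" and \<sigma>: "\<And>t. 0 \<le> t \<Longrightarrow> continuous_on UNIV (\<sigma> t)"
    and "0 \<le> h" and n: "n \<le> m"
  shows "sg_scheme F \<sigma> (\<lambda>k f. f k) h x0 n \<in> borel_measurable (PiM {1..m} (\<lambda>_. borel))"
  using n
proof (induction n)
  case 0
  show ?case by (simp add: sg_scheme.simps(1)[abs_def])
next
  case (Suc n)
  let ?N = "PiM {1..m} (\<lambda>_. borel) :: (nat \<Rightarrow> real^'a) measure"
  let ?X = "sg_scheme F \<sigma> (\<lambda>k f. f k) h x0 n"
  have X: "?X \<in> borel_measurable ?N"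
    using Suc by simp
  have [measurable]: "(\<lambda>f. grad F (?X f)) \<in> borel_measurable ?N"
    using measurable_compose[OF X borel_measurable_continuous_onI[OF F]] .
  have S: "(\<lambda>f. \<sigma> (real n * h) (?X f)) \<in> borel_measurable ?N"
    using measurable_compose[OF X borel_measurable_continuous_onI[OF \<sigma>]] \<open>0 \<le> h\<close> by simp
  have "(\<lambda>f. f (Suc n)) \<in> borel_measurable ?N"
    using Suc.prems by (intro measurable_component_singleton) auto
  note [measurable] = X borel_measurable_matrix_vector_mult[OF S this]
  show ?case
    unfolding sg_scheme.simps(2)[abs_def] by measurable
qed

lemma (in prob_space) sg_scheme_indep:
  fixes \<gamma> :: "nat \<Rightarrow> 'a \<Rightarrow> real^'n"
  assumes F: "continuous_on UNIV (grad F)" and \<sigma>: "\<And>t. 0 \<le> t \<Longrightarrow> continuous_on UNIV (\<sigma> t)"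
    and "0 \<le> h" and \<gamma>: "indep_vars (\<lambda>_. borel) \<gamma> {1..}"
  shows "indep_var borel (sg_scheme F \<sigma> \<gamma> h x0 n) borel (\<gamma> (Suc n))"
proof -
  have "indep_var (PiM {1..n} (\<lambda>_. borel)) (\<lambda>\<omega>. restrict (\<lambda>i. \<gamma> i \<omega>) {1..n})
      (PiM {Suc n} (\<lambda>_. borel)) (\<lambda>\<omega>. restrict (\<lambda>i. \<gamma> i \<omega>) {Suc n})"
    by (rule indep_var_restrict[OF \<gamma>]) auto
  moreover have "sg_scheme F \<sigma> (\<lambda>k f. f k) h x0 n \<in> borel_measurable (PiM {1..n} (\<lambda>_. borel))"
    using F \<sigma> \<open>0 \<le> h\<close> by (intro sg_scheme_measurable) auto
  moreover have "(\<lambda>f. f (Suc n)) \<in> borel_measurable (PiM {Suc n} (\<lambda>_. borel))"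
    by (intro measurable_component_singleton) auto
  ultimately have "indep_var borel (sg_scheme F \<sigma> (\<lambda>k f. f k) h x0 n \<circ> (\<lambda>\<omega>. restrict (\<lambda>i. \<gamma> i \<omega>) {1..n}))
      borel ((\<lambda>f. f (Suc n)) \<circ> (\<lambda>\<omega>. restrict (\<lambda>i. \<gamma> i \<omega>) {Suc n}))"
    by (rule indep_var_compose)
  moreover have "sg_scheme F \<sigma> (\<lambda>k f. f k) h x0 n \<circ> (\<lambda>\<omega>. restrict (\<lambda>i. \<gamma> i \<omega>) {1..n})
      = sg_scheme F \<sigma> \<gamma> h x0 n"
    by (simp only: comp_def sg_scheme_restrict[OF order_refl])
  moreover have "(\<lambda>f. f (Suc n)) \<circ> (\<lambda>\<omega>. restrict (\<lambda>i. \<gamma> i \<omega>) {Suc n}) = \<gamma> (Suc n)"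
    by (simp add: comp_def)
  ultimately show ?thesis
    by simp
qed

section \<open>Consequences of the assumption on the objective function\<close>

text \<open>A zero of \<open>G\<close> is a fixed point of a gradient step, and a short step is a
  Banach contraction: \<open>gradient_step_crude\<close> is applied to the shifted field
  \<open>G z - G y\<close>, which vanishes at \<open>y\<close>.\<close>

lemma strongly_monotone_lipschitz_zero:
  fixes G :: "'a::euclidean_space \<Rightarrow> 'a"
  assumes L: "\<And>x y. norm (G y - G x) \<le> L * norm (y - x)" and "0 < \<mu>" "strongly_monotone \<mu> G"
  shows "\<exists>x. G x = 0"
proof -
  \<comment> \<open>Small enough both for the crude step (\<open>s * L\<^sup>2 \<le> \<mu>\<close>)
    and for \<open>1 - \<mu> * s\<close> to lie in \<open>[1 / 2, 1)\<close>.\<close>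
  define s where "s = \<mu> / (L\<^sup>2 + 2 * \<mu>\<^sup>2)"
  have den: "0 < L\<^sup>2 + 2 * \<mu>\<^sup>2"
    using \<open>0 < \<mu>\<close> by (simp add: add_nonneg_pos)
  have s: "0 < s" "s * L\<^sup>2 \<le> \<mu>" "\<mu> * s \<le> 1 / 2"
    using \<open>0 < \<mu>\<close> den by (simp_all add: s_def field_simps power2_eq_square)
  have contr: "dist (x - s *\<^sub>R G x) (y - s *\<^sub>R G y) \<le> sqrt (1 - \<mu> * s) * dist x y" for x y
  proof -
    have "(norm (x - s *\<^sub>R (G x - G y) - y))\<^sup>2 \<le> (1 - \<mu> * s) * (norm (x - y))\<^sup>2"
      using assms(3) L[of x y] s
      by (intro gradient_step_crude[of \<mu> x y "\<lambda>z. G z - G y" L s]) (auto simp: strongly_monotone_def)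
    moreover have "x - s *\<^sub>R (G x - G y) - y = (x - s *\<^sub>R G x) - (y - s *\<^sub>R G y)"
      by (simp add: algebra_simps)
    ultimately have "(dist (x - s *\<^sub>R G x) (y - s *\<^sub>R G y))\<^sup>2 \<le> (1 - \<mu> * s) * (dist x y)\<^sup>2"
      by (simp add: dist_norm)
    then have "sqrt ((dist (x - s *\<^sub>R G x) (y - s *\<^sub>R G y))\<^sup>2) \<le> sqrt ((1 - \<mu> * s) * (dist x y)\<^sup>2)"
      by (rule real_sqrt_le_mono)
    then show ?thesis
      by (simp add: real_sqrt_mult)
  qed
  have "sqrt (1 - \<mu> * s) < 1"
    using s \<open>0 < \<mu>\<close> by simp
  then have "\<exists>!x. x - s *\<^sub>R G x = x"
    using contr s by (intro banach_fix_type[of "sqrt (1 - \<mu> * s)"]) auto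
  then obtain x where "x - s *\<^sub>R G x = x"
    by blast
  then show ?thesis
    using s by auto
qed

text \<open>Monotonicity makes the derivative of \<open>F\<close> along every ray from
  \<open>z\<close> positive. The resulting strict inequality also yields the uniqueness required by
  the definite description in \<open>minimizer\<close>.\<close>

lemma strongly_monotone_minimizer:
  fixes F :: "'a::euclidean_space \<Rightarrow> real"
  assumes F: "\<And>x. F differentiable (at x)" and "0 < \<mu>" "strongly_monotone \<mu> (grad F)" and z: "grad F z = 0"
  shows "minimizer F = z"
proof -
  have less: "F z < F y" if "y \<noteq> z" for y
  proof -
    define f where "f t = F (z + t *\<^sub>R (y - z))" for t
    have "(f has_real_derivative (y - z) \<bullet> grad F (z + t *\<^sub>R (y - z))) (at t)" for t
    proof -
      have line: "((\<lambda>t. z + t *\<^sub>R (y - z)) has_derivative (\<lambda>u. u *\<^sub>R (y - z))) (at t)"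
        by (auto intro!: derivative_eq_intros)
      from has_derivative_compose[OF line has_derivative_grad[OF F]] show ?thesis
        unfolding f_def has_field_derivative_def by (simp add: mult_commute_abs)
    qed
    then obtain t where t: "0 < t" "t < 1"
      "f 1 - f 0 = (1 - 0) * ((y - z) \<bullet> grad F (z + t *\<^sub>R (y - z)))"
      using MVT2[of 0 1 f "\<lambda>t. (y - z) \<bullet> grad F (z + t *\<^sub>R (y - z))"] by auto
    have "\<mu> * (norm (t *\<^sub>R (y - z)))\<^sup>2 \<le> grad F (z + t *\<^sub>R (y - z)) \<bullet> (t *\<^sub>R (y - z))"
      using assms(3)[unfolded strongly_monotone_def, rule_format, of "z + t *\<^sub>R (y - z)" z] z by simp
    moreover have "0 < \<mu> * (norm (t *\<^sub>R (y - z)))\<^sup>2"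
      using t \<open>0 < \<mu>\<close> that by simp
    ultimately have "0 < t * ((y - z) \<bullet> grad F (z + t *\<^sub>R (y - z)))"
      by (simp add: inner_commute)
    then show ?thesis
      using t by (simp add: f_def zero_less_mult_iff)
  qed
  show ?thesis
    unfolding minimizer_def
  proof (rule the_equality)
    show "\<forall>y. F z \<le> F y"
      using less by (metis less_imp_le order_refl)
  next
    fix x assume "\<forall>y. F x \<le> F y"
    then show "x = z"
      using less[of x] by (meson not_less)
  qed
qed

lemma F_strong_modified_gradient:
  fixes F :: "'a::euclidean_space \<Rightarrow> real"
  assumes "F_strong hmax \<mu> F"
  shows "\<exists>L B h0. 0 < h0 \<and> h0 < hmax \<and>
    modified_gradient (grad F) (\<lambda>x. frechet_derivative (grad F) (at x)) L B \<mu> h0 (minimizer F)"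
proof -
  obtain L0 h0 B0 where C: "C_class 5 F" and L0: "L0-lipschitz_on UNIV (grad F)" and mu: "0 < \<mu>"
    and h0: "0 < h0" "h0 < hmax" and mono: "strongly_monotone \<mu> (grad F)"
    and monoh: "\<And>h. 0 < h \<Longrightarrow> h < h0 \<Longrightarrow> strongly_monotone \<mu> (grad (modified_objective h F))"
    and B0: "deriv_bounded_by B0 3 F"
    using assms by (auto simp: F_strong_def)
  define G where "G = grad F"
  define H where "H x = frechet_derivative G (at x)" for x
  have five: "5 = Suc (Suc (Suc (Suc (Suc 0))))" and three: "3 = Suc (Suc (Suc 0))"
    by simp_all
  have F: "F differentiable (at x)" for x
    using C by (simp add: five)
  have dF: "frechet_derivative F (at x) k = k \<bullet> G x" for x k
    unfolding G_def by (rule frechet_derivative_grad[OF F])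
  have Gk: "(\<lambda>x. k \<bullet> G x) differentiable (at x)" for k x
    using C by (simp add: five dF)
  have "G differentiable (at x)" for x
    using Gk by (simp add: differentiable_componentwise_within[of G] inner_commute)
  then have G': "(G has_derivative H x) (at x)" for x
    by (simp add: H_def frechet_derivative_works)
  have dG: "frechet_derivative (\<lambda>x. l \<bullet> G x) (at x) k = l \<bullet> H x k" for l x k
    using frechet_derivative_at[OF has_derivative_inner_right[OF G', of l]] by (simp add: fun_eq_iff)
  have lip: "norm (G y - G x) \<le> L0 * norm (y - x)" for x y
    using lipschitz_onD[OF L0, of y x] by (simp add: dist_norm G_def)
  have H_lip: "norm (H y k - H x k) \<le> \<bar>B0\<bar> * norm (y - x) * norm k" for x y k
  proof (rule norm_le_if_inner_le)
    fix l
    have it: "iter_deriv F [k, l] = (\<lambda>x. l \<bullet> H x k)"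
      by (simp add: dF dG fun_eq_iff)
    have "norm (iter_deriv F [k, l] y - iter_deriv F [k, l] x)
        \<le> B0 * prod_list (map norm [k, l]) * norm (y - x)"
      using C[unfolded five, THEN C_class_SucD, THEN C_class_SucD] B0
      by (intro deriv_bounded_by_iter_deriv_lipschitz) (simp_all only: three list.size add_0_left add_Suc_right add_0_right)
    then have "\<bar>l \<bullet> H y k - l \<bullet> H x k\<bar> \<le> B0 * (norm k * norm l * norm (y - x))"
      unfolding it by (simp add: mult_ac)
    also have "\<dots> \<le> \<bar>B0\<bar> * (norm k * norm l * norm (y - x))"
      by (intro mult_right_mono) auto
    finally have "l \<bullet> (H y k - H x k) \<le> \<bar>B0\<bar> * (norm k * norm l * norm (y - x))"
      by (simp add: inner_diff_right)
    then show "(H y k - H x k) \<bullet> l \<le> \<bar>B0\<bar> * norm (y - x) * norm k * norm l"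
      by (simp only: inner_commute[of l] mult_ac)
  qed simp
  have lin: "linear (H x)" for x
    using G' by (rule has_derivative_linear)
  have taylor: "norm (G y - G x - H x (y - x)) \<le> \<bar>B0\<bar> * (norm (y - x))\<^sup>2" for x y
    by (rule taylor_remainder[OF G' H_lip]) simp
  have sym: "H x a \<bullet> b = H x b \<bullet> a" for x a b
    using has_derivative_grad[OF F] taylor unfolding G_def
    by (intro symmetric_hessian[OF _ lin[unfolded G_def]]) auto
  obtain z where z: "G z = 0"
    using strongly_monotone_lipschitz_zero[of G L0 \<mu>] lip mu mono by (auto simp: G_def)
  have min: "minimizer F = z"
    using strongly_monotone_minimizer[OF F mu mono] z by (simp add: G_def)
  \<comment> \<open>Differentiating \<open>G x \<bullet> G x\<close> produces the adjoint of the
    Hessian applied to \<open>G y\<close>; symmetry of the Hessian turns it into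
    \<open>H y (G y)\<close>.\<close>
  have grad_mod: "grad (modified_objective h F) y = G y + (h / 2) *\<^sub>R H y (G y)" for h y
  proof (rule grad_eqI)
    have "(modified_objective h F) = (\<lambda>x. F x + h / 4 * (G x \<bullet> G x))"
      by (simp add: modified_objective_def fun_eq_iff G_def power2_norm_eq_inner)
    moreover have "((\<lambda>x. F x + h / 4 * (G x \<bullet> G x)) has_derivative
        (\<lambda>k. k \<bullet> G y + h / 4 * (G y \<bullet> H y k + H y k \<bullet> G y))) (at y)"
      using has_derivative_grad[OF F, of y] unfolding G_def[symmetric]
      by (intro has_derivative_add has_derivative_mult_right has_derivative_inner G')
    ultimately show "(modified_objective h F has_derivative
        (\<lambda>k. k \<bullet> G y + h / 4 * (G y \<bullet> H y k + H y k \<bullet> G y))) (at y)"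
      by simp
    show "k \<bullet> G y + h / 4 * (G y \<bullet> H y k + H y k \<bullet> G y) = k \<bullet> (G y + (h / 2) *\<^sub>R H y (G y))" for k
      using sym[of y k "G y"] by (simp add: inner_add_right inner_commute)
  qed
  have "modified_gradient G H L0 \<bar>B0\<bar> \<mu> h0 z"
  proof
    \<comment> \<open>The modified gradient vanishes at \<open>z\<close> together with
      \<open>G\<close>, so monotonicity against \<open>z\<close> has only one term.\<close>
    show "\<mu> * (norm (y - z))\<^sup>2 \<le> (G y + (h / 2) *\<^sub>R H y (G y)) \<bullet> (y - z)" if "0 < h" "h < h0" for h y
      using monoh[OF that, unfolded strongly_monotone_def grad_mod, rule_format, of y z]
      by (simp add: z linear_0[OF lin])
    show "0 \<le> L0"
      using L0 by (rule lipschitz_on_nonneg)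
  qed (use G' lip H_lip z mu in auto)
  then show ?thesis
    using h0 unfolding min G_def H_def by blast
qed

section \<open>The weight of the noise\<close>

text \<open>The noise is controlled by its average over the step, since \<open>vsig\<close> itself is only measurable.\<close>

locale noise_weight =
  fixes vsig :: "real \<Rightarrow> real" and K :: real
  assumes meas: "set_borel_measurable borel {0..} vsig"
    and bound: "\<And>t. 0 \<le> t \<Longrightarrow> \<bar>vsig t\<bar> \<le> K"
begin

definition cell :: "real \<Rightarrow> nat \<Rightarrow> real" where
  "cell h n = (LBINT s:{real n * h<..real (Suc n) * h}. (vsig s)\<^sup>2)"

text \<open>The \<beta> of the overview. Its square root is the transient term of the weak and
  strong errors, and it is itself that of the residual.\<close>

definition discounted :: "real \<Rightarrow> real \<Rightarrow> nat \<Rightarrow> real" where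
  "discounted \<mu> h n = exp (- 2 * \<mu> * (real n * h)) * (1 + h * rho \<mu> vsig (real n * h))"

lemma set_integrable_weighted:
  assumes A: "A \<in> sets borel" "A \<subseteq> {0..T}" and f: "continuous_on UNIV f"
  shows "set_integrable lborel A (\<lambda>s. f s * (vsig s)\<^sup>2)"
proof (rule set_integrable_subset)
  have [measurable]: "(\<lambda>s. indicator {0..} s *\<^sub>R vsig s) \<in> borel_measurable borel"
    using meas by (simp add: set_borel_measurable_def)
  have [measurable]: "f \<in> borel_measurable borel"
    using f by (rule borel_measurable_continuous_onI)
  \<comment> \<open>Only the truncation of \<open>vsig\<close> to nonnegative times is known to be
    measurable; on \<open>{0..T}\<close> it agrees with \<open>vsig\<close>.\<close>
  have eq: "indicator {0..T} s *\<^sub>R (f s * (vsig s)\<^sup>2)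
      = indicator {0..T} s *\<^sub>R (f s * (indicator {0..} s *\<^sub>R vsig s)\<^sup>2)" for s
    by (auto simp: indicator_def)
  show "set_integrable lborel {0..T} (\<lambda>s. f s * (vsig s)\<^sup>2)"
  proof (rule set_integrable_bound)
    show "set_integrable lborel {0..T} (\<lambda>s. K\<^sup>2 * f s)"
      using f by (intro set_integrable_mult_right borel_integrable_atLeastAtMost')
        (auto intro: continuous_on_subset)
    show "set_borel_measurable lborel {0..T} (\<lambda>s. f s * (vsig s)\<^sup>2)"
      unfolding set_borel_measurable_def eq by measurable
    have "\<bar>f s\<bar> * (vsig s)\<^sup>2 \<le> \<bar>f s\<bar> * K\<^sup>2" if "0 \<le> s" for s
      using power_mono[OF bound[OF that], of 2] by (intro mult_left_mono) auto
    then show "AE s in lborel. s \<in> {0..T} \<longrightarrow> norm (f s * (vsig s)\<^sup>2) \<le> norm (K\<^sup>2 * f s)"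
      by (auto simp: abs_mult mult.commute)
  qed
qed (use A in auto)

lemma set_integral_const_cell:
  "0 \<le> h \<Longrightarrow> set_integrable lborel {real n * h<..real (Suc n) * h} (\<lambda>_. c :: real)"
  "0 \<le> h \<Longrightarrow> (LBINT s:{real n * h<..real (Suc n) * h}. c) = h * c"
  by (auto simp: set_integrable_def set_lebesgue_integral_def algebra_simps)

lemma cell_subset: "0 \<le> h \<Longrightarrow> {real n * h<..real (Suc n) * h} \<subseteq> {0..real (Suc n) * h}"
proof
  fix s assume "0 \<le> h" and s: "s \<in> {real n * h<..real (Suc n) * h}"
  then have "0 \<le> real n * h"
    by simp
  with s show "s \<in> {0..real (Suc n) * h}"
    by auto
qed

lemma cell_bounds:
  assumes "0 \<le> h"
  shows "0 \<le> cell h n" and "cell h n \<le> h * K\<^sup>2"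
proof -
  show "0 \<le> cell h n"
    unfolding cell_def set_lebesgue_integral_def by (intro Bochner_Integration.integral_nonneg) auto
  have "cell h n \<le> (LBINT s:{real n * h<..real (Suc n) * h}. K\<^sup>2)"
    unfolding cell_def
  proof (rule set_integral_mono)
    show "set_integrable lborel {real n * h<..real (Suc n) * h} (\<lambda>s. (vsig s)\<^sup>2)"
      using set_integrable_weighted[OF _ cell_subset[OF assms], where f = "\<lambda>_. 1"] by simp
    fix s assume "s \<in> {real n * h<..real (Suc n) * h}"
    then have "0 \<le> s"
      using subsetD[OF cell_subset[OF assms]] by simp
    then show "(vsig s)\<^sup>2 \<le> K\<^sup>2"
      using power_mono[OF bound, of s 2] by simp
  qed (rule set_integral_const_cell[OF assms])
  then show "cell h n \<le> h * K\<^sup>2"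
    by (simp only: set_integral_const_cell[OF assms])
qed

lemma discounted_0: "discounted \<mu> h 0 = 1"
proof -
  have "AE s in lborel. indicator {0..0} s *\<^sub>R (exp (2 * \<mu> * s) * (vsig s)\<^sup>2) = 0"
    using AE_lborel_singleton[of "0 :: real"] by eventually_elim simp
  then have "rho \<mu> vsig 0 = 0"
    unfolding rho_def set_lebesgue_integral_def by (rule integral_eq_zero_AE)
  then show ?thesis
    by (simp add: discounted_def)
qed

text \<open>The integral in \<open>rho\<close> is split at the last grid point. On the new cell the
  exponential weight lies between its values at the two ends: the left one gives the lower estimate,
  the right one the upper estimate.\<close>

lemma discounted_Suc:
  assumes "0 < \<mu>" "0 \<le> h" "h \<le> 1"
  shows "exp (- 2 * \<mu> * h) * (discounted \<mu> h n + h * cell h n) \<le> discounted \<mu> h (Suc n)"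
    and "discounted \<mu> h (Suc n) \<le> exp (- 2 * \<mu> * h) * discounted \<mu> h n + K\<^sup>2 * h"
proof -
  define a where "a = real n * h"
  define b where "b = real (Suc n) * h"
  define J where "J = (LBINT s:{a<..b}. exp (2 * \<mu> * s) * (vsig s)\<^sup>2)"
  have ab: "0 \<le> a" "a \<le> b" "b = a + h"
    using assms by (auto simp: a_def b_def algebra_simps)
  have cont: "continuous_on UNIV (\<lambda>s. exp (2 * \<mu> * s))"
    by (intro continuous_intros)
  have int: "set_integrable lborel A (\<lambda>s. exp (2 * \<mu> * s) * (vsig s)\<^sup>2)"
    if "A \<in> sets borel" "A \<subseteq> {0..b}" for A
    by (rule set_integrable_weighted[OF that cont])
  have "{0..b} = {0..a} \<union> {a<..b}"
    using ab by auto
  then have rho: "rho \<mu> vsig b = rho \<mu> vsig a + J"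
    unfolding rho_def J_def
    by (simp only:) (rule set_integral_Un; (intro int)?; use ab in auto)
  have cell_int: "set_integrable lborel {a<..b} (\<lambda>s. c * (vsig s)\<^sup>2)" for c
    by (rule set_integrable_weighted[of _ b]) (use ab in auto)
  have "exp (2 * \<mu> * a) * cell h n = (LBINT s:{a<..b}. exp (2 * \<mu> * a) * (vsig s)\<^sup>2)"
    by (simp add: cell_def a_def b_def)
  also have "\<dots> \<le> J"
    unfolding J_def using ab \<open>0 < \<mu>\<close>
    by (intro set_integral_mono cell_int int) (auto intro!: mult_right_mono)
  finally have J1: "exp (2 * \<mu> * a) * cell h n \<le> J" .
  have "J \<le> (LBINT s:{a<..b}. exp (2 * \<mu> * b) * (vsig s)\<^sup>2)"
    unfolding J_def using ab \<open>0 < \<mu>\<close>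
    by (intro set_integral_mono cell_int int) (auto intro!: mult_right_mono)
  also have "\<dots> = exp (2 * \<mu> * b) * cell h n"
    by (simp add: cell_def a_def b_def)
  also have "\<dots> \<le> exp (2 * \<mu> * b) * (h * K\<^sup>2)"
    using cell_bounds(2)[OF assms(2)] by (intro mult_left_mono) auto
  finally have J2: "J \<le> exp (2 * \<mu> * b) * (h * K\<^sup>2)" .
  have e: "exp (- 2 * \<mu> * b) = exp (- 2 * \<mu> * h) * exp (- 2 * \<mu> * a)"
    by (simp add: exp_add[symmetric] ab(3) algebra_simps)
  have split: "discounted \<mu> h (Suc n) = exp (- 2 * \<mu> * h) * discounted \<mu> h n + h * (exp (- 2 * \<mu> * b) * J)"
  proof -
    have "discounted \<mu> h (Suc n) = exp (- 2 * \<mu> * b) * (1 + h * (rho \<mu> vsig a + J))"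
      by (simp only: discounted_def b_def[symmetric] rho)
    also have "\<dots> = exp (- 2 * \<mu> * b) * (1 + h * rho \<mu> vsig a) + h * (exp (- 2 * \<mu> * b) * J)"
      by (simp add: algebra_simps)
    also have "exp (- 2 * \<mu> * b) * (1 + h * rho \<mu> vsig a) = exp (- 2 * \<mu> * h) * discounted \<mu> h n"
      unfolding e by (simp only: discounted_def a_def mult.assoc)
    finally show ?thesis .
  qed
  have "exp (- 2 * \<mu> * b) * (exp (2 * \<mu> * a) * cell h n) \<le> exp (- 2 * \<mu> * b) * J"
    by (intro mult_left_mono J1) simp
  moreover have "exp (- 2 * \<mu> * b) * exp (2 * \<mu> * a) = exp (- 2 * \<mu> * h)"
    by (simp add: exp_add[symmetric] ab(3) algebra_simps)
  ultimately have "exp (- 2 * \<mu> * h) * cell h n \<le> exp (- 2 * \<mu> * b) * J"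
    by (simp only: mult.assoc[symmetric])
  then have "h * (exp (- 2 * \<mu> * h) * cell h n) \<le> h * (exp (- 2 * \<mu> * b) * J)"
    using assms by (intro mult_left_mono)
  then show "exp (- 2 * \<mu> * h) * (discounted \<mu> h n + h * cell h n) \<le> discounted \<mu> h (Suc n)"
    unfolding split distrib_left by (simp only: mult.left_commute[of h] add_left_mono)
  have "exp (- 2 * \<mu> * b) * J \<le> exp (- 2 * \<mu> * b) * (exp (2 * \<mu> * b) * (h * K\<^sup>2))"
    by (intro mult_left_mono J2) simp
  also have "\<dots> = h * K\<^sup>2"
    by (simp add: exp_minus)
  finally have "h * (exp (- 2 * \<mu> * b) * J) \<le> h * (h * K\<^sup>2)"
    using assms by (intro mult_left_mono)
  also have "\<dots> \<le> 1 * (h * K\<^sup>2)"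
    using assms by (intro mult_right_mono) auto
  finally show "discounted \<mu> h (Suc n) \<le> exp (- 2 * \<mu> * h) * discounted \<mu> h n + K\<^sup>2 * h"
    unfolding split by (simp add: mult.commute)
qed

text \<open>The value of \<open>vsig\<close> at a single grid point says nothing about its integral.
  So \<open>S\<close> at the grid point is compared with \<open>S\<close> at every time
  \<open>s\<close> of the cell, at cost \<open>\<Lambda> * h\<close>, and the squared inequality is
  averaged over \<open>s\<close>. The constant 4 combines the factors 2 from two squares of
  sums.\<close>

lemma cell_average_bound:
  fixes S :: "real \<Rightarrow> 'b::real_normed_vector"
  assumes "0 < h" and lip: "\<And>s t. 0 \<le> s \<Longrightarrow> 0 \<le> t \<Longrightarrow> norm (S t - S s) \<le> \<Lambda> * \<bar>t - s\<bar>"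
    and "0 \<le> \<Lambda>" "0 \<le> e" and S: "\<And>t. 0 \<le> t \<Longrightarrow> norm (S t) \<le> vsig t * (1 + e)"
  shows "(norm (S (real n * h)))\<^sup>2 \<le> 4 * (cell h n / h + \<Lambda>\<^sup>2 * h\<^sup>2) * (1 + e\<^sup>2)"
proof -
  let ?C = "{real n * h<..real (Suc n) * h}"
  have h0: "0 \<le> h" using \<open>0 < h\<close> by simp
  define d where "d = 2 * (1 + e)\<^sup>2"
  have int: "set_integrable lborel ?C (\<lambda>s. d * (vsig s)\<^sup>2)"
    by (rule set_integrable_weighted[OF _ cell_subset[OF h0]]) auto
  have pt: "(norm (S (real n * h)))\<^sup>2 \<le> d * (vsig s)\<^sup>2 + d * (\<Lambda>\<^sup>2 * h\<^sup>2)" if s: "s \<in> ?C" for s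
  proof -
    have s0: "0 \<le> s"
      using subsetD[OF cell_subset[OF h0] s] by simp
    have "norm (S (real n * h)) \<le> norm (S s) + norm (S (real n * h) - S s)"
      using norm_triangle_ineq[of "S s" "S (real n * h) - S s"] by simp
    also have "\<dots> \<le> vsig s * (1 + e) + \<Lambda> * \<bar>real n * h - s\<bar>"
      using s0 h0 by (intro add_mono S lip) auto
    also have "\<Lambda> * \<bar>real n * h - s\<bar> \<le> \<Lambda> * h"
      using s \<open>0 \<le> \<Lambda>\<close> by (intro mult_left_mono) (auto simp: algebra_simps)
    also have "\<Lambda> * h \<le> \<Lambda> * h * (1 + e)"
      using \<open>0 \<le> \<Lambda>\<close> h0 \<open>0 \<le> e\<close> by (simp add: mult_left_le distrib_left)
    finally have "norm (S (real n * h)) \<le> (vsig s + \<Lambda> * h) * (1 + e)"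
      by (simp add: algebra_simps)
    then have "(norm (S (real n * h)))\<^sup>2 \<le> ((vsig s + \<Lambda> * h) * (1 + e))\<^sup>2"
      by (intro power_mono) simp_all
    also have "\<dots> = (vsig s + \<Lambda> * h)\<^sup>2 * (1 + e)\<^sup>2"
      by (simp only: power_mult_distrib)
    also have "\<dots> \<le> (2 * ((vsig s)\<^sup>2 + (\<Lambda> * h)\<^sup>2)) * (1 + e)\<^sup>2"
      using sum_squares_bound[of "vsig s" "\<Lambda> * h"]
      by (intro mult_right_mono zero_le_power2) (simp add: power2_sum)
    finally show ?thesis
      by (simp add: d_def power_mult_distrib distrib_left distrib_right mult_ac)
  qed
  have "h * (norm (S (real n * h)))\<^sup>2 = (LBINT s:?C. (norm (S (real n * h)))\<^sup>2)"
    by (simp only: set_integral_const_cell[OF h0])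
  also have "\<dots> \<le> (LBINT s:?C. d * (vsig s)\<^sup>2 + d * (\<Lambda>\<^sup>2 * h\<^sup>2))"
    by (intro set_integral_mono set_integral_add int set_integral_const_cell h0 pt)
  also have "\<dots> = d * cell h n + h * (d * (\<Lambda>\<^sup>2 * h\<^sup>2))"
    by (subst set_integral_add(2)[OF int set_integral_const_cell(1)[OF h0]])
      (simp only: set_integral_const_cell(2)[OF h0] set_integral_mult_right cell_def, simp)
  also have "\<dots> = h * ((cell h n / h + \<Lambda>\<^sup>2 * h\<^sup>2) * d)"
    using \<open>0 < h\<close> by (simp add: field_simps)
  finally have "(norm (S (real n * h)))\<^sup>2 \<le> (cell h n / h + \<Lambda>\<^sup>2 * h\<^sup>2) * d"
    using \<open>0 < h\<close> by (simp only: mult_le_cancel_left_pos)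
  also have "\<dots> \<le> (cell h n / h + \<Lambda>\<^sup>2 * h\<^sup>2) * (4 * (1 + e\<^sup>2))"
  proof (rule mult_left_mono)
    show "d \<le> 4 * (1 + e\<^sup>2)"
      using sum_squares_bound[of 1 e] by (simp add: d_def power2_sum)
    show "0 \<le> cell h n / h + \<Lambda>\<^sup>2 * h\<^sup>2"
      using cell_bounds(1)[OF h0] \<open>0 < h\<close> by simp
  qed
  finally show ?thesis
    by (simp only: mult_ac)
qed

end

section \<open>Moments of the scheme\<close>

context prob_space
begin

lemma expectation_square_le:
  fixes f :: "'a \<Rightarrow> real"
  assumes "integrable M f" "integrable M (\<lambda>\<omega>. (f \<omega>)\<^sup>2)"
  shows "(expectation f)\<^sup>2 \<le> expectation (\<lambda>\<omega>. (f \<omega>)\<^sup>2)"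
  using variance_positive[of f] variance_eq[OF assms] by simp

lemma norm_expectation_square_le:
  fixes V :: "'a \<Rightarrow> 'b::euclidean_space"
  assumes "integrable M (\<lambda>\<omega>. norm (V \<omega>))" "integrable M (\<lambda>\<omega>. (norm (V \<omega>))\<^sup>2)"
  shows "(norm (expectation V))\<^sup>2 \<le> expectation (\<lambda>\<omega>. (norm (V \<omega>))\<^sup>2)"
proof -
  have "(norm (expectation V))\<^sup>2 \<le> (expectation (\<lambda>\<omega>. norm (V \<omega>)))\<^sup>2"
    by (intro power_mono integral_norm_bound) simp
  also have "\<dots> \<le> expectation (\<lambda>\<omega>. (norm (V \<omega>))\<^sup>2)"
    using assms by (rule expectation_square_le)
  finally show ?thesis .
qed

text \<open>
  Comparing the drift at \<open>X\<close> and at its mean through the linearization at \<open>xs\<close>, only second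
  moments around \<open>xs\<close> remain.
\<close>

lemma expectation_gradient_step:
  fixes X :: "'a \<Rightarrow> 'b::euclidean_space"
  assumes mg: "modified_gradient G A L B \<mu> h0 xs" and [measurable]: "X \<in> borel_measurable M"
    and X2: "integrable M (\<lambda>\<omega>. (norm (X \<omega> - xs))\<^sup>2)" and X1: "integrable M (\<lambda>\<omega>. X \<omega> - xs)"
    and "0 \<le> h"
  defines "m \<equiv> expectation (\<lambda>\<omega>. X \<omega> - xs)"
  shows "norm (expectation (\<lambda>\<omega>. X \<omega> - h *\<^sub>R G (X \<omega>) - xs))
    \<le> norm ((xs + m) - h *\<^sub>R G (xs + m) - xs) + h * (2 * B * expectation (\<lambda>\<omega>. (norm (X \<omega> - xs))\<^sup>2))"
proof -
  interpret modified_gradient G A L B \<mu> h0 xs by fact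
  define r where "r x = G x - A xs (x - xs)" for x
  define b where "b = expectation (\<lambda>\<omega>. (norm (X \<omega> - xs))\<^sup>2)"
  have r_le: "norm (r x) \<le> B * (norm (x - xs))\<^sup>2" for x
    using taylor[of x xs] by (simp add: r_def zero)
  have bl: "bounded_linear (A xs)"
    using linear_H by (simp add: linear_conv_bounded_linear)
  have "continuous_on UNIV G"
    using deriv has_derivative_continuous continuous_at_imp_continuous_on by blast
  then have [measurable]: "G \<in> borel_measurable borel"
    by (rule borel_measurable_continuous_onI)
  have [measurable]: "A xs \<in> borel_measurable borel"
    by (intro borel_measurable_continuous_onI linear_continuous_on bl)
  have [measurable]: "r \<in> borel_measurable borel"
    unfolding r_def[abs_def] by measurable
  have r_int: "integrable M (\<lambda>\<omega>. r (X \<omega>))"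
  proof (rule Bochner_Integration.integrable_bound)
    show "integrable M (\<lambda>\<omega>. B * (norm (X \<omega> - xs))\<^sup>2)"
      using X2 by simp
    show "AE \<omega> in M. norm (r (X \<omega>)) \<le> norm (B * (norm (X \<omega> - xs))\<^sup>2)"
      using r_le by (intro AE_I2) (auto intro: order_trans[OF _ abs_ge_self])
  qed measurable
  have AX_int: "integrable M (\<lambda>\<omega>. A xs (X \<omega> - xs))"
    by (rule integrable_bounded_linear[OF bl X1])
  have "expectation (\<lambda>\<omega>. X \<omega> - h *\<^sub>R G (X \<omega>) - xs)
      = expectation (\<lambda>\<omega>. (X \<omega> - xs) - (h *\<^sub>R A xs (X \<omega> - xs) + h *\<^sub>R r (X \<omega>)))"
    by (intro Bochner_Integration.integral_cong) (simp_all add: r_def algebra_simps)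
  also have "\<dots> = m - (h *\<^sub>R A xs m + h *\<^sub>R expectation (\<lambda>\<omega>. r (X \<omega>)))"
    using X1 AX_int r_int integral_bounded_linear[OF bl X1] by (simp add: m_def)
  \<comment> \<open>The linear part of the drift commutes with the expectation, so the mean step and
    the step from the mean differ only through the nonlinear part \<open>r\<close>.\<close>
  also have "\<dots> = ((xs + m) - h *\<^sub>R G (xs + m) - xs) + h *\<^sub>R (r (xs + m) - expectation (\<lambda>\<omega>. r (X \<omega>)))"
    by (simp add: r_def algebra_simps)
  also have "norm \<dots> \<le> norm ((xs + m) - h *\<^sub>R G (xs + m) - xs)
      + norm (h *\<^sub>R (r (xs + m) - expectation (\<lambda>\<omega>. r (X \<omega>))))"
    by (rule norm_triangle_ineq)
  also have "norm (h *\<^sub>R (r (xs + m) - expectation (\<lambda>\<omega>. r (X \<omega>)))) \<le> h * (2 * B * b)"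
  proof -
    \<comment> \<open>By Jensen the remainder at the mean obeys the same bound as the mean of the
      remainder, whence the factor 2.\<close>
    have "norm (r (xs + m)) \<le> B * (norm m)\<^sup>2"
      using r_le[of "xs + m"] by simp
    also have "\<dots> \<le> B * b"
      unfolding m_def b_def using X1 X2 nonneg by (intro mult_left_mono norm_expectation_square_le) auto
    finally have 1: "norm (r (xs + m)) \<le> B * b" .
    have "norm (expectation (\<lambda>\<omega>. r (X \<omega>))) \<le> expectation (\<lambda>\<omega>. norm (r (X \<omega>)))"
      by (rule integral_norm_bound)
    also have "\<dots> \<le> expectation (\<lambda>\<omega>. B * (norm (X \<omega> - xs))\<^sup>2)"
      using r_int X2 by (intro integral_mono r_le) auto
    also have "\<dots> = B * b"
      by (simp add: b_def)
    finally have "norm (r (xs + m) - expectation (\<lambda>\<omega>. r (X \<omega>))) \<le> 2 * B * b"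
      using 1 norm_triangle_ineq4[of "r (xs + m)" "expectation (\<lambda>\<omega>. r (X \<omega>))"] by simp
    then show ?thesis
      using \<open>0 \<le> h\<close> by (simp add: mult_left_mono)
  qed
  finally show ?thesis
    by (simp add: b_def)
qed

text \<open>The threshold and the constant are chosen before \<open>x0\<close>, \<open>n\<close> and
  \<open>h\<close>, which is the uniformity that the final estimates need. The bounds are obtained
  in the order fourth moment, second moment, mean, each feeding the next.\<close>

lemma sg_scheme_moments:
  fixes \<gamma> :: "nat \<Rightarrow> 'a \<Rightarrow> real^'n" and F :: "real^'n \<Rightarrow> real" and xs :: "real^'n"
  assumes \<gamma>: "iid_standard_gaussian M \<gamma>"
    and mg: "modified_gradient (grad F) A L B \<mu> h0 xs" and "0 < h0"
    and strong: "\<And>x. \<mu> * (norm (x - xs))\<^sup>2 \<le> grad F x \<bullet> (x - xs)"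
    and nw: "noise_weight vsig K"
    and \<sigma>_cont: "\<And>t. 0 \<le> t \<Longrightarrow> continuous_on UNIV (\<sigma> t)"
    and \<sigma>_lip: "\<And>s t x. 0 \<le> s \<Longrightarrow> 0 \<le> t \<Longrightarrow> norm (\<sigma> t x - \<sigma> s x) \<le> \<Lambda> * \<bar>t - s\<bar>" and "0 \<le> \<Lambda>"
    and \<sigma>_growth: "\<And>t x. 0 \<le> t \<Longrightarrow> norm (\<sigma> t x) \<le> vsig t * (1 + norm (x - xs))"
  shows "\<exists>H C. 0 < H \<and> H \<le> h0 \<and> H \<le> 1 \<and> 0 < C \<and> (\<forall>x0 n h. 0 < h \<longrightarrow> h < H \<longrightarrow>
    (let X = sg_scheme F \<sigma> \<gamma> h x0 n; \<beta> = noise_weight.discounted vsig \<mu> h n; R = 1 + norm (x0 - xs) ^ 4 in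
      X \<in> borel_measurable M \<and> integrable M (\<lambda>\<omega>. norm (X \<omega> - xs) ^ 4) \<and>
      0 \<le> \<beta> \<and> \<beta> \<le> C \<and>
      expectation (\<lambda>\<omega>. (norm (X \<omega> - xs))\<^sup>2) \<le> C * R * (\<beta> + h\<^sup>2) \<and>
      norm (expectation (\<lambda>\<omega>. X \<omega> - xs)) \<le> C * R * (sqrt \<beta> + h\<^sup>2)))"
proof -
  interpret modified_gradient "grad F" A L B \<mu> h0 xs by fact
  interpret noise_weight vsig K by fact
  obtain Q where Q: "0 \<le> Q" and step2: "\<And>x h. 0 < h \<Longrightarrow> h < h0 \<Longrightarrow> h \<le> 1 \<Longrightarrow>
      (norm (x - h *\<^sub>R grad F x - xs))\<^sup>2 \<le> exp (- 2 * \<mu> * h) * (norm (x - xs))\<^sup>2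
        + Q * h ^ 3 * ((norm (x - xs))\<^sup>2 + norm (x - xs) ^ 3)"
    using gradient_step_contraction_sq by blast
  obtain Q' where Q': "0 \<le> Q'" and step1: "\<And>x h. 0 < h \<Longrightarrow> h < h0 \<Longrightarrow> h \<le> 1 \<Longrightarrow>
      norm (x - h *\<^sub>R grad F x - xs) \<le> exp (- \<mu> * h) * norm (x - xs)
        + Q' * h ^ 3 * (norm (x - xs) + (norm (x - xs))\<^sup>2)"
    using gradient_step_contraction by blast
  have F_cont: "continuous_on UNIV (grad F)"
    using deriv has_derivative_continuous continuous_at_imp_continuous_on by blast
  have \<gamma>_indep: "indep_vars (\<lambda>_. borel) \<gamma> {1..}" and \<gamma>_gauss: "\<And>n. standard_gaussian M (\<gamma> (Suc n))"
    using \<gamma> by (auto simp: iid_standard_gaussian_def)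
  \<comment> \<open>Expressed through the density, the noise moments are visibly the same for all
    steps.\<close>
  define m2 where "m2 = (\<integral>y. (\<Prod>i\<in>UNIV. std_normal_density (y $ i)) * (norm y)\<^sup>2 \<partial>(lborel :: (real^'n) measure))"
  define m4 where "m4 = (\<integral>y. (\<Prod>i\<in>UNIV. std_normal_density (y $ i)) * norm y ^ 4 \<partial>(lborel :: (real^'n) measure))"
  have \<gamma>2: "expectation (\<lambda>\<omega>. (norm (\<gamma> (Suc n) \<omega>))\<^sup>2) = m2"
    and \<gamma>4: "expectation (\<lambda>\<omega>. norm (\<gamma> (Suc n) \<omega>) ^ 4) = m4" for n
    using \<gamma>_gauss[of n] unfolding standard_gaussian_def m2_def m4_def
    by (auto intro!: distributed_integral[symmetric] prod_nonneg)
  have m2: "0 \<le> m2" and m4: "0 \<le> m4"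
    unfolding \<gamma>2[of 0, symmetric] \<gamma>4[of 0, symmetric] by simp_all
  define W where "W = 4 * (K\<^sup>2 + \<Lambda>\<^sup>2)"
  have W0: "0 \<le> W" by (simp add: W_def)
  define Cc where "Cc = 16 * W * m2 + 6 * W\<^sup>2 * m4"
  have Cc0: "0 \<le> Cc"
    using W0 m2 m4 by (simp add: Cc_def)
  \<comment> \<open>The bounds ensure, in turn, the refined contraction,
    \<open>1 - \<mu> * h \<ge> 0\<close>, the crude contraction, and the absorption of the noise in
    the fourth moment. The extra summands in the denominators keep them positive.\<close>
  define H where "H = min (min h0 1) (min (1 / \<mu>) (min (\<mu> / (L\<^sup>2 + \<mu>)) (\<mu> / (2 * Cc + 1))))"
  have H: "0 < H" "H \<le> h0" "H \<le> 1"
    using \<open>0 < h0\<close> mu_pos Cc0 by (auto simp: H_def add_nonneg_pos)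
  \<comment> \<open>The forcing constants below come from \<open>1 + c n \<le> 2 * R\<close> (4),
    from the 4 in \<open>w n\<close> times \<open>1 + b n \<le> 3 * R\<close> (12), and from
    \<open>z n + (z n)\<^sup>2 \<le> 5 * R\<close> (5). \<open>D1\<close>, \<open>S\<close>,
    \<open>B2\<close> and \<open>D2\<close> are the constants that the scalar recursions return for
    them.\<close>
  define K1 where "K1 = 4 * Q + 12 * m2 * (1 + \<Lambda>\<^sup>2)"
  define D1 where "D1 = 1 + K1 * exp (2 * \<mu>) * (1 + 1 / (2 * \<mu>))"
  define K2 where "K2 = 5 * Q' + 2 * B * D1"
  define S where "S = 1 + K\<^sup>2 * exp (2 * \<mu>) / (2 * \<mu>)"
  define B2 where "B2 = (K2 + 2 * B * D1) * exp (2 * \<mu>) / \<mu>"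
  define D2 where "D2 = 1 + B2 + 2 * B2 * sqrt S"
  have K1: "0 \<le> K1"
    using Q m2 by (simp add: K1_def)
  have D1: "1 \<le> D1"
    using K1 mu_pos by (simp add: D1_def)
  have K2: "0 \<le> K2"
    using Q' D1 nonneg by (simp add: K2_def)
  have S1: "1 \<le> S"
    using mu_pos by (simp add: S_def)
  have B2: "0 \<le> B2"
    using K2 D1 nonneg mu_pos by (simp add: B2_def)
  have D2: "1 \<le> D2"
    using B2 S1 by (simp add: D2_def)
  have main: "sg_scheme F \<sigma> \<gamma> h x0 n \<in> borel_measurable M
      \<and> integrable M (\<lambda>\<omega>. norm (sg_scheme F \<sigma> \<gamma> h x0 n \<omega> - xs) ^ 4)
      \<and> 0 \<le> discounted \<mu> h n \<and> discounted \<mu> h n \<le> S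
      \<and> expectation (\<lambda>\<omega>. (norm (sg_scheme F \<sigma> \<gamma> h x0 n \<omega> - xs))\<^sup>2)
        \<le> (1 + norm (x0 - xs) ^ 4) * D1 * (discounted \<mu> h n + h\<^sup>2)
      \<and> norm (expectation (\<lambda>\<omega>. sg_scheme F \<sigma> \<gamma> h x0 n \<omega> - xs))
        \<le> (1 + norm (x0 - xs) ^ 4) * D2 * (sqrt (discounted \<mu> h n) + h\<^sup>2)"
    if h: "0 < h" "h < H" for x0 n h
  proof -
    have h0: "0 \<le> h" "h \<le> 1" "h < h0"
      using h H by auto
    have hL: "h * L\<^sup>2 \<le> \<mu>" and hmu: "\<mu> * h \<le> 1" and hCc: "h * (2 * Cc) \<le> \<mu>"
    proof -
      have "0 < L\<^sup>2 + \<mu>" "0 < 2 * Cc + 1"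
        using mu_pos Cc0 by (auto simp: add_nonneg_pos)
      moreover have "h \<le> \<mu> / (L\<^sup>2 + \<mu>)" "h \<le> \<mu> / (2 * Cc + 1)"
        using h by (auto simp: H_def)
      ultimately have "h * (L\<^sup>2 + \<mu>) \<le> \<mu>" "h * (2 * Cc + 1) \<le> \<mu>"
        by (simp_all add: pos_le_divide_eq)
      moreover have "0 \<le> h * \<mu>" "0 \<le> h * L\<^sup>2"
        using h mu_pos by simp_all
      ultimately show "h * L\<^sup>2 \<le> \<mu>" "h * (2 * Cc) \<le> \<mu>"
        using h by (simp_all add: distrib_left)
      have "h \<le> 1 / \<mu>"
        using h by (auto simp: H_def)
      then show "\<mu> * h \<le> 1"
        using mu_pos by (simp add: field_simps)
    qed
    define X where "X = sg_scheme F \<sigma> \<gamma> h x0"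
    define \<Phi> where "\<Phi> x = x - h *\<^sub>R grad F x" for x
    \<comment> \<open>Squared coefficient of the noise, bounded by a cell average:
      \<open>h\<^sup>2 * w n\<close> is \<open>4 * h * cell h n\<close> plus a term of order
      h^4.\<close>
    define w where "w n = 4 * (cell h n / h + \<Lambda>\<^sup>2 * h\<^sup>2)" for n
    define R where "R = 1 + norm (x0 - xs) ^ 4"
    define b where "b n = expectation (\<lambda>\<omega>. (norm (X n \<omega> - xs))\<^sup>2)" for n
    define c where "c n = expectation (\<lambda>\<omega>. norm (X n \<omega> - xs) ^ 4)" for n
    define z where "z n = norm (expectation (\<lambda>\<omega>. X n \<omega> - xs))" for n
    have R1: "1 \<le> R" by (simp add: R_def)
    have X_Suc: "X (Suc n) \<omega> = \<Phi> (X n \<omega>) + h *\<^sub>R (\<sigma> (real n * h) (X n \<omega>) *v \<gamma> (Suc n) \<omega>)" for n \<omega>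
      by (simp add: X_def \<Phi>_def)
    have indep: "indep_var borel (X n) borel (\<gamma> (Suc n))" for n
      unfolding X_def by (rule sg_scheme_indep[OF F_cont \<sigma>_cont h0(1) \<gamma>_indep])
    have X_meas[measurable]: "X n \<in> borel_measurable M" for n
      using indep_var_rv1[OF indep] .
    have \<Phi>_cont: "continuous_on UNIV \<Phi>"
      unfolding \<Phi>_def by (intro continuous_intros F_cont)
    then have \<Phi>_meas: "\<Phi> \<in> borel_measurable borel"
      by (rule borel_measurable_continuous_onI)
    have \<sigma>_meas: "\<sigma> (real n * h) \<in> borel_measurable borel" for n
      using h0 by (intro borel_measurable_continuous_onI \<sigma>_cont) simp
    have \<Phi>_crude: "(norm (\<Phi> x - xs))\<^sup>2 \<le> (1 - \<mu> * h) * (norm (x - xs))\<^sup>2" for x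
      unfolding \<Phi>_def by (rule gradient_step_crude[OF strong G_bound h0(1) hL])
    have \<Phi>_le: "(norm (\<Phi> x - xs))\<^sup>2 \<le> (norm (x - xs))\<^sup>2" for x
    proof -
      have "(1 - \<mu> * h) * (norm (x - xs))\<^sup>2 \<le> 1 * (norm (x - xs))\<^sup>2"
        using h0 mu_pos by (intro mult_right_mono) auto
      with \<Phi>_crude[of x] show ?thesis by linarith
    qed
    have \<sigma>_w: "(norm (\<sigma> (real n * h) x))\<^sup>2 \<le> w n * (1 + (norm (x - xs))\<^sup>2)" for n x
      unfolding w_def using h \<sigma>_lip \<sigma>_growth \<open>0 \<le> \<Lambda>\<close> by (intro cell_average_bound) auto
    have w0: "0 \<le> w n" for n
      unfolding w_def using cell_bounds(1)[OF h0(1)] h by simp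
    have wW: "w n \<le> W" for n
    proof -
      have "cell h n / h \<le> K\<^sup>2"
        using cell_bounds(2)[OF h0(1), of n] h by (simp add: pos_divide_le_eq mult.commute)
      moreover have "\<Lambda>\<^sup>2 * h\<^sup>2 \<le> \<Lambda>\<^sup>2 * 1"
        using h0 by (intro mult_left_mono power_le_one) auto
      ultimately show ?thesis
        by (simp add: w_def W_def)
    qed
    have int4: "integrable M (\<lambda>\<omega>. norm (X n \<omega> - xs) ^ 4)" for n
    proof (induction n)
      case 0
      then show ?case by (simp add: X_def)
    next
      case (Suc n)
      show ?case
        unfolding X_Suc
        by (rule noisy_step(1)[OF indep[of n] \<Phi>_meas \<sigma>_meas[of n] Suc
              standard_gaussian_moments[OF \<gamma>_gauss[of n]] \<Phi>_le \<sigma>_w[of n]])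
    qed
    have int: "integrable M (\<lambda>\<omega>. norm (X n \<omega> - xs) ^ k)" if "k \<le> 4" for n k
      by (rule integrable_power_le[OF int4 _ _ that]) auto
    have noisy: "b (Suc n) \<le> expectation (\<lambda>\<omega>. (norm (\<Phi> (X n \<omega>) - xs))\<^sup>2) + h\<^sup>2 * w n * m2 * (1 + b n)"
      "c (Suc n) \<le> expectation (\<lambda>\<omega>. norm (\<Phi> (X n \<omega>) - xs) ^ 4)
        + h\<^sup>2 * (16 * w n * m2 + 6 * h\<^sup>2 * (w n)\<^sup>2 * m4) * (1 + c n)"
      "expectation (\<lambda>\<omega>. X (Suc n) \<omega> - xs) = expectation (\<lambda>\<omega>. \<Phi> (X n \<omega>) - xs)" for n
      unfolding b_def c_def X_Suc \<gamma>2[of n, symmetric] \<gamma>4[of n, symmetric]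
      by (rule noisy_step(2-4)[OF indep[of n] \<Phi>_meas \<sigma>_meas[of n] int4[of n]
            standard_gaussian_moments[OF \<gamma>_gauss[of n]] \<Phi>_le \<sigma>_w[of n]])+
    have \<Phi>_int: "integrable M (\<lambda>\<omega>. norm (\<Phi> (X n \<omega>) - xs) ^ 4)" for n
    proof (rule Bochner_Integration.integrable_bound[OF int4[of n]])
      have "norm (\<Phi> x - xs) \<le> norm (x - xs)" for x
        using \<Phi>_le by (rule power2_le_imp_le) simp
      then show "AE \<omega> in M. norm (norm (\<Phi> (X n \<omega>) - xs) ^ 4) \<le> norm (norm (X n \<omega> - xs) ^ 4)"
        by (intro AE_I2) (simp add: power_mono)
    qed (use \<Phi>_meas in measurable)
    have pow_le: "norm (x - xs) ^ k \<le> 1 + norm (x - xs) ^ 4" if "k \<le> 4" for x k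
    proof (cases "norm (x - xs) \<le> 1")
      case True
      then show ?thesis
        using power_le_one[of "norm (x - xs)" k] by (simp add: add_increasing2)
    next
      case False
      then have "1 \<le> norm (x - xs)" by simp
      from power_increasing[OF that this] show ?thesis by simp
    qed
    have c0: "0 \<le> c n" for n
      by (simp add: c_def)
    \<comment> \<open>\<open>R\<close> is invariant: contraction frees \<open>\<mu> * h * R\<close>,
      and the noise adds at most \<open>2 * Cc * h\<^sup>2 * R\<close>, which the choice of
      \<open>H\<close> makes no larger.\<close>
    have c_le: "c n \<le> R" for n
    proof (induction n)
      case 0
      then show ?case
        by (simp add: c_def X_def R_def prob_space)
    next
      case (Suc n)
      have "c (Suc n) \<le> expectation (\<lambda>\<omega>. norm (\<Phi> (X n \<omega>) - xs) ^ 4)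
          + h\<^sup>2 * (16 * w n * m2 + 6 * h\<^sup>2 * (w n)\<^sup>2 * m4) * (1 + c n)"
        by (rule noisy(2))
      also have "expectation (\<lambda>\<omega>. norm (\<Phi> (X n \<omega>) - xs) ^ 4)
          \<le> expectation (\<lambda>\<omega>. (1 - \<mu> * h) * norm (X n \<omega> - xs) ^ 4)"
      proof (intro integral_mono \<Phi>_int integrable_mult_right int4)
        fix \<omega>
        have "norm (\<Phi> (X n \<omega>) - xs) ^ 4 = ((norm (\<Phi> (X n \<omega>) - xs))\<^sup>2)\<^sup>2" by simp
        also have "\<dots> \<le> ((1 - \<mu> * h) * (norm (X n \<omega> - xs))\<^sup>2)\<^sup>2"
          by (intro power_mono \<Phi>_crude) simp
        also have "\<dots> = (1 - \<mu> * h) * ((1 - \<mu> * h) * norm (X n \<omega> - xs) ^ 4)"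
          by (simp add: power2_eq_square power4_eq_xxxx mult_ac)
        also have "\<dots> \<le> 1 * ((1 - \<mu> * h) * norm (X n \<omega> - xs) ^ 4)"
          using hmu h0 mu_pos by (intro mult_right_mono) auto
        finally show "norm (\<Phi> (X n \<omega>) - xs) ^ 4 \<le> (1 - \<mu> * h) * norm (X n \<omega> - xs) ^ 4"
          by simp
      qed
      also have "\<dots> = (1 - \<mu> * h) * c n"
        by (simp add: c_def)
      also have "h\<^sup>2 * (16 * w n * m2 + 6 * h\<^sup>2 * (w n)\<^sup>2 * m4) * (1 + c n) \<le> h\<^sup>2 * Cc * (2 * R)"
      proof (intro mult_mono mult_left_mono)
        have "6 * h\<^sup>2 * (w n)\<^sup>2 * m4 \<le> 6 * 1 * W\<^sup>2 * m4"
          using h0 w0 wW m4 by (intro mult_right_mono mult_mono power_mono power_le_one) auto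
        moreover have "16 * w n * m2 \<le> 16 * W * m2"
          using wW m2 by (intro mult_right_mono) auto
        ultimately show "16 * w n * m2 + 6 * h\<^sup>2 * (w n)\<^sup>2 * m4 \<le> Cc"
          by (simp add: Cc_def)
        show "1 + c n \<le> 2 * R"
          using Suc R1 by simp
        show "0 \<le> h\<^sup>2 * Cc"
          using Cc0 by simp
        show "0 \<le> 1 + c n"
          using c0[of n] by simp
      qed (use w0[of n] m2 m4 in auto)
      also have "(1 - \<mu> * h) * c n \<le> (1 - \<mu> * h) * R"
        using Suc hmu by (intro mult_left_mono) auto
      also have "h\<^sup>2 * Cc * (2 * R) = h * (h * (2 * Cc)) * R"
        by (simp add: power2_eq_square)
      also have "\<dots> \<le> h * \<mu> * R"
        using hCc h0 R1 by (intro mult_right_mono mult_left_mono) auto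
      finally show ?case
        by (simp add: algebra_simps)
    qed
    have b_le_c: "b n \<le> 1 + c n" for n
    proof -
      have "b n \<le> expectation (\<lambda>\<omega>. 1 + norm (X n \<omega> - xs) ^ 4)"
        unfolding b_def using int[of 2] int4 by (intro integral_mono pow_le) auto
      also have "\<dots> = 1 + c n"
        using int4 by (simp add: c_def prob_space)
      finally show ?thesis .
    qed
    have b2R: "b n \<le> 2 * R" for n
      using b_le_c[of n] c_le[of n] R1 by simp
    have b_rec: "b (Suc n) \<le> exp (- (2 * \<mu>) * h) * b n + R * K1 * (h ^ 3 + h * cell h n)" for n
    proof -
      have "b (Suc n) \<le> expectation (\<lambda>\<omega>. (norm (\<Phi> (X n \<omega>) - xs))\<^sup>2) + h\<^sup>2 * w n * m2 * (1 + b n)"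
        by (rule noisy(1))
      also have "expectation (\<lambda>\<omega>. (norm (\<Phi> (X n \<omega>) - xs))\<^sup>2)
          \<le> expectation (\<lambda>\<omega>. exp (- 2 * \<mu> * h) * (norm (X n \<omega> - xs))\<^sup>2
            + Q * h ^ 3 * (2 * (1 + norm (X n \<omega> - xs) ^ 4)))"
      proof (intro integral_mono)
        show "integrable M (\<lambda>\<omega>. (norm (\<Phi> (X n \<omega>) - xs))\<^sup>2)"
          using \<Phi>_meas by (intro integrable_power_le[OF \<Phi>_int]) (measurable, auto)
        show "integrable M (\<lambda>\<omega>. exp (- 2 * \<mu> * h) * (norm (X n \<omega> - xs))\<^sup>2
            + Q * h ^ 3 * (2 * (1 + norm (X n \<omega> - xs) ^ 4)))"
          using int[of 2 n] int4[of n] by simp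
        fix \<omega>
        \<comment> \<open>Here the third power enters and the fourth moment is spent.\<close>
        have "Q * h ^ 3 * ((norm (X n \<omega> - xs))\<^sup>2 + norm (X n \<omega> - xs) ^ 3)
            \<le> Q * h ^ 3 * (2 * (1 + norm (X n \<omega> - xs) ^ 4))"
          using pow_le[of 2 "X n \<omega>"] pow_le[of 3 "X n \<omega>"] Q h0 by (intro mult_left_mono) auto
        then show "(norm (\<Phi> (X n \<omega>) - xs))\<^sup>2 \<le> exp (- 2 * \<mu> * h) * (norm (X n \<omega> - xs))\<^sup>2
            + Q * h ^ 3 * (2 * (1 + norm (X n \<omega> - xs) ^ 4))"
          using step2[OF h(1) h0(3) h0(2), of "X n \<omega>"] unfolding \<Phi>_def by linarith
      qed
      also have "\<dots> = exp (- 2 * \<mu> * h) * b n + Q * h ^ 3 * (2 * (1 + c n))"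
        using int[of 2 n] int4[of n] by (simp add: b_def c_def prob_space)
      also have "Q * h ^ 3 * (2 * (1 + c n)) \<le> Q * h ^ 3 * (4 * R)"
        using c_le[of n] R1 Q h0 by (intro mult_left_mono) auto
      also have "h\<^sup>2 * w n * m2 * (1 + b n) \<le> h\<^sup>2 * w n * m2 * (3 * R)"
        using b2R[of n] R1 w0[of n] m2 by (intro mult_left_mono) auto
      also have "h\<^sup>2 * w n * m2 * (3 * R) = 12 * m2 * R * (h * cell h n + \<Lambda>\<^sup>2 * (h * h ^ 3))"
        using h by (simp add: w_def power2_eq_square power3_eq_cube field_simps)
      also have "\<dots> \<le> 12 * m2 * R * (h * cell h n + \<Lambda>\<^sup>2 * (1 * h ^ 3))"
        using m2 R1 h0 by (intro mult_left_mono add_left_mono mult_right_mono) auto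
      finally have 1: "b (Suc n) \<le> exp (- 2 * \<mu> * h) * b n
          + R * (4 * Q * h ^ 3 + 12 * m2 * (h * cell h n + \<Lambda>\<^sup>2 * h ^ 3))"
        by (simp add: algebra_simps)
      have "4 * Q * h ^ 3 + 12 * m2 * (h * cell h n + \<Lambda>\<^sup>2 * h ^ 3) \<le> K1 * (h ^ 3 + h * cell h n)"
      proof -
        have "K1 * (h ^ 3 + h * cell h n) = 4 * Q * h ^ 3 + 12 * m2 * (h * cell h n + \<Lambda>\<^sup>2 * h ^ 3)
            + (4 * Q * (h * cell h n) + 12 * m2 * h ^ 3 + 12 * m2 * \<Lambda>\<^sup>2 * (h * cell h n))"
          by (simp add: K1_def algebra_simps)
        moreover have "0 \<le> 4 * Q * (h * cell h n) + 12 * m2 * h ^ 3 + 12 * m2 * \<Lambda>\<^sup>2 * (h * cell h n)"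
          using Q m2 h0 cell_bounds(1)[OF h0(1), of n] by (intro add_nonneg_nonneg mult_nonneg_nonneg) auto
        ultimately show ?thesis by linarith
      qed
      then have "R * (4 * Q * h ^ 3 + 12 * m2 * (h * cell h n + \<Lambda>\<^sup>2 * h ^ 3)) \<le> R * (K1 * (h ^ 3 + h * cell h n))"
        using R1 by (intro mult_left_mono) auto
      with 1 show ?thesis
        by (simp add: mult.assoc)
    qed
    have \<beta>: "exp (- (2 * \<mu>) * h) * (discounted \<mu> h n + h * cell h n) \<le> discounted \<mu> h (Suc n)"
      "discounted \<mu> h (Suc n) \<le> exp (- (2 * \<mu>) * h) * discounted \<mu> h n + K\<^sup>2 * h" for n
      using discounted_Suc[OF mu_pos h0(1,2), of n] by simp_all
    have \<beta>0: "0 \<le> discounted \<mu> h n" for n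
    proof (induction n)
      case 0
      then show ?case by (simp add: discounted_0)
    next
      case (Suc n)
      have "0 \<le> exp (- (2 * \<mu>) * h) * (discounted \<mu> h n + h * cell h n)"
        using Suc h0 cell_bounds(1)[OF h0(1), of n] by simp
      then show ?case
        using \<beta>(1)[of n] by linarith
    qed
    have \<beta>S: "discounted \<mu> h n \<le> S" for n
      unfolding S_def using mu_pos
      by (intro discounted_recursion_bounded[where \<beta> = "discounted \<mu> h" and c = "2 * \<mu>" and K = "K\<^sup>2",
            OF h0(1,2) _ _ _ \<beta>(2)])
        (auto simp: discounted_0)
    have b_0: "b 0 \<le> R"
      using pow_le[of 2 x0] by (simp add: b_def X_def R_def prob_space)
    have b_D1: "b n \<le> R * D1 * (discounted \<mu> h n + h\<^sup>2)" for n
      unfolding D1_def using mu_pos K1 R1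
      by (intro second_moment_recursion[where b = b and \<beta> = "discounted \<mu> h" and I = "cell h" and c = "2 * \<mu>"
            and R = R and K = K1, OF h0(1,2) _ _ cell_bounds(1)[OF h0(1)] _ \<beta>(1) b_0 b_rec])
        (auto simp: discounted_0)
    have z_rec: "z (Suc n) \<le> exp (- \<mu> * h) * z n + R * (K2 + 2 * B * D1) * (h ^ 3 + h * discounted \<mu> h n)" for n
    proof -
      let ?m = "expectation (\<lambda>\<omega>. X n \<omega> - xs)"
      have X1: "integrable M (\<lambda>\<omega>. X n \<omega> - xs)"
        using int[of 1 n] by (simp add: integrable_norm_iff)
      have z2: "(z n)\<^sup>2 \<le> b n"
        unfolding z_def b_def using int[of 1 n] int[of 2 n] by (intro norm_expectation_square_le) auto
      have "0 \<le> z n"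
        by (simp add: z_def)
      then have "z n \<le> 1 + (z n)\<^sup>2"
        using sum_squares_bound[of "z n" 1] by simp
      then have zz: "z n + (z n)\<^sup>2 \<le> 5 * R"
        using z2 b2R[of n] R1 by linarith
      have "z (Suc n) = norm (expectation (\<lambda>\<omega>. X n \<omega> - h *\<^sub>R grad F (X n \<omega>) - xs))"
        unfolding z_def noisy(3) by (simp add: \<Phi>_def)
      also have "\<dots> \<le> norm ((xs + ?m) - h *\<^sub>R grad F (xs + ?m) - xs) + h * (2 * B * b n)"
        unfolding b_def by (rule expectation_gradient_step[OF mg X_meas int[of 2] X1 h0(1)]) simp
      also have "norm ((xs + ?m) - h *\<^sub>R grad F (xs + ?m) - xs)
          \<le> exp (- \<mu> * h) * z n + Q' * h ^ 3 * (z n + (z n)\<^sup>2)"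
        using step1[OF h(1) h0(3) h0(2), of "xs + ?m"] by (simp add: z_def)
      also have "Q' * h ^ 3 * (z n + (z n)\<^sup>2) \<le> Q' * h ^ 3 * (5 * R)"
        using zz Q' h0 by (intro mult_left_mono) auto
      \<comment> \<open>The crude bound \<open>b n \<le> 2 * R\<close> would leave a forcing of
        order \<open>h\<close>. The refined one splits into \<open>h ^ 3\<close> and
        \<open>h\<close> times \<beta>, as \<open>mean_recursion\<close> requires.\<close>
      also have "h * (2 * B * b n) \<le> h * (2 * B * (R * D1 * (discounted \<mu> h n + h\<^sup>2)))"
        using b_D1[of n] h0 nonneg by (intro mult_left_mono) auto
      finally have 1: "z (Suc n) \<le> exp (- \<mu> * h) * z n
          + R * (5 * Q' * h ^ 3 + 2 * B * D1 * (h * discounted \<mu> h n + h ^ 3))"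
        by (simp add: power2_eq_square power3_eq_cube algebra_simps)
      have "5 * Q' * h ^ 3 + 2 * B * D1 * (h * discounted \<mu> h n + h ^ 3)
          \<le> (K2 + 2 * B * D1) * (h ^ 3 + h * discounted \<mu> h n)"
      proof -
        have "(K2 + 2 * B * D1) * (h ^ 3 + h * discounted \<mu> h n)
            = 5 * Q' * h ^ 3 + 2 * B * D1 * (h * discounted \<mu> h n + h ^ 3)
              + (5 * Q' * (h * discounted \<mu> h n) + 2 * B * D1 * (h * discounted \<mu> h n + h ^ 3))"
          by (simp add: K2_def algebra_simps)
        moreover have "0 \<le> 5 * Q' * (h * discounted \<mu> h n) + 2 * B * D1 * (h * discounted \<mu> h n + h ^ 3)"
          using Q' D1 nonneg h0 \<beta>0[of n] by (intro add_nonneg_nonneg mult_nonneg_nonneg) auto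
        ultimately show ?thesis by linarith
      qed
      then have "R * (5 * Q' * h ^ 3 + 2 * B * D1 * (h * discounted \<mu> h n + h ^ 3))
          \<le> R * ((K2 + 2 * B * D1) * (h ^ 3 + h * discounted \<mu> h n))"
        using R1 by (intro mult_left_mono) auto
      with 1 show ?thesis
        by (simp add: mult.assoc)
    qed
    have z_0: "z 0 \<le> R"
      using pow_le[of 1 x0] by (simp add: z_def X_def R_def prob_space)
    have \<beta>_dec: "exp (- 2 * \<mu> * h) * discounted \<mu> h n \<le> discounted \<mu> h (Suc n)" for n
    proof -
      have "exp (- 2 * \<mu> * h) * discounted \<mu> h n \<le> exp (- 2 * \<mu> * h) * (discounted \<mu> h n + h * cell h n)"
        using h0 cell_bounds(1)[OF h0(1), of n] by (intro mult_left_mono) auto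
      then show ?thesis
        using discounted_Suc(1)[OF mu_pos h0(1,2), of n] by (rule order_trans)
    qed
    have "z n \<le> R * D2 * (sqrt (discounted \<mu> h n) + h\<^sup>2)" for n
      unfolding D2_def B2_def using mu_pos K2 D1 nonneg R1
      by (intro mean_recursion[where z = z and \<beta> = "discounted \<mu> h" and \<mu> = \<mu> and R = R and S = S
            and K = "K2 + 2 * B * D1", OF h0(1,2) mu_pos _ discounted_0 \<beta>_dec \<beta>0 \<beta>S z_0 z_rec]) auto
    then show ?thesis
      using X_meas[of n] int4[of n] \<beta>0[of n] \<beta>S[of n] b_D1[of n]
      unfolding X_def b_def z_def R_def by blast
  qed
  show ?thesis
  proof (rule exI[of _ H], rule exI[of _ "S + D1 + D2"], intro conjI allI impI)
    show "0 < S + D1 + D2"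
      using S1 D1 D2 by simp
    fix x0 n h assume h: "0 < h" "h < H"
    have mono_C: "R * D * t \<le> (S + D1 + D2) * R * t" if "0 \<le> R" "D \<le> S + D1 + D2" "0 \<le> t" for R D t :: real
      using mult_right_mono[OF mult_left_mono[OF that(2,1)] that(3)] by (simp only: mult.commute[of R])
    have R: "0 \<le> 1 + norm (x0 - xs) ^ 4"
      by simp
    note m = main[OF h, of x0 n]
    have t: "0 \<le> discounted \<mu> h n + h\<^sup>2" "0 \<le> sqrt (discounted \<mu> h n) + h\<^sup>2"
      using m by simp_all
    have D: "D1 \<le> S + D1 + D2" "D2 \<le> S + D1 + D2" "S \<le> S + D1 + D2"
      using S1 D1 D2 by simp_all
    show "let X = sg_scheme F \<sigma> \<gamma> h x0 n; \<beta> = discounted \<mu> h n; R = 1 + norm (x0 - xs) ^ 4 in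
      X \<in> borel_measurable M \<and> integrable M (\<lambda>\<omega>. norm (X \<omega> - xs) ^ 4) \<and>
      0 \<le> \<beta> \<and> \<beta> \<le> S + D1 + D2 \<and>
      expectation (\<lambda>\<omega>. (norm (X \<omega> - xs))\<^sup>2) \<le> (S + D1 + D2) * R * (\<beta> + h\<^sup>2) \<and>
      norm (expectation (\<lambda>\<omega>. X \<omega> - xs)) \<le> (S + D1 + D2) * R * (sqrt \<beta> + h\<^sup>2)"
      using m mono_C[OF R D(1) t(1)] mono_C[OF R D(2) t(2)] D(3) unfolding Let_def by force
  qed (use H in auto)
qed

end

section \<open>Taylor expansion of test functions and conclusion\<close>

lemma (in prob_space) expectation_taylor:
  fixes \<phi> :: "'b::euclidean_space \<Rightarrow> real" and X :: "'a \<Rightarrow> 'b"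
  assumes \<phi>: "\<And>z. \<phi> differentiable (at z)"
    and S: "\<And>y x. norm (grad \<phi> y - grad \<phi> x) \<le> S * norm (y - x)" "0 \<le> S"
    and [measurable]: "X \<in> borel_measurable M"
    and X1: "integrable M (\<lambda>\<omega>. X \<omega> - xs)" and X2: "integrable M (\<lambda>\<omega>. (norm (X \<omega> - xs))\<^sup>2)"
  shows "integrable M (\<lambda>\<omega>. \<phi> (X \<omega>))"
    and "\<bar>expectation (\<lambda>\<omega>. \<phi> (X \<omega>)) - \<phi> xs - grad \<phi> xs \<bullet> expectation (\<lambda>\<omega>. X \<omega> - xs)\<bar>
      \<le> S * expectation (\<lambda>\<omega>. (norm (X \<omega> - xs))\<^sup>2)"
proof -
  \<comment> \<open>The linear part sees only the mean of \<open>X - xs\<close>. The remainder is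
    controlled by the second moment, which also makes \<open>\<phi>\<close> of \<open>X\<close>
    integrable.\<close>
  define r where "r x = \<phi> x - \<phi> xs - grad \<phi> xs \<bullet> (x - xs)" for x
  have r_le: "\<bar>r x\<bar> \<le> S * (norm (x - xs))\<^sup>2" for x
    unfolding r_def by (rule grad_lipschitz_taylor[OF \<phi> S])
  have "continuous_on UNIV \<phi>"
    using \<phi> by (auto intro!: differentiable_imp_continuous_on simp: differentiable_on_def)
  then have [measurable]: "\<phi> \<in> borel_measurable borel"
    by (rule borel_measurable_continuous_onI)
  have [measurable]: "r \<in> borel_measurable borel"
    unfolding r_def[abs_def] by measurable
  have r_int: "integrable M (\<lambda>\<omega>. r (X \<omega>))"
  proof (rule Bochner_Integration.integrable_bound)
    show "integrable M (\<lambda>\<omega>. S * (norm (X \<omega> - xs))\<^sup>2)"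
      using X2 by simp
    show "AE \<omega> in M. norm (r (X \<omega>)) \<le> norm (S * (norm (X \<omega> - xs))\<^sup>2)"
      using r_le by (intro AE_I2) (auto intro: order_trans[OF _ abs_ge_self])
  qed measurable
  have lin_int: "integrable M (\<lambda>\<omega>. grad \<phi> xs \<bullet> (X \<omega> - xs))"
    using X1 by simp
  have eq: "(\<lambda>\<omega>. \<phi> (X \<omega>)) = (\<lambda>\<omega>. \<phi> xs + grad \<phi> xs \<bullet> (X \<omega> - xs) + r (X \<omega>))"
    by (auto simp: r_def)
  show "integrable M (\<lambda>\<omega>. \<phi> (X \<omega>))"
    unfolding eq by (intro Bochner_Integration.integrable_add lin_int r_int integrable_const)
  have "expectation (\<lambda>\<omega>. \<phi> (X \<omega>))
      = \<phi> xs + expectation (\<lambda>\<omega>. grad \<phi> xs \<bullet> (X \<omega> - xs)) + expectation (\<lambda>\<omega>. r (X \<omega>))"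
    unfolding eq using lin_int r_int by (simp add: prob_space)
  moreover have "expectation (\<lambda>\<omega>. grad \<phi> xs \<bullet> (X \<omega> - xs)) = grad \<phi> xs \<bullet> expectation (\<lambda>\<omega>. X \<omega> - xs)"
    by (rule integral_inner_right) (use X1 in auto)
  moreover have "\<bar>expectation (\<lambda>\<omega>. r (X \<omega>))\<bar> \<le> S * expectation (\<lambda>\<omega>. (norm (X \<omega> - xs))\<^sup>2)"
  proof -
    have "\<bar>expectation (\<lambda>\<omega>. r (X \<omega>))\<bar> \<le> expectation (\<lambda>\<omega>. \<bar>r (X \<omega>)\<bar>)"
      using integral_norm_bound[of M "\<lambda>\<omega>. r (X \<omega>)"] by simp
    also have "\<dots> \<le> expectation (\<lambda>\<omega>. S * (norm (X \<omega> - xs))\<^sup>2)"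
      using r_int X2 by (intro integral_mono r_le) auto
    finally show ?thesis by simp
  qed
  ultimately show "\<bar>expectation (\<lambda>\<omega>. \<phi> (X \<omega>)) - \<phi> xs - grad \<phi> xs \<bullet> expectation (\<lambda>\<omega>. X \<omega> - xs)\<bar>
      \<le> S * expectation (\<lambda>\<omega>. (norm (X \<omega> - xs))\<^sup>2)"
    by simp
qed

text \<open>The moment bounds carry a fourth power of the initial distance; this passes to the fifth
  power of the claim.\<close>

lemma power4_le_power5:
  fixes r :: real
  assumes "0 \<le> r"
  shows "1 + r ^ 4 \<le> 2 * (1 + r ^ 5)"
proof (cases "r \<le> 1")
  case True
  then have "r ^ 4 \<le> 1"
    using assms by (rule power_le_one[rotated])
  then show ?thesis
    using zero_le_power[OF assms, of 5] unfolding distrib_left by linarith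
next
  case False
  then have "r ^ 4 \<le> r ^ 5"
    by (intro power_increasing) auto
  then show ?thesis
    using zero_le_power[OF assms, of 5] unfolding distrib_left by linarith
qed

lemma square_le_powr:
  fixes r :: real
  assumes "0 \<le> r"
  shows "1 + r\<^sup>2 \<le> 2 * (1 + r powr (5 / 2))"
proof (cases "r \<le> 1")
  case True
  then have "r\<^sup>2 \<le> 1"
    using assms by (rule power_le_one[rotated])
  then show ?thesis
    using powr_ge_zero[of r "5 / 2"] unfolding distrib_left by linarith
next
  case False
  then have "r\<^sup>2 = r powr 2"
    by (simp add: powr_numeral)
  also have "\<dots> \<le> r powr (5 / 2)"
    using False by (intro powr_mono) auto
  finally show ?thesis
    using powr_ge_zero[of r "5 / 2"] unfolding distrib_left by linarith
qed

theorem theorem2: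
  fixes M :: "'w measure"
    and \<gamma> :: "nat \<Rightarrow> 'w \<Rightarrow> real^'n"
    and F :: "real^'n \<Rightarrow> real"
    and \<sigma> :: "real \<Rightarrow> real^'n \<Rightarrow> real^'n^'n"
    and vsig :: "real \<Rightarrow> real"
    and hmax \<mu> :: real
  assumes "prob_space M"
    and "iid_standard_gaussian M \<gamma>"
    and "0 < hmax"
    and "F_strong hmax \<mu> F"
    and "sigma_strong (minimizer F) vsig \<sigma>"
  shows "\<exists>H C. 0 < H \<and> H < hmax \<and> 0 < C \<and>
    (\<forall>x0 N h. 1 \<le> N \<and> 0 < h \<and> h < H \<longrightarrow>
      (let xstar = minimizer F;
           T = real N * h;
           X = sg_scheme F \<sigma> \<gamma> h x0 N
       in
        (\<forall>\<phi> :: real^'n \<Rightarrow> real.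
           C_class 3 \<phi> \<and> (\<forall>m\<in>{2, 3}. \<exists>B. deriv_bounded_by B m \<phi>) \<longrightarrow>
             integrable M (\<lambda>\<omega>. \<phi> (X \<omega>)) \<and>
             \<bar>(LINT \<omega>|M. \<phi> (X \<omega>)) - \<phi> xstar\<bar>
               \<le> C * (norm (grad \<phi> xstar) + deriv_seminorm 2 \<phi> + deriv_seminorm 3 \<phi>)
                   * (1 + norm (x0 - xstar) ^ 5)
                   * (exp (- \<mu> * T) * sqrt (1 + h * rho \<mu> vsig T) + h\<^sup>2)) \<and>
        (integrable M (\<lambda>\<omega>. F (X \<omega>)) \<and>
         (LINT \<omega>|M. F (X \<omega>)) - F xstar
           \<le> C * (1 + norm (x0 - xstar) ^ 5)
               * (exp (- 2 * \<mu> * T) * (1 + h * rho \<mu> vsig T) + h\<^sup>2)) \<and>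
        (integrable M (\<lambda>\<omega>. norm (X \<omega> - xstar)) \<and>
         integrable M (\<lambda>\<omega>. (norm (X \<omega> - xstar))\<^sup>2) \<and>
         (LINT \<omega>|M. norm (X \<omega> - xstar)) \<le> sqrt (LINT \<omega>|M. (norm (X \<omega> - xstar))\<^sup>2) \<and>
         sqrt (LINT \<omega>|M. (norm (X \<omega> - xstar))\<^sup>2)
           \<le> C * (1 + norm (x0 - xstar) powr (5 / 2))
               * (exp (- \<mu> * T) * sqrt (1 + h * rho \<mu> vsig T) + h))))"
proof -
  interpret prob_space M by fact
  define xs where "xs = minimizer F"
  obtain L B h0 where h0: "0 < h0" "h0 < hmax"
    and mg: "modified_gradient (grad F) (\<lambda>x. frechet_derivative (grad F) (at x)) L B \<mu> h0 xs"
    using F_strong_modified_gradient[OF assms(4)] unfolding xs_def by blast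
  interpret modified_gradient "grad F" "\<lambda>x. frechet_derivative (grad F) (at x)" L B \<mu> h0 xs
    by fact
  have "C_class 5 F" and sm: "strongly_monotone \<mu> (grad F)"
    using assms(4) by (auto simp: F_strong_def)
  then have F_diff: "F differentiable (at x)" for x
    by (simp add: numeral_eq_Suc)
  have strong: "\<mu> * (norm (x - xs))\<^sup>2 \<le> grad F x \<bullet> (x - xs)" for x
    using sm[unfolded strongly_monotone_def, rule_format, of x xs] by (simp add: zero)
  have meas: "set_borel_measurable borel {0..} vsig" and bdd: "bounded (vsig ` {0..})"
    and growth: "\<And>t x. 0 \<le> t \<Longrightarrow> norm (\<sigma> t x) / (1 + norm (x - xs)) \<le> vsig t"
    and \<sigma>_C: "\<And>t. 0 \<le> t \<Longrightarrow> C_class 3 (\<sigma> t)"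
    using assms(5) by (auto simp: sigma_strong_def xs_def)
  obtain \<Lambda> where \<Lambda>: "0 < \<Lambda>" "\<And>s t x. 0 \<le> s \<Longrightarrow> 0 \<le> t \<Longrightarrow> norm (\<sigma> t x - \<sigma> s x) \<le> \<Lambda> * \<bar>t - s\<bar>"
  proof -
    have "\<exists>\<Lambda>>0. \<forall>t1\<ge>0. \<forall>t2\<ge>0. \<forall>x. norm (\<sigma> t2 x - \<sigma> t1 x) \<le> \<Lambda> * \<bar>t2 - t1\<bar>"
      using assms(5) by (simp only: sigma_strong_def)
    then show ?thesis
      using that by blast
  qed
  obtain K where K: "\<And>t. 0 \<le> t \<Longrightarrow> \<bar>vsig t\<bar> \<le> K"
    using bdd by (auto simp: bounded_iff)
  have nw: "noise_weight vsig K"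
    using meas K by unfold_locales
  have \<sigma>_cont: "continuous_on UNIV (\<sigma> t)" if "0 \<le> t" for t
    using \<sigma>_C[OF that] by (auto intro!: differentiable_imp_continuous_on simp: differentiable_on_def numeral_3_eq_3)
  have \<sigma>_growth: "norm (\<sigma> t x) \<le> vsig t * (1 + norm (x - xs))" if "0 \<le> t" for t x
  proof -
    have "0 < 1 + norm (x - xs)"
      by (simp add: add_pos_nonneg)
    then show ?thesis
      using growth[OF that, of x] by (simp add: pos_divide_le_eq)
  qed
  obtain H C0 where H: "0 < H" "H \<le> h0" "H \<le> 1" and C0: "0 < C0"
    and moments: "\<And>x0 n h. 0 < h \<Longrightarrow> h < H \<Longrightarrow>
      (let X = sg_scheme F \<sigma> \<gamma> h x0 n; \<beta> = noise_weight.discounted vsig \<mu> h n; R = 1 + norm (x0 - xs) ^ 4 in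
        X \<in> borel_measurable M \<and> integrable M (\<lambda>\<omega>. norm (X \<omega> - xs) ^ 4) \<and>
        0 \<le> \<beta> \<and> \<beta> \<le> C0 \<and>
        expectation (\<lambda>\<omega>. (norm (X \<omega> - xs))\<^sup>2) \<le> C0 * R * (\<beta> + h\<^sup>2) \<and>
        norm (expectation (\<lambda>\<omega>. X \<omega> - xs)) \<le> C0 * R * (sqrt \<beta> + h\<^sup>2))"
    using sg_scheme_moments[OF assms(2) mg h0(1) strong nw \<sigma>_cont \<Lambda>(2) less_imp_le[OF \<Lambda>(1)] \<sigma>_growth]
    by blast
  \<comment> \<open>One constant dominating those of the three estimates; see \<open>C_ge\<close>,
    listed in the order weak error, residual, strong error.\<close>
  define C where "C = 2 * (1 + C0)\<^sup>2 * (1 + L)"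
  have L0: "0 \<le> L" by (rule nonneg)
  have C_pos: "0 < C"
    using C0 L0 by (simp add: C_def add_pos_nonneg)
  have C_ge: "2 * (C0 * (1 + C0)) \<le> C" "2 * (L * C0) \<le> C" "2 * (1 + C0) \<le> C"
  proof -
    have "C = 2 + 4 * C0 + 2 * (C0 * C0) + 2 * L + 2 * (L * (C0 * C0)) + 4 * (L * C0)"
      by (simp add: C_def power2_eq_square algebra_simps)
    moreover have "0 \<le> L * (C0 * C0)" "0 \<le> L * C0" "0 \<le> C0 * C0"
      using C0 L0 by simp_all
    moreover have "2 * (C0 * (1 + C0)) = 2 * C0 + 2 * (C0 * C0)" "2 * (1 + C0) = 2 + 2 * C0"
      by (simp_all add: algebra_simps)
    ultimately show "2 * (C0 * (1 + C0)) \<le> C" "2 * (L * C0) \<le> C" "2 * (1 + C0) \<le> C"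
      using C0 L0 by linarith+
  qed
  show ?thesis
  proof (rule exI[of _ H], rule exI[of _ C], intro conjI allI impI)
    show "0 < H" "0 < C" by fact+
    show "H < hmax" using H h0 by simp
    fix x0 :: "real^'n" and N :: nat and h :: real
    assume Nh: "1 \<le> N \<and> 0 < h \<and> h < H"
    then have h: "0 < h" "h < H" "h \<le> 1"
      using H by auto
    define X where "X = sg_scheme F \<sigma> \<gamma> h x0 N"
    define T where "T = real N * h"
    define \<beta> where "\<beta> = exp (- 2 * \<mu> * T) * (1 + h * rho \<mu> vsig T)"
    define r where "r = norm (x0 - xs)"
    define b where "b = expectation (\<lambda>\<omega>. (norm (X \<omega> - xs))\<^sup>2)"
    define z where "z = expectation (\<lambda>\<omega>. X \<omega> - xs)"
    have r0: "0 \<le> r" by (simp add: r_def)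
    have \<beta>_eq: "\<beta> = noise_weight.discounted vsig \<mu> h N"
      by (simp add: \<beta>_def T_def noise_weight.discounted_def[OF nw])
    have X_meas[measurable]: "X \<in> borel_measurable M"
      and X4: "integrable M (\<lambda>\<omega>. norm (X \<omega> - xs) ^ 4)"
      and \<beta>: "0 \<le> \<beta>" "\<beta> \<le> C0"
      and b: "b \<le> C0 * (1 + r ^ 4) * (\<beta> + h\<^sup>2)"
      and z: "norm z \<le> C0 * (1 + r ^ 4) * (sqrt \<beta> + h\<^sup>2)"
      using moments[OF h(1,2), of x0 N] unfolding Let_def X_def b_def z_def r_def \<beta>_eq by auto
    have X_int: "integrable M (\<lambda>\<omega>. norm (X \<omega> - xs))" "integrable M (\<lambda>\<omega>. (norm (X \<omega> - xs))\<^sup>2)"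
      using integrable_power_le[OF X4, of 1] integrable_power_le[OF X4, of 2] by simp_all
    then have X1: "integrable M (\<lambda>\<omega>. X \<omega> - xs)"
      by (simp add: integrable_norm_iff)
    have b0: "0 \<le> b" by (simp add: b_def)
    have sqrt_\<beta>: "sqrt \<beta> = exp (- \<mu> * T) * sqrt (1 + h * rho \<mu> vsig T)"
    proof -
      have "exp (- 2 * \<mu> * T) = (exp (- \<mu> * T))\<^sup>2"
        by (simp add: exp_double[symmetric])
      then show ?thesis
        by (simp add: \<beta>_def real_sqrt_mult)
    qed
    \<comment> \<open>Since \<beta> is bounded, it is at most a constant times its root, so the
      quadratic part of the expansion fits into the weak rate.\<close>
    have \<beta>_sqrt: "\<beta> + h\<^sup>2 \<le> (1 + C0) * (sqrt \<beta> + h\<^sup>2)"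
    proof -
      have "0 \<le> sqrt \<beta>"
        using \<beta> by simp
      then have "sqrt \<beta> \<le> 1 + \<beta>"
        using \<beta> sum_squares_bound[of "sqrt \<beta>" 1] by simp
      then have "sqrt \<beta> * sqrt \<beta> \<le> (1 + C0) * sqrt \<beta>"
        using \<beta> by (intro mult_right_mono) auto
      moreover have "h\<^sup>2 \<le> (1 + C0) * h\<^sup>2"
        using C0 by (simp add: distrib_right)
      ultimately show ?thesis
        using \<beta> by (simp add: distrib_left)
    qed
    have r45: "1 + r ^ 4 \<le> 2 * (1 + r ^ 5)"
      using r0 by (rule power4_le_power5)
    have "(\<forall>\<phi> :: real^'n \<Rightarrow> real.
           C_class 3 \<phi> \<and> (\<forall>m\<in>{2, 3}. \<exists>B. deriv_bounded_by B m \<phi>) \<longrightarrow>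
             integrable M (\<lambda>\<omega>. \<phi> (X \<omega>)) \<and>
             \<bar>(LINT \<omega>|M. \<phi> (X \<omega>)) - \<phi> xs\<bar>
               \<le> C * (norm (grad \<phi> xs) + deriv_seminorm 2 \<phi> + deriv_seminorm 3 \<phi>)
                   * (1 + r ^ 5) * (sqrt \<beta> + h\<^sup>2))"
    proof (intro allI impI)
      fix \<phi> :: "real^'n \<Rightarrow> real"
      assume \<phi>: "C_class 3 \<phi> \<and> (\<forall>m\<in>{2, 3}. \<exists>B. deriv_bounded_by B m \<phi>)"
      define s where "s = deriv_seminorm 2 \<phi>"
      define g where "g = norm (grad \<phi> xs)"
      have \<phi>2: "C_class 2 \<phi>"
        using \<phi> C_class_SucD[of 2 \<phi>] by (simp add: eval_nat_numeral)
      obtain B2 B3 where B: "deriv_bounded_by B2 2 \<phi>" "deriv_bounded_by B3 3 \<phi>"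
        using \<phi> by auto
      have s: "deriv_bounded_by s 2 \<phi>" "0 \<le> s" "0 \<le> deriv_seminorm 3 \<phi>"
        using deriv_seminorm_bounds[OF B(1)] deriv_seminorm_bounds[OF B(2)] by (simp_all add: s_def)
      have g0: "0 \<le> g" by (simp add: g_def)
      have \<phi>_diff: "\<phi> differentiable (at x)" for x
        using \<phi>2 by (simp add: numeral_2_eq_2)
      note taylor = expectation_taylor[OF \<phi>_diff deriv_bounded_by_grad_lipschitz[OF \<phi>2 s(1,2)] s(2)
          X_meas X1 X_int(2)]
      have "\<bar>expectation (\<lambda>\<omega>. \<phi> (X \<omega>)) - \<phi> xs\<bar> \<le> \<bar>grad \<phi> xs \<bullet> z\<bar> + s * b"
        using taylor(2) unfolding z_def b_def by linarith
      also have "\<dots> \<le> g * norm z + s * b"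
        unfolding g_def using Cauchy_Schwarz_ineq2 by (intro add_mono) auto
      also have "\<dots> \<le> g * (C0 * (1 + r ^ 4) * (sqrt \<beta> + h\<^sup>2))
          + s * (C0 * (1 + r ^ 4) * ((1 + C0) * (sqrt \<beta> + h\<^sup>2)))"
      proof (intro add_mono mult_left_mono z g0 s)
        have "C0 * (1 + r ^ 4) * (\<beta> + h\<^sup>2) \<le> C0 * (1 + r ^ 4) * ((1 + C0) * (sqrt \<beta> + h\<^sup>2))"
          using C0 r0 by (intro mult_left_mono \<beta>_sqrt) auto
        then show "b \<le> C0 * (1 + r ^ 4) * ((1 + C0) * (sqrt \<beta> + h\<^sup>2))"
          using b by linarith
      qed
      also have "\<dots> = C0 * (1 + r ^ 4) * (sqrt \<beta> + h\<^sup>2) * (g + s * (1 + C0))"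
        by (simp add: algebra_simps)
      also have "\<dots> \<le> C0 * (2 * (1 + r ^ 5)) * (sqrt \<beta> + h\<^sup>2) * ((1 + C0) * (g + s + deriv_seminorm 3 \<phi>))"
      proof (intro mult_mono r45)
        have "0 \<le> C0 * g" "0 \<le> C0 * deriv_seminorm 3 \<phi>"
          using C0 g0 s(3) by simp_all
        then show "g + s * (1 + C0) \<le> (1 + C0) * (g + s + deriv_seminorm 3 \<phi>)"
          using s(3) by (simp add: algebra_simps)
      qed (use C0 \<beta> s g0 r0 in auto)
      also have "\<dots> = (2 * (C0 * (1 + C0))) * ((g + s + deriv_seminorm 3 \<phi>) * (1 + r ^ 5) * (sqrt \<beta> + h\<^sup>2))"
        by (simp only: mult_ac)
      also have "\<dots> \<le> C * ((g + s + deriv_seminorm 3 \<phi>) * (1 + r ^ 5) * (sqrt \<beta> + h\<^sup>2))"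
        using s g0 \<beta> r0 by (intro mult_right_mono C_ge) auto
      finally show "integrable M (\<lambda>\<omega>. \<phi> (X \<omega>)) \<and>
             \<bar>(LINT \<omega>|M. \<phi> (X \<omega>)) - \<phi> xs\<bar>
               \<le> C * (norm (grad \<phi> xs) + deriv_seminorm 2 \<phi> + deriv_seminorm 3 \<phi>)
                   * (1 + r ^ 5) * (sqrt \<beta> + h\<^sup>2)"
        using taylor(1) by (simp add: g_def s_def mult.assoc)
    qed
    moreover have "integrable M (\<lambda>\<omega>. F (X \<omega>)) \<and>
      (LINT \<omega>|M. F (X \<omega>)) - F xs \<le> C * (1 + r ^ 5) * (\<beta> + h\<^sup>2)"
    proof
      note taylor = expectation_taylor[OF F_diff lip nonneg(1) X_meas X1 X_int(2)]
      show "integrable M (\<lambda>\<omega>. F (X \<omega>))"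
        by (rule taylor(1))
      \<comment> \<open>The gradient of \<open>F\<close> vanishes at the minimizer, so the linear
        part drops out and the residual decays like \<beta>, not like its root.\<close>
      have "expectation (\<lambda>\<omega>. F (X \<omega>)) - F xs \<le> L * b"
        using taylor(2) by (simp add: zero b_def)
      also have "\<dots> \<le> L * (C0 * (2 * (1 + r ^ 5)) * (\<beta> + h\<^sup>2))"
      proof (rule mult_left_mono[OF order_trans[OF b] L0])
        show "C0 * (1 + r ^ 4) * (\<beta> + h\<^sup>2) \<le> C0 * (2 * (1 + r ^ 5)) * (\<beta> + h\<^sup>2)"
          using C0 \<beta> by (intro mult_right_mono mult_left_mono r45) auto
      qed
      also have "\<dots> = (2 * (L * C0)) * ((1 + r ^ 5) * (\<beta> + h\<^sup>2))"
        by (simp only: mult_ac)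
      also have "\<dots> \<le> C * ((1 + r ^ 5) * (\<beta> + h\<^sup>2))"
        using \<beta> r0 by (intro mult_right_mono C_ge) auto
      finally show "expectation (\<lambda>\<omega>. F (X \<omega>)) - F xs \<le> C * (1 + r ^ 5) * (\<beta> + h\<^sup>2)"
        by (simp add: mult.assoc)
    qed
    moreover have "(LINT \<omega>|M. norm (X \<omega> - xs)) \<le> sqrt b"
    proof (rule real_le_rsqrt)
      show "(expectation (\<lambda>\<omega>. norm (X \<omega> - xs)))\<^sup>2 \<le> b"
        unfolding b_def using X_int by (rule expectation_square_le)
    qed
    moreover have "sqrt b \<le> C * (1 + r powr (5 / 2)) * (sqrt \<beta> + h)"
    proof -
      \<comment> \<open>Written as a square so that the root distributes over the factors. Taking it
        lowers h^2 to \<open>h\<close> and the fourth power of the initial distance to the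
        second.\<close>
      have "b \<le> ((1 + C0) * (1 + r\<^sup>2) * (sqrt \<beta> + h))\<^sup>2"
      proof -
        have "C0 * (1 + r ^ 4) * (\<beta> + h\<^sup>2) \<le> (1 + C0)\<^sup>2 * (1 + r\<^sup>2)\<^sup>2 * (sqrt \<beta> + h)\<^sup>2"
        proof (intro mult_mono)
          show "C0 \<le> (1 + C0)\<^sup>2"
            using C0 by (simp add: power2_sum)
          show "1 + r ^ 4 \<le> (1 + r\<^sup>2)\<^sup>2"
            by (simp add: power2_sum)
          show "\<beta> + h\<^sup>2 \<le> (sqrt \<beta> + h)\<^sup>2"
            using \<beta> h by (simp add: power2_sum)
        qed (use C0 \<beta> in auto)
        then show ?thesis
          using b by (simp only: power_mult_distrib)
      qed
      then have "sqrt b \<le> (1 + C0) * (1 + r\<^sup>2) * (sqrt \<beta> + h)"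
        using C0 \<beta> h by (intro real_le_lsqrt) auto
      also have "\<dots> \<le> (1 + C0) * (2 * (1 + r powr (5 / 2))) * (sqrt \<beta> + h)"
        using C0 \<beta> h by (intro mult_right_mono mult_left_mono square_le_powr r0) auto
      also have "\<dots> = (2 * (1 + C0)) * ((1 + r powr (5 / 2)) * (sqrt \<beta> + h))"
        by (simp only: mult_ac)
      also have "\<dots> \<le> C * ((1 + r powr (5 / 2)) * (sqrt \<beta> + h))"
        using \<beta> h by (intro mult_right_mono C_ge) auto
      finally show ?thesis
        by (simp add: mult.assoc)
    qed
    ultimately show "let xstar = minimizer F; T = real N * h; X = sg_scheme F \<sigma> \<gamma> h x0 N
       in
        (\<forall>\<phi> :: real^'n \<Rightarrow> real.
           C_class 3 \<phi> \<and> (\<forall>m\<in>{2, 3}. \<exists>B. deriv_bounded_by B m \<phi>) \<longrightarrow>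
             integrable M (\<lambda>\<omega>. \<phi> (X \<omega>)) \<and>
             \<bar>(LINT \<omega>|M. \<phi> (X \<omega>)) - \<phi> xstar\<bar>
               \<le> C * (norm (grad \<phi> xstar) + deriv_seminorm 2 \<phi> + deriv_seminorm 3 \<phi>)
                   * (1 + norm (x0 - xstar) ^ 5)
                   * (exp (- \<mu> * T) * sqrt (1 + h * rho \<mu> vsig T) + h\<^sup>2)) \<and>
        (integrable M (\<lambda>\<omega>. F (X \<omega>)) \<and>
         (LINT \<omega>|M. F (X \<omega>)) - F xstar
           \<le> C * (1 + norm (x0 - xstar) ^ 5)
               * (exp (- 2 * \<mu> * T) * (1 + h * rho \<mu> vsig T) + h\<^sup>2)) \<and>
        (integrable M (\<lambda>\<omega>. norm (X \<omega> - xstar)) \<and>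
         integrable M (\<lambda>\<omega>. (norm (X \<omega> - xstar))\<^sup>2) \<and>
         (LINT \<omega>|M. norm (X \<omega> - xstar)) \<le> sqrt (LINT \<omega>|M. (norm (X \<omega> - xstar))\<^sup>2) \<and>
         sqrt (LINT \<omega>|M. (norm (X \<omega> - xstar))\<^sup>2)
           \<le> C * (1 + norm (x0 - xstar) powr (5 / 2))
               * (exp (- \<mu> * T) * sqrt (1 + h * rho \<mu> vsig T) + h))"
      unfolding Let_def xs_def[symmetric] T_def[symmetric] X_def[symmetric] r_def[symmetric]
        sqrt_\<beta>[symmetric] \<beta>_def[symmetric] b_def[symmetric]
      using X_int by blast
  qed
qed

end
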